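(* Let $\mathcal{C}=(C_1,\dots,C_m)$ be any arrangement of collinear cameras (all $m$ centers lie on a common line). Then $\widetilde{I}_{\mathcal{C}}$ is the vanishing ideal of its line multiview variety, i.e. $\widetilde{I}_{\mathcal{C}}=I(\mathcal{L}_{\mathcal{C}})$.
   Context: A camera is a matrix $C\in\mathbb{C}^{3\times4}$ of rank $3$ with center $\ker C\in\mathbb{P}^3$. A camera arrangement is a tuple $\mathcal{C}=(C_1,\dots,C_m)$ of $m\ge2$ cameras with pairwise distinct centers $c_1,\dots,c_m$ (standing assumption). The line multiview variety $\mathcal{L}_{\mathcal{C}}\subseteq(\mathbb{P}^2)^m$ is the Zariski closure of the set of tuples $(\ell_1,\dots,\ell_m)$, $\ell_i=(C_ia)\times(C_ib)$ (cross product), where $a,b$ span a line in $\mathbb{P}^3$ containing no center. Let $R=\mathbb{C}[\ell_{i,j}\mid1\le i\le3,1\le j\le m]$, $\ell_k=(\ell_{1,k},\ell_{2,k},\ell_{3,k})^T$, $M(\ell)=\begin{bmatrix}C_1^T\ell_1&\cdots&C_m^T\ell_m\end{bmatrix}\in R^{4\times m}$; $I(\mathcal{L}_{\mathcal{C}})\subseteq R$ is the (multihomogeneous) ideal of all polynomials vanishing on $\mathcal{L}_{\mathcal{C}}$. For a $4$-element set $\sigma=\{i_1<i_2<i_3<i_4\}\subseteq[m]$ of indices of collinear cameras let $E_\sigma$ be the line spanned by their centers, let $E_\sigma^*$ be any chosen line disjoint from $E_\sigma$, and $f=(f_1,f_2,f_3)$ (depending on $\sigma$) three distinct points of $E_\sigma^*$.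 Fix representatives in $\mathbb{C}^4$ of $c_i,f_1,f_2,f_3$. For $i\in\sigma$ let $h_i=C_i^T\ell_i$ and $e_i(\ell_i)=c_i-(h_i^Tf_2)f_1+(h_i^Tf_1)f_2$. Let $\nu:\mathbb{C}^4\to\mathbb{C}^{10}$, $\nu(x,y,z,w)=(x^2,y^2,z^2,w^2,xy,xz,xw,yz,yw,zw)^T$. $\Phi_{\mathcal{C},f,\sigma}(\ell)$ is the $10\times10$ matrix obtained by applying $\nu$ to each column of $\begin{bmatrix}c_{i_1}&c_{i_2}&c_{i_3}&f_1&f_2&f_3&e_{i_1}(\ell_{i_1})&e_{i_2}(\ell_{i_2})&e_{i_3}(\ell_{i_3})&e_{i_4}(\ell_{i_4})\end{bmatrix}$. Finally $$\widetilde{I}_{\mathcal{C}}:=\langle3\times3\text{-minors of }M(\ell)\rangle+\sum_{\sigma\in\mathcal{J}}\langle\det\Phi_{\mathcal{C},f,\sigma}(\ell)\rangle\subseteq R,$$ where $\mathcal{J}$ is the collection of index sets of four collinear cameras (here all of $\binom{[m]}{4}$). *)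

theory Defs
  imports
    "HOL-Analysis.Analysis"
    "HOL-Library.Poly_Mapping"
    "HOL-Library.Set_Algebras"
begin

section \<open>Projective points and lines\<close>

text \<open>
  Points (lines) of projective space are the linear subspaces of dimension one (two) of the
  coordinate space. The complex-linear notions are the ones with prefix \<open>vec\<close>; the
  unprefixed \<open>span\<close>, \<open>dim\<close> and \<open>subspace\<close> of HOL-Analysis are real-linear.
\<close>

definition proj_point :: "(complex^'n) set \<Rightarrow> bool" where
  "proj_point P \<longleftrightarrow> vec.subspace P \<and> vec.dim P = 1"

definition proj_line :: "(complex^'n) set \<Rightarrow> bool" where
  "proj_line L \<longleftrightarrow> vec.subspace L \<and> vec.dim L = 2"


section \<open>Cameras\<close>

definition camera :: "complex^4^3 \<Rightarrow> bool" where
  "camera A \<longleftrightarrow> rank A = 3"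

definition center :: "complex^4^3 \<Rightarrow> (complex^4) set" where
  "center A = {x. A *v x = 0}"

text \<open>The index set of the cameras is a finite linearly ordered type \<open>'m\<close>.\<close>

definition camera_arrangement :: "('m::finite \<Rightarrow> complex^4^3) \<Rightarrow> bool" where
  "camera_arrangement C \<longleftrightarrow>
     CARD('m) \<ge> 2 \<and> (\<forall>i. camera (C i)) \<and> inj (\<lambda>i. center (C i))"

definition collinear_cameras :: "('m \<Rightarrow> complex^4^3) \<Rightarrow> 'm set \<Rightarrow> bool" where
  "collinear_cameras C S \<longleftrightarrow> (\<exists>L. proj_line L \<and> (\<forall>i\<in>S. center (C i) \<subseteq> L))"


section \<open>The polynomial ring\<close>

text \<open>
  The variable \<open>\<ell>\<^sub>i\<^sub>,\<^sub>j\<close> is the pair \<open>(i, j)\<close>. The numeral \<open>3\<close> denotes the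
  element \<open>0\<close> of the index type \<open>3\<close>, so that the indices are \<open>1\<close>, \<open>2\<close>, \<open>3\<close>.
\<close>

type_synonym 'm monomial = "(3 \<times> 'm) \<Rightarrow>\<^sub>0 nat"
type_synonym 'm mpoly = "'m monomial \<Rightarrow>\<^sub>0 complex"

definition Const :: "complex \<Rightarrow> 'm mpoly" where
  "Const a = Poly_Mapping.single 0 a"

definition Var :: "3 \<times> 'm \<Rightarrow> 'm mpoly" where
  "Var v = Poly_Mapping.single (Poly_Mapping.single v 1) 1"

definition eval_mpoly :: "'m::finite mpoly \<Rightarrow> ('m \<Rightarrow> complex^3) \<Rightarrow> complex" where
  "eval_mpoly p x =
     (\<Sum>mon\<in>Poly_Mapping.keys p. Poly_Mapping.lookup p mon *
        (\<Prod>(i, j)\<in>UNIV. (x j $ i) ^ Poly_Mapping.lookup mon (i, j)))"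

definition multihomogeneous :: "'m::finite mpoly \<Rightarrow> bool" where
  "multihomogeneous p \<longleftrightarrow>
     (\<exists>d. \<forall>mon\<in>Poly_Mapping.keys p. \<forall>j. (\<Sum>i\<in>UNIV. Poly_Mapping.lookup mon (i, j)) = d j)"

text \<open>The set of finite linear combinations of elements of \<open>S\<close> with coefficients in the ring.\<close>

definition ideal_generated :: "'a::comm_ring_1 set \<Rightarrow> 'a set" where
  "ideal_generated S = module.span (*) S"


section \<open>Subvarieties of a product of projective planes\<close>

text \<open>
  A point of the product is a family \<open>X\<close> of points of the projective plane. A polynomial
  vanishes at \<open>X\<close> if it vanishes at all tuples of homogeneous coordinates of \<open>X\<close>.
  For multihomogeneous polynomials one such tuple is enough.
\<close>

definition vanishes_at :: "'m::finite mpoly \<Rightarrow> ('m \<Rightarrow> (complex^3) set) \<Rightarrow> bool" where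
  "vanishes_at p X \<longleftrightarrow> (\<forall>x. (\<forall>j. x j \<in> X j \<and> x j \<noteq> 0) \<longrightarrow> eval_mpoly p x = 0)"

definition zariski_closed :: "('m::finite \<Rightarrow> (complex^3) set) set \<Rightarrow> bool" where
  "zariski_closed Z \<longleftrightarrow>
     (\<exists>S. (\<forall>p\<in>S. multihomogeneous p) \<and>
          Z = {X. (\<forall>j. proj_point (X j)) \<and> (\<forall>p\<in>S. vanishes_at p X)})"

definition vanishing_ideal :: "('m::finite \<Rightarrow> (complex^3) set) set \<Rightarrow> 'm mpoly set" where
  "vanishing_ideal Z = {p. \<forall>X\<in>Z. vanishes_at p X}"


section \<open>The line multiview variety\<close>

definition cprod :: "'a::comm_ring_1^3 \<Rightarrow> 'a^3 \<Rightarrow> 'a^3" where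
  "cprod u v = vector [u$2 * v$3 - u$3 * v$2, u$3 * v$1 - u$1 * v$3, u$1 * v$2 - u$2 * v$1]"

definition line_image :: "('m \<Rightarrow> complex^4^3) \<Rightarrow> complex^4 \<Rightarrow> complex^4 \<Rightarrow> 'm \<Rightarrow> (complex^3) set" where
  "line_image C a b = (\<lambda>i. vec.span {cprod (C i *v a) (C i *v b)})"

definition line_multiview_variety ::
    "('m::finite \<Rightarrow> complex^4^3) \<Rightarrow> ('m \<Rightarrow> (complex^3) set) set" where
  "line_multiview_variety C =
     zariski_closed hull
       {line_image C a b | a b.
          proj_line (vec.span {a, b}) \<and> (\<forall>i. \<not> center (C i) \<subseteq> vec.span {a, b})}"


section \<open>The generators\<close>

definition const_vec :: "complex^'n \<Rightarrow> 'm mpoly^'n" where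
  "const_vec v = (\<chi> r. Const (v $ r))"

text \<open>\<open>back_plane C i\<close> is the vector \<open>C\<^sub>i\<^sup>T \<ell>\<^sub>i\<close> of linear forms.\<close>

definition back_plane :: "('m::finite \<Rightarrow> complex^4^3) \<Rightarrow> 'm \<Rightarrow> 'm mpoly^4" where
  "back_plane C i = map_matrix Const (transpose (C i)) *v (\<chi> k. Var (k, i))"

definition M_matrix :: "('m::finite \<Rightarrow> complex^4^3) \<Rightarrow> 'm mpoly^'m^4" where
  "M_matrix C = transpose (\<chi> j. back_plane C j)"

definition minors3 :: "'a::comm_ring_1^('n::{finite,linorder})^('k::{finite,linorder}) \<Rightarrow> 'a set" where
  "minors3 A = {det (\<chi> i j. A $ r i $ s j :: 'a^3^3) | r s.
                  strict_mono (r :: 3 \<Rightarrow> 'k) \<and> strict_mono (s :: 3 \<Rightarrow> 'n)}"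

definition dotp :: "'a::comm_ring_1^'n \<Rightarrow> 'a^'n \<Rightarrow> 'a" where
  "dotp u v = (\<Sum>r\<in>UNIV. u $ r * v $ r)"

text \<open>
  Below, \<open>c i\<close> is a representative of the \<open>i\<close>-th center, and \<open>f 1\<close>, \<open>f 2\<close>, \<open>f 3\<close> are
  representatives of the three auxiliary points.
\<close>

definition e_vec :: "('m::finite \<Rightarrow> complex^4^3) \<Rightarrow> ('m \<Rightarrow> complex^4) \<Rightarrow> (3 \<Rightarrow> complex^4) \<Rightarrow> 'm \<Rightarrow> 'm mpoly^4"
  where
  "e_vec C c f i =
     const_vec (c i)
       - dotp (back_plane C i) (const_vec (f 2)) *s const_vec (f 1)
       + dotp (back_plane C i) (const_vec (f 1)) *s const_vec (f 2)"

definition veronese :: "'a::comm_ring_1^4 \<Rightarrow> 'a^10" where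
  "veronese v =
     (let x = v$1; y = v$2; z = v$3; w = v$4
      in vector [x^2, y^2, z^2, w^2, x*y, x*z, x*w, y*z, y*w, z*w])"

definition Phi :: "('m::{finite,linorder} \<Rightarrow> complex^4^3) \<Rightarrow> ('m \<Rightarrow> complex^4) \<Rightarrow>
    (3 \<Rightarrow> complex^4) \<Rightarrow> 'm set \<Rightarrow> 'm mpoly^10^10" where
  "Phi C c f \<sigma> =
     (let i = (\<lambda>k. sorted_list_of_set \<sigma> ! k)
      in transpose (vector (map veronese
           [const_vec (c (i 0)), const_vec (c (i 1)), const_vec (c (i 2)),
            const_vec (f 1), const_vec (f 2), const_vec (f 3),
            e_vec C c f (i 0), e_vec C c f (i 1), e_vec C c f (i 2), e_vec C c f (i 3)])))"

definition collinear_quadruples :: "('m::finite \<Rightarrow> complex^4^3) \<Rightarrow> 'm set set" where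
  "collinear_quadruples C = {\<sigma>. card \<sigma> = 4 \<and> collinear_cameras C \<sigma>}"

text \<open>
  \<open>L\<close> is the auxiliary line: it does not meet the line spanned by the centers with index in
  \<open>\<sigma>\<close>, and \<open>f\<close> represents three distinct points on it.
\<close>

definition auxiliary_points :: "('m \<Rightarrow> complex^4^3) \<Rightarrow> 'm set \<Rightarrow> (complex^4) set \<Rightarrow>
    (3 \<Rightarrow> complex^4) \<Rightarrow> bool" where
  "auxiliary_points C \<sigma> L f \<longleftrightarrow>
     proj_line L \<and> L \<inter> vec.span (\<Union>i\<in>\<sigma>. center (C i)) = {0} \<and>
     (\<forall>k. f k \<in> L \<and> f k \<noteq> 0) \<and> inj (\<lambda>k. vec.span {f k})"

text \<open>Sums of ideals are the elementwise sums of sets from \<open>HOL-Library.Set_Algebras\<close>.\<close>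

definition I_tilde :: "('m::{finite,linorder} \<Rightarrow> complex^4^3) \<Rightarrow> ('m \<Rightarrow> complex^4) \<Rightarrow>
    ('m set \<Rightarrow> 3 \<Rightarrow> complex^4) \<Rightarrow> 'm mpoly set" where
  "I_tilde C c f =
     ideal_generated (minors3 (M_matrix C))
       + (\<Sum>\<sigma>\<in>collinear_quadruples C. ideal_generated {det (Phi C c (f \<sigma>) \<sigma>)})"

end

theory Submission
  imports Defs
begin

text \<open>
  Choose a basis \<open>E1, E2, F1, F2\<close> of the coordinate space such that \<open>E1,
  E2\<close> span the line of centres, and write \<open>c i = al i *s E1 + be i *s E2\<close> for
  the centres and \<open>[i j] = al i * be j - al j * be i\<close> for their brackets. The plane
  \<open>h\<^sub>i = C\<^sub>i\<^sup>T \<ell>\<^sub>i\<close> contains \<open>c i\<close>, so its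
  coordinates are \<open>(- be i * X\<^sub>i, al i * X\<^sub>i, Y\<^sub>i, Z\<^sub>i)\<close> for
  three linear forms \<open>X\<^sub>i, Y\<^sub>i, Z\<^sub>i\<close> in
  \<open>\<ell>\<^sub>i\<close>. These letters are new variables of the polynomial ring. A line
  that does not meet the line of centres has the coordinates \<open>X\<^sub>i = l\<^sub>i\<close>,
  \<open>Y\<^sub>i = l\<^sub>i * U (c i)\<close>, \<open>Z\<^sub>i = l\<^sub>i * V (c i)\<close>
  for two linear forms \<open>U, V\<close> on the line of centres and nonzero
  \<open>l\<^sub>i\<close>. Such lines are dense, so the vanishing ideal consists of the
  polynomials that vanish at all these points (\<open>vanishing_ideal_variety\<close>).

  In the letters the minors become the relations \<open>minor_XX\<close> between the values of one
  linear form at three centres, and the relations \<open>minor_XYZ\<close>. The determinant of the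
  ten points is a nonzero multiple of a form \<open>quad_form\<close> that is linear in the
  letters of each of four cameras (\<open>det_Phi\<close>). Another auxiliary line changes
  \<open>quad_form\<close> by a nonzero factor and by a combination of minors
  (\<open>quad_form_change_line\<close>). So it remains to prove that the ideal \<open>I\<close>
  generated by all \<open>minor_XX\<close>, \<open>minor_XYZ\<close> and \<open>quad_form\<close>
  contains every polynomial \<open>f\<close> that vanishes at the points above
  (\<open>line_points_vanishing\<close>).

  The proof peels off one camera \<open>n\<close>. Let \<open>f\<close> be homogeneous of degree
  \<open>D + 1\<close> in the letters of \<open>n\<close>, with coefficients in the letters of a
  set \<open>T\<close> of other cameras, and write \<open>f = X\<^sub>n ^ (D + 1) * g + Y\<^sub>n
  * f\<^sub>2 + Z\<^sub>n * f\<^sub>3\<close> with \<open>g\<close> in the letters of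
  \<open>T\<close>. At the points with \<open>U (c n) = V (c n) = 0\<close> the polynomial
  \<open>g\<close> vanishes. There the letters of \<open>i\<close> are proportional to \<open>1, t
  * [i n], s * [i n]\<close>. After division of \<open>Y\<^sub>i, Z\<^sub>i\<close> by \<open>[i
  n]\<close> they form a matrix of rank one, so \<open>g\<close> is a combination of its 2 x 2
  minors (\<open>rank_one_vanishing\<close>). The product of \<open>X\<^sub>n\<close> with such a
  2 x 2 minor is an element of \<open>I\<close> up to multiples of \<open>Y\<^sub>n\<close> and
  \<open>Z\<^sub>n\<close>. Hence the power of \<open>X\<^sub>n\<close> can be traded for a power
  of \<open>Y\<^sub>n\<close>, and after finitely many steps \<open>f\<close> is congruent to
  \<open>Y\<^sub>n ^ (D + 1) * h + Z\<^sub>n * f'\<close>. Now \<open>h\<close> vanishes at the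
  points with \<open>V (c n) = 0\<close>. The polynomials with this property are determined by the
  same peeling (\<open>lines_at_vanishing\<close>), and the product of \<open>Y\<^sub>n\<close>
  with each of their generators is in \<open>I\<close> up to multiples of
  \<open>Z\<^sub>n\<close>; this is the step that needs \<open>quad_form\<close>. So
  \<open>f\<close> is congruent to \<open>Z\<^sub>n * f''\<close>. Since \<open>V (c n)\<close> is
  nonzero on a dense set, \<open>f''\<close> vanishes at all points, and it has degree
  \<open>D\<close> in the letters of \<open>n\<close>.
\<close>

section \<open>Linear independence of monomial functions\<close>

text \<open>
  This is the independence of characters for the torus: doubling the coordinate in which two
  exponents differ and subtracting the relation eliminates a term.
\<close>

lemma monomials_independent:
  fixes c :: "('v::finite \<Rightarrow> nat) \<Rightarrow> complex"
  assumes "finite S"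
    and "\<And>x. (\<And>v. x v \<noteq> 0) \<Longrightarrow> (\<Sum>e\<in>S. c e * (\<Prod>v\<in>UNIV. x v ^ e v)) = 0"
    and "e \<in> S"
  shows "c e = 0"
  using assms
proof (induction S arbitrary: c e rule: finite_induct)
  case empty
  then show ?case by simp
next
  case (insert d S)
  define mon where "mon x e = (\<Prod>v\<in>UNIV. x v ^ e v)" for x :: "'v \<Rightarrow> complex" and e :: "'v \<Rightarrow> nat"
  have rel: "c d * mon x d + (\<Sum>e\<in>S. c e * mon x e) = 0" if "\<And>v. x v \<noteq> 0" for x
    using insert.prems(1)[OF that] insert.hyps unfolding mon_def by simp
  have double: "mon (x(w := 2 * x w)) e = 2 ^ e w * mon x e" for x w e
  proof -
    have "mon (x(w := 2 * x w)) e = (\<Prod>v\<in>UNIV. (if v = w then 2 ^ e w else 1) * x v ^ e v)"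
      unfolding mon_def by (rule prod.cong) (auto simp: power_mult_distrib)
    also have "\<dots> = (\<Prod>v\<in>UNIV. (if v = w then 2 ^ e w else 1)) * mon x e"
      unfolding mon_def by (rule prod.distrib)
    finally show ?thesis by simp
  qed
  have small: "c e * (2 ^ e w - 2 ^ d w) = 0" if "e \<in> S" for e w
  proof (rule insert.IH[where c = "\<lambda>e. c e * (2 ^ e w - 2 ^ d w)", OF _ that])
    fix x :: "'v \<Rightarrow> complex" assume nz: "\<And>v. x v \<noteq> 0"
    have "c d * mon (x(w := 2 * x w)) d + (\<Sum>e\<in>S. c e * mon (x(w := 2 * x w)) e) = 0"
      by (rule rel) (simp add: nz)
    moreover have "c d * (2 ^ d w * mon x d) + 2 ^ d w * (\<Sum>e\<in>S. c e * mon x e) = 2 ^ d w * (c d * mon x d + (\<Sum>e\<in>S. c e * mon x e))"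
      by (simp add: algebra_simps)
    ultimately have "(\<Sum>e\<in>S. c e * mon (x(w := 2 * x w)) e) = 2 ^ d w * (\<Sum>e\<in>S. c e * mon x e)"
      unfolding double[of x w d] rel[OF nz] by (metis add_left_imp_eq mult_zero_right)
    then have "(\<Sum>e\<in>S. c e * mon (x(w := 2 * x w)) e) - 2 ^ d w * (\<Sum>e\<in>S. c e * mon x e) = 0"
      by simp
    then have "(\<Sum>e\<in>S. c e * (2 ^ e w - 2 ^ d w) * mon x e) = 0"
      unfolding double sum_distrib_left sum_subtractf[symmetric]
      by (simp add: algebra_simps)
    then show "(\<Sum>e\<in>S. c e * (2 ^ e w - 2 ^ d w) * (\<Prod>v\<in>UNIV. x v ^ e v)) = 0"
      unfolding mon_def .
  qed
  have S0: "c e = 0" if "e \<in> S" for e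
  proof -
    have "e \<noteq> d" using that insert.hyps by auto
    then obtain w where "e w \<noteq> d w" by auto
    then have "(2::complex) ^ e w \<noteq> 2 ^ d w"
      by (metis norm_numeral norm_power one_less_numeral_iff power_inject_exp semiring_norm(76))
    then show ?thesis using small[OF that, of w] by simp
  qed
  have "c d = 0"
    using rel[of "\<lambda>_. 1"] S0 by (simp add: mon_def)
  then show ?case using S0 insert.prems(2) by auto
qed

section \<open>Polynomials in letters\<close>

text \<open>
  A commutative algebra with elements \<open>L x i\<close>, the letters, that take arbitrary
  independent values under evaluation: \<open>x\<close> is one of the three letters \<open>X, Y,
  Z\<close> and \<open>i\<close> is a camera. Evaluation is indexed by the values of the letters.
\<close>

locale letter_algebra =
  fixes K :: "complex \<Rightarrow> 'r::comm_ring_1"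
    and L :: "3 \<Rightarrow> 'i::finite \<Rightarrow> 'r"
    and ev :: "(3 \<Rightarrow> 'i \<Rightarrow> complex) \<Rightarrow> 'r \<Rightarrow> complex"
  assumes K_add: "K (a + b) = K a + K b"
    and K_mult: "K (a * b) = K a * K b"
    and K_1: "K 1 = 1"
    and ev_add: "ev p (f + g) = ev p f + ev p g"
    and ev_mult: "ev p (f * g) = ev p f * ev p g"
    and ev_K: "ev p (K a) = a"
    and ev_L: "ev p (L x i) = p x i"
begin

lemma K_0: "K 0 = 0"
  using K_add[of 0 0] by simp

lemma K_minus: "K (- a) = - K a"
  using K_add[of a "- a"] K_0 by (simp add: eq_neg_iff_add_eq_0 add.commute)

lemma K_diff: "K (a - b) = K a - K b"
  using K_add[of a "- b"] K_minus by simp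

lemma ev_0: "ev p 0 = 0"
  using ev_K[of p 0] K_0 by simp

lemma ev_1: "ev p 1 = 1"
  using ev_K[of p 1] K_1 by simp

lemma ev_minus: "ev p (- f) = - ev p f"
  using ev_add[of p f "- f"] ev_0 by (simp add: eq_neg_iff_add_eq_0 add.commute)

lemma ev_diff: "ev p (f - g) = ev p f - ev p g"
  using ev_add[of p f "- g"] ev_minus by simp

lemma ev_sum: "ev p (\<Sum>x\<in>S. g x) = (\<Sum>x\<in>S. ev p (g x))"
  by (induction S rule: infinite_finite_induct) (auto simp: ev_0 ev_add)

lemma ev_power: "ev p (f ^ n) = ev p f ^ n"
  by (induction n) (auto simp: ev_1 ev_mult)

lemmas K_simps = K_0 K_1 K_add K_mult K_minus K_diff
lemmas ev_simps = ev_0 ev_1 ev_add ev_mult ev_minus ev_diff ev_K ev_L ev_power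

text \<open>
  Letters only multiply from the left. So an induction over \<open>Pol\<close> has no case for
  products.
\<close>

inductive_set Pol :: "'i set \<Rightarrow> 'r set" for T where
  Pol_K: "K a \<in> Pol T"
| Pol_add: "f \<in> Pol T \<Longrightarrow> g \<in> Pol T \<Longrightarrow> f + g \<in> Pol T"
| Pol_letter: "i \<in> T \<Longrightarrow> f \<in> Pol T \<Longrightarrow> L x i * f \<in> Pol T"

lemma Pol_0: "0 \<in> Pol T"
  using Pol_K[of 0] K_0 by simp

lemma Pol_1: "1 \<in> Pol T"
  using Pol_K[of 1] K_1 by simp

lemma Pol_L: "i \<in> T \<Longrightarrow> L x i \<in> Pol T"
  using Pol_letter[of i T 1] Pol_1 by simp

lemma Pol_scale: "f \<in> Pol T \<Longrightarrow> K a * f \<in> Pol T"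
proof (induction rule: Pol.induct)
  case (Pol_K b)
  then show ?case using Pol.Pol_K[of "a * b"] K_mult by simp
next
  case (Pol_add f g)
  then show ?case using Pol.Pol_add by (simp add: distrib_left)
next
  case (Pol_letter i f x)
  then show ?case using Pol.Pol_letter[of i T "K a * f" x] by (simp add: ac_simps)
qed

lemma Pol_mult: "f \<in> Pol T \<Longrightarrow> g \<in> Pol T \<Longrightarrow> f * g \<in> Pol T"
proof (induction rule: Pol.induct)
  case (Pol_K a)
  then show ?case by (rule Pol_scale)
next
  case (Pol_add f1 f2)
  then show ?case using Pol.Pol_add by (simp add: distrib_right)
next
  case (Pol_letter i f x)
  then show ?case using Pol.Pol_letter[of i T "f * g" x] by (simp add: ac_simps)
qed

lemma Pol_minus: "f \<in> Pol T \<Longrightarrow> - f \<in> Pol T"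
  using Pol_scale[of f T "-1"] K_minus[of 1] K_1 by simp

lemma Pol_diff: "f \<in> Pol T \<Longrightarrow> g \<in> Pol T \<Longrightarrow> f - g \<in> Pol T"
  using Pol_add[of f T "- g"] Pol_minus[of g T] by simp

lemma Pol_power: "f \<in> Pol T \<Longrightarrow> f ^ n \<in> Pol T"
  by (induction n) (auto intro: Pol_1 Pol_mult)

lemma Pol_sum: "(\<And>x. x \<in> S \<Longrightarrow> g x \<in> Pol T) \<Longrightarrow> (\<Sum>x\<in>S. g x) \<in> Pol T"
  by (induction S rule: infinite_finite_induct) (auto intro: Pol_0 Pol_add)

lemma Pol_mono: "f \<in> Pol T \<Longrightarrow> T \<subseteq> T' \<Longrightarrow> f \<in> Pol T'"
  by (induction rule: Pol.induct) (auto intro: Pol.intros)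

lemma Pol_empty: "f \<in> Pol {} \<Longrightarrow> \<exists>a. f = K a"
proof (induction rule: Pol.induct)
  case (Pol_add f g)
  then show ?case using K_add by metis
qed auto

lemmas Pol_closed = Pol_0 Pol_1 Pol_L Pol_K Pol_add Pol_mult Pol_minus Pol_diff Pol_power

lemma ev_cong_Pol:
  "f \<in> Pol T \<Longrightarrow> (\<And>x i. i \<in> T \<Longrightarrow> p x i = q x i) \<Longrightarrow> ev p f = ev q f"
  by (induction rule: Pol.induct) (auto simp: ev_simps)

text \<open>
  The recursion on the degree \<open>D\<close> turns the scaling law \<open>ev_scale_forms\<close>
  and the splitting of a pure power of a letter into plain inductions. The coefficients are in the
  letters of \<open>T\<close>.
\<close>

primrec forms :: "3 set \<Rightarrow> 'i \<Rightarrow> 'i set \<Rightarrow> nat \<Rightarrow> 'r set" where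
  "forms S n T 0 = Pol T"
| "forms S n T (Suc D) = {f. \<exists>g. (\<forall>x\<in>S. g x \<in> forms S n T D) \<and> f = (\<Sum>x\<in>S. L x n * g x)}"

lemma forms_0: "0 \<in> forms S n T D"
proof (induction D)
  case 0
  show ?case by (simp add: Pol_0)
next
  case (Suc D)
  then show ?case by (auto intro!: exI[of _ "\<lambda>_. 0"])
qed

lemma forms_add: "f \<in> forms S n T D \<Longrightarrow> g \<in> forms S n T D \<Longrightarrow> f + g \<in> forms S n T D"
proof (induction D arbitrary: f g)
  case 0
  then show ?case by (simp add: Pol_add)
next
  case (Suc D)
  from Suc.prems obtain f' g' where
    "\<forall>x\<in>S. f' x \<in> forms S n T D" "f = (\<Sum>x\<in>S. L x n * f' x)"
    "\<forall>x\<in>S. g' x \<in> forms S n T D" "g = (\<Sum>x\<in>S. L x n * g' x)" by auto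
  then show ?case using Suc.IH
    by (auto intro!: exI[of _ "\<lambda>x. f' x + g' x"] simp: sum.distrib distrib_left)
qed

lemma forms_Pol_mult: "f \<in> forms S n T D \<Longrightarrow> g \<in> Pol T \<Longrightarrow> g * f \<in> forms S n T D"
proof (induction D arbitrary: f)
  case 0
  then show ?case by (simp add: Pol_mult)
next
  case (Suc D)
  from Suc.prems obtain f' where
    "\<forall>x\<in>S. f' x \<in> forms S n T D" "f = (\<Sum>x\<in>S. L x n * f' x)" by auto
  moreover have "g * f = (\<Sum>x\<in>S. L x n * (g * f' x))"
    unfolding calculation sum_distrib_left by (simp add: ac_simps)
  ultimately show ?case using Suc.IH Suc.prems
    by (auto intro!: exI[of _ "\<lambda>x. g * f' x"])
qed

lemma forms_letter:
  assumes "f \<in> forms S n T D" "x \<in> S"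
  shows "L x n * f \<in> forms S n T (Suc D)"
proof -
  have "(\<Sum>y\<in>S. L y n * (if y = x then f else 0)) = (\<Sum>y\<in>S. if y = x then L x n * f else 0)"
    by (rule sum.cong) auto
  also have "\<dots> = L x n * f" using assms by simp
  finally show ?thesis
    using assms forms_0 by (auto intro!: exI[of _ "\<lambda>y. if y = x then f else 0"])
qed

lemma forms_letter_power:
  "f \<in> forms S n T D \<Longrightarrow> x \<in> S \<Longrightarrow> L x n ^ k * f \<in> forms S n T (k + D)"
  by (induction k) (auto simp only: power_0 power_Suc mult_1 mult.assoc add_0 add_Suc intro: forms_letter)

lemma forms_power_Pol: "g \<in> Pol T \<Longrightarrow> x \<in> S \<Longrightarrow> L x n ^ k * g \<in> forms S n T k"
  using forms_letter_power[of g S n T 0 x k] by simp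

lemma forms_Pol: "f \<in> forms S n T D \<Longrightarrow> f \<in> Pol (insert n T)"
proof (induction D arbitrary: f)
  case 0
  then show ?case by (auto intro: Pol_mono)
next
  case (Suc D)
  then show ?case by (auto intro!: Pol_sum Pol_letter)
qed

text \<open>
  Only the pure power of one letter has a coefficient that is free of the letters of
  \<open>n\<close>; all other terms contain another letter of \<open>n\<close>.
\<close>

lemma forms_SucE_XYZ:
  assumes "f \<in> forms UNIV n T (Suc D)"
  obtains g f2 f3 where "g \<in> Pol T" "f2 \<in> forms UNIV n T D" "f3 \<in> forms UNIV n T D"
    "f = L 1 n ^ Suc D * g + L 2 n * f2 + L 3 n * f3"
proof -
  have "\<exists>g\<in>Pol T. \<exists>f2\<in>forms UNIV n T D. \<exists>f3\<in>forms UNIV n T D.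
      f = L 1 n ^ Suc D * g + L 2 n * f2 + L 3 n * f3"
    using assms
  proof (induction D arbitrary: f)
    case 0
    then obtain h where "\<forall>x. h x \<in> Pol T" "f = (\<Sum>x\<in>UNIV. L x n * h x)" by auto
    then show ?case
      by (intro bexI[of _ "h 1"] bexI[of _ "h 2"] bexI[of _ "h 3"]) (auto simp: sum_3)
  next
    case (Suc D)
    then obtain h where h: "\<forall>x. h x \<in> forms UNIV n T (Suc D)" and f: "f = (\<Sum>x\<in>UNIV. L x n * h x)"
      by (subst (asm) forms.simps) auto
    from Suc.IH[of "h 1"] h obtain g f2 f3 where g: "g \<in> Pol T" "f2 \<in> forms UNIV n T D"
      "f3 \<in> forms UNIV n T D" "h 1 = L 1 n ^ Suc D * g + L 2 n * f2 + L 3 n * f3" by blast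
    have "f = L 1 n ^ Suc (Suc D) * g + L 2 n * (L 1 n * f2 + h 2) + L 3 n * (L 1 n * f3 + h 3)"
      unfolding f sum_3 g(4) by (simp add: algebra_simps)
    moreover have "L 1 n * f2 + h 2 \<in> forms UNIV n T (Suc D)" "L 1 n * f3 + h 3 \<in> forms UNIV n T (Suc D)"
      using h g by (auto intro!: forms_add forms_letter simp del: forms.simps)
    ultimately show ?case using g(1) by blast
  qed
  then show ?thesis using that by blast
qed

lemma forms_SucE_XZ:
  assumes "f \<in> forms {1, 3} n T (Suc D)"
  obtains g f3 where "g \<in> Pol T" "f3 \<in> forms {1, 3} n T D"
    "f = L 1 n ^ Suc D * g + L 3 n * f3"
proof -
  have "\<exists>g\<in>Pol T. \<exists>f3\<in>forms {1, 3} n T D. f = L 1 n ^ Suc D * g + L 3 n * f3"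
    using assms
  proof (induction D arbitrary: f)
    case 0
    then obtain h where "\<forall>x\<in>{1,3}. h x \<in> Pol T" "f = (\<Sum>x\<in>{1,3}. L x n * h x)" by auto
    then show ?case
      by (intro bexI[of _ "h 1"] bexI[of _ "h 3"]) auto
  next
    case (Suc D)
    then obtain h where h: "\<forall>x\<in>{1,3}. h x \<in> forms {1,3} n T (Suc D)" and f: "f = (\<Sum>x\<in>{1,3}. L x n * h x)"
      by (subst (asm) forms.simps) auto
    from Suc.IH[of "h 1"] h obtain g f3 where g: "g \<in> Pol T"
      "f3 \<in> forms {1,3} n T D" "h 1 = L 1 n ^ Suc D * g + L 3 n * f3" by blast
    have "f = L 1 n ^ Suc (Suc D) * g + L 3 n * (L 1 n * f3 + h 3)"
      unfolding f using g(3) by (simp add: algebra_simps)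
    moreover have "L 1 n * f3 + h 3 \<in> forms {1,3} n T (Suc D)"
      using h g by (auto intro!: forms_add forms_letter simp del: forms.simps)
    ultimately show ?case using g(1) by blast
  qed
  then show ?thesis using that by blast
qed

lemma forms_SucE_Y:
  assumes "f \<in> forms UNIV n T (Suc D)"
  obtains h f2 where "h \<in> forms {1, 3} n T (Suc D)" "f2 \<in> forms UNIV n T D" "f = h + L 2 n * f2"
proof -
  have "\<exists>h\<in>forms {1, 3} n T (Suc D). \<exists>f2\<in>forms UNIV n T D. f = h + L 2 n * f2"
    using assms
  proof (induction D arbitrary: f)
    case 0
    then obtain g where g: "\<forall>x. g x \<in> Pol T" "f = (\<Sum>x\<in>UNIV. L x n * g x)" by auto
    have "L 1 n * g 1 + L 3 n * g 3 \<in> forms {1,3} n T (Suc 0)"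
      using g by (auto intro!: exI[of _ g])
    then show ?case using g
      by (intro bexI[of _ "L 1 n * g 1 + L 3 n * g 3"] bexI[of _ "g 2"]) (auto simp: sum_3)
  next
    case (Suc D)
    then obtain g where g: "\<forall>x. g x \<in> forms UNIV n T (Suc D)" and f: "f = (\<Sum>x\<in>UNIV. L x n * g x)"
      by (subst (asm) forms.simps) auto
    from Suc.IH[of "g 1"] g obtain h1 f1 where h1: "h1 \<in> forms {1,3} n T (Suc D)"
      "f1 \<in> forms UNIV n T D" "g 1 = h1 + L 2 n * f1" by blast
    from Suc.IH[of "g 3"] g obtain h3 f3 where h3: "h3 \<in> forms {1,3} n T (Suc D)"
      "f3 \<in> forms UNIV n T D" "g 3 = h3 + L 2 n * f3" by blast
    have "f = (L 1 n * h1 + L 3 n * h3) + L 2 n * (L 1 n * f1 + L 3 n * f3 + g 2)"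
      unfolding f sum_3 h1(3) h3(3) by (simp add: algebra_simps)
    moreover have "L 1 n * h1 + L 3 n * h3 \<in> forms {1,3} n T (Suc (Suc D))"
      using h1 h3 by (intro forms_add forms_letter) auto
    moreover have "L 1 n * f1 + L 3 n * f3 + g 2 \<in> forms UNIV n T (Suc D)"
      using h1 h3 g by (intro forms_add forms_letter) auto
    ultimately show ?case by blast
  qed
  then show ?thesis using that by blast
qed

lemma forms_decomposition:
  assumes "f \<in> Pol (insert n T)"
  obtains N F where "\<And>D. F D \<in> forms UNIV n T D" "f = (\<Sum>D\<le>N. F D)" "\<And>D. D > N \<Longrightarrow> F D = 0"
proof -
  have "\<exists>N F. (\<forall>D. F D \<in> forms UNIV n T D) \<and> f = (\<Sum>D\<le>N. F D) \<and> (\<forall>D>N. F D = 0)"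
    using assms
  proof (induction rule: Pol.induct)
    case (Pol_K a)
    show ?case
      by (intro exI[of _ "0::nat"] exI[of _ "\<lambda>D. if D = 0 then K a else 0"])
        (auto simp: forms_0 Pol.Pol_K)
  next
    case (Pol_add f g)
    then obtain N F M G where F: "\<forall>D. F D \<in> forms UNIV n T D" "f = (\<Sum>D\<le>N. F D)" "\<forall>D>N. F D = 0"
      and G: "\<forall>D. G D \<in> forms UNIV n T D" "g = (\<Sum>D\<le>M. G D)" "\<forall>D>M. G D = 0" by auto
    have "f = (\<Sum>D\<le>max N M. F D)" "g = (\<Sum>D\<le>max N M. G D)"
      unfolding F(2) G(2) by (rule sum.mono_neutral_left; use F G in auto)+
    then have "f + g = (\<Sum>D\<le>max N M. F D + G D)" by (simp add: sum.distrib)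
    then show ?case using F G
      by (intro exI[of _ "max N M"] exI[of _ "\<lambda>D. F D + G D"]) (auto intro: forms_add)
  next
    case (Pol_letter i f x)
    then obtain N F where F: "\<forall>D. F D \<in> forms UNIV n T D" "f = (\<Sum>D\<le>N. F D)" "\<forall>D>N. F D = 0" by auto
    show ?case
    proof (cases "i = n")
      case True
      define G where "G = (\<lambda>D. case D of 0 \<Rightarrow> 0 | Suc D \<Rightarrow> L x n * F D)"
      have "G D \<in> forms UNIV n T D" for D
        using F forms_0 forms_letter Pol_0 by (cases D) (auto simp: G_def simp del: forms.simps(2))
      moreover have "L x i * f = (\<Sum>D\<le>Suc N. G D)"
        unfolding F(2) True sum.atMost_Suc_shift by (simp add: G_def sum_distrib_left)
      moreover have "\<forall>D>Suc N. G D = 0"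
        using F(3) by (auto simp: G_def split: nat.split)
      ultimately show ?thesis by blast
    next
      case False
      then have "i \<in> T" using Pol_letter by auto
      then show ?thesis using F
        by (intro exI[of _ N] exI[of _ "\<lambda>D. L x i * F D"])
          (auto intro!: forms_Pol_mult Pol_L simp: sum_distrib_left)
    qed
  qed
  then show ?thesis using that by blast
qed

section \<open>Vanishing on sets of points\<close>

definition van :: "(3 \<Rightarrow> 'i \<Rightarrow> complex) set \<Rightarrow> 'r set" where
  "van V = {f. \<forall>p\<in>V. ev p f = 0}"

lemma van_0: "0 \<in> van V"
  and van_add: "f \<in> van V \<Longrightarrow> g \<in> van V \<Longrightarrow> f + g \<in> van V"
  and van_diff: "f \<in> van V \<Longrightarrow> g \<in> van V \<Longrightarrow> f - g \<in> van V"
  and van_mult: "f \<in> van V \<Longrightarrow> h * f \<in> van V"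
  by (auto simp: van_def ev_simps)

lemma van_mono: "f \<in> van V \<Longrightarrow> W \<subseteq> V \<Longrightarrow> f \<in> van W"
  by (auto simp: van_def)

definition scale_at :: "'i \<Rightarrow> complex \<Rightarrow> (3 \<Rightarrow> 'i \<Rightarrow> complex) \<Rightarrow> 3 \<Rightarrow> 'i \<Rightarrow> complex" where
  "scale_at n t p = (\<lambda>x i. if i = n then t * p x i else p x i)"

lemma ev_scale_forms:
  assumes "f \<in> forms S n T D" "n \<notin> T"
  shows "ev (scale_at n t p) f = t ^ D * ev p f"
  using assms(1)
proof (induction D arbitrary: f)
  case 0
  have "ev (scale_at n t p) f = ev p f"
    by (rule ev_cong_Pol[of f T]) (use 0 assms(2) in \<open>auto simp: scale_at_def\<close>)
  then show ?case by simp
next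
  case (Suc D)
  then obtain g where g: "\<forall>x\<in>S. g x \<in> forms S n T D" "f = (\<Sum>x\<in>S. L x n * g x)" by auto
  then show ?case
    by (simp add: ev_sum ev_simps Suc.IH sum_distrib_left)
      (rule sum.cong, auto simp: scale_at_def)
qed

text \<open>
  If the point set is stable under rescaling the letters of \<open>n\<close>, then a polynomial
  vanishes on it together with its homogeneous components: their values are the coefficients of a
  polynomial in the scaling factor that has infinitely many roots.
\<close>

lemma homogeneous_suffices:
  assumes f: "f \<in> Pol (insert n T)" "f \<in> van V" and n: "n \<notin> T"
    and V: "\<And>p t. p \<in> V \<Longrightarrow> t \<noteq> 0 \<Longrightarrow> scale_at n t p \<in> V"
    and A: "0 \<in> A" "\<And>f g. f \<in> A \<Longrightarrow> g \<in> A \<Longrightarrow> f + g \<in> A"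
    and forms: "\<And>D f. f \<in> forms UNIV n T D \<Longrightarrow> f \<in> van V \<Longrightarrow> f \<in> A"
  shows "f \<in> A"
proof -
  obtain N F where F: "\<And>D. F D \<in> forms UNIV n T D" "f = (\<Sum>D\<le>N. F D)" "\<And>D. D > N \<Longrightarrow> F D = 0"
    using forms_decomposition[OF f(1)] by blast
  have "ev p (F D) = 0" if "p \<in> V" for p D
  proof (cases "D \<le> N")
    case True
    have "(\<Sum>D\<le>N. ev p (F D) * t ^ D) = 0" if "t \<noteq> 0" for t
    proof -
      have "ev (scale_at n t p) f = 0" using f(2) V[OF \<open>p \<in> V\<close> that] by (auto simp: van_def)
      then show ?thesis
        unfolding F(2) ev_sum ev_scale_forms[OF F(1) n] by (simp add: mult.commute)
    qed
    then have "UNIV - {0} \<subseteq> {t. (\<Sum>D\<le>N. ev p (F D) * t ^ D) = 0}" by auto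
    moreover have "infinite (UNIV - {0 :: complex})"
      by (simp add: infinite_UNIV_char_0)
    ultimately have "infinite {t. (\<Sum>D\<le>N. ev p (F D) * t ^ D) = 0}"
      using finite_subset by blast
    then show ?thesis using True polyfun_finite_roots[where c = "\<lambda>D. ev p (F D)" and n = N] by blast
  next
    case False
    then show ?thesis using F(3) by (simp add: ev_0)
  qed
  then have "F D \<in> A" for D using forms[OF F(1)] by (auto simp: van_def)
  then have "(\<Sum>D\<in>S. F D) \<in> A" for S
    by (induction S rule: infinite_finite_induct) (auto simp: A)
  then show ?thesis unfolding F(2) .
qed

lemma isCont_ev:
  assumes "f \<in> Pol T" "\<And>x i. isCont (\<lambda>t. q t x i) (s::complex)"
  shows "isCont (\<lambda>t. ev (q t) f) s"
  using assms(1)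
  by (induction rule: Pol.induct) (auto simp: ev_simps intro!: continuous_intros assms(2))

lemma ev_eq_0_limit:
  assumes "f \<in> Pol T" "\<And>x i. isCont (\<lambda>t. q t x i) (0::complex)"
    and "\<forall>\<^sub>F t in at 0. ev (q t) f = 0"
  shows "ev (q 0) f = 0"
proof -
  have "(\<lambda>t. ev (q t) f) \<midarrow>0\<rightarrow> ev (q 0) f"
    using isCont_ev[where q = q and s = 0, OF assms(1)] assms(2) by (auto simp: isCont_def)
  moreover have "(\<lambda>t. ev (q t) f) \<midarrow>0\<rightarrow> 0"
    by (rule tendsto_eventually) (rule assms(3))
  ultimately show ?thesis using LIM_unique by blast
qed

section \<open>Matrices of letters of rank one\<close>

text \<open>
  A product of letters that are normalized by the scalars \<open>g\<close>. With this
  normalization, words with the same letters and the same indices take equal values at the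
  matrices of rank one below.
\<close>

definition word :: "(3 \<Rightarrow> 'i \<Rightarrow> complex) \<Rightarrow> (3 \<times> 'i) multiset \<Rightarrow> 'r" where
  "word g N = (\<Prod>(x, i)\<in>#N. K (1 / g x i) * L x i)"

text \<open>
  The exponents of the letters and of the indices in a word. They are the exponents of its value
  as a monomial in the row and the column parameters.
\<close>

definition tally :: "(3 \<times> 'i) multiset \<Rightarrow> 3 + 'i \<Rightarrow> nat" where
  "tally N v = (case v of Inl x \<Rightarrow> count (image_mset fst N) x | Inr i \<Rightarrow> count (image_mset snd N) i)"

lemma tally_eq_iff:
  "tally N = tally N' \<longleftrightarrow>
     image_mset fst N = image_mset fst N' \<and> image_mset snd N = image_mset snd N'"
proof
  assume *: "tally N = tally N'"
  have "count (image_mset fst N) x = count (image_mset fst N') x" for x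
    using fun_cong[OF *, of "Inl x"] by (simp add: tally_def)
  moreover have "count (image_mset snd N) x = count (image_mset snd N') x" for x
    using fun_cong[OF *, of "Inr x"] by (simp add: tally_def)
  ultimately show "image_mset fst N = image_mset fst N' \<and> image_mset snd N = image_mset snd N'"
    by (auto intro: multiset_eqI)
qed (auto simp: tally_def fun_eq_iff split: sum.split)

lemma word_add_mset: "word g (add_mset (x, i) N) = K (1 / g x i) * L x i * word g N"
  by (simp add: word_def)

lemma word_empty: "word g {#} = 1"
  by (simp add: word_def)

lemma ev_word:
  assumes "\<And>x i. (x, i) \<in># N \<Longrightarrow> g x i \<noteq> 0 \<and> p x i = l i * th x * g x i"
  shows "ev p (word g N) = (\<Prod>v\<in>UNIV. (case v of Inl x \<Rightarrow> th x | Inr i \<Rightarrow> l i) ^ tally N v)"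
  using assms
proof (induction N)
  case empty
  have "tally {#} v = 0" for v by (simp add: tally_def split: sum.split)
  then show ?case by (simp add: word_empty ev_simps)
next
  case (add y N)
  obtain x i where y: "y = (x, i)" by force
  let ?w = "\<lambda>v::3+'i. case v of Inl x \<Rightarrow> th x | Inr i \<Rightarrow> l i"
  have tally: "tally (add_mset y N) v =
      (if v = Inl x then 1 else 0) + ((if v = Inr i then 1 else 0) + tally N v)" for v
    by (auto simp: tally_def y split: sum.split)
  have "(\<Prod>v\<in>UNIV. ?w v ^ tally (add_mset y N) v) =
      (\<Prod>v\<in>UNIV. ?w v ^ (if v = Inl x then 1 else 0)) *
      ((\<Prod>v\<in>UNIV. ?w v ^ (if v = Inr i then 1 else 0)) * (\<Prod>v\<in>UNIV. ?w v ^ tally N v))"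
    unfolding tally power_add by (simp only: prod.distrib)
  also have "(\<Prod>v\<in>UNIV. ?w v ^ (if v = Inl x then 1 else 0)) = (\<Prod>v::3+'i\<in>UNIV. if v = Inl x then th x else 1)"
    by (rule prod.cong) auto
  also have "(\<Prod>v\<in>UNIV. ?w v ^ (if v = Inr i then 1 else 0)) = (\<Prod>v::3+'i\<in>UNIV. if v = Inr i then l i else 1)"
    by (rule prod.cong) auto
  also have "(\<Prod>v\<in>UNIV. ?w v ^ tally N v) = ev p (word g N)"
    using add by auto
  finally show ?case
    using add.prems[of x i] by (simp add: y word_add_mset ev_simps)
qed

text \<open>
  Two words with the same letters and the same indices differ by swaps of letters, so they agree
  modulo every submodule that contains the swaps. In the induction, one swap moves the first
  letter of the first word to its place in the second word, and then it cancels.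
\<close>

lemma words_congruent:
  assumes A: "0 \<in> A" "\<And>f g. f \<in> A \<Longrightarrow> g \<in> A \<Longrightarrow> f + g \<in> A" "\<And>f g. f \<in> A \<Longrightarrow> g \<in> Pol T \<Longrightarrow> g * f \<in> A"
    and swap: "\<And>x y i j. x \<in> S \<Longrightarrow> y \<in> S \<Longrightarrow> i \<in> T \<Longrightarrow> j \<in> T \<Longrightarrow>
      K (1 / g x i) * L x i * (K (1 / g y j) * L y j) - K (1 / g x j) * L x j * (K (1 / g y i) * L y i) \<in> A"
    and "set_mset N \<subseteq> S \<times> T" "set_mset N' \<subseteq> S \<times> T" "tally N = tally N'"
  shows "word g N - word g N' \<in> A"
  using assms(5-)
proof (induction N arbitrary: N')
  case empty
  then have "N' = {#}" by (simp add: tally_eq_iff)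
  then show ?case using A by simp
next
  case (add z N)
  obtain x i where z: "z = (x, i)" by force
  have xi: "x \<in> S" "i \<in> T" using add.prems z by auto
  have Pol_word: "word g M \<in> Pol T" if "set_mset M \<subseteq> S \<times> T" for M
    using that
  proof (induction M)
    case (add z M)
    then show ?case by (cases z) (auto simp: word_add_mset intro!: Pol_closed)
  qed (simp add: word_empty Pol_1)
  have cancel: "word g (add_mset z N) - word g (add_mset z M) \<in> A"
    if "set_mset M \<subseteq> S \<times> T" "tally (add_mset z N) = tally (add_mset z M)" for M
  proof -
    have "tally N = tally M" using that(2) by (simp add: tally_eq_iff)
    then have "word g N - word g M \<in> A" using add.IH[of M] add.prems that by auto
    then have "K (1 / g x i) * L x i * (word g N - word g M) \<in> A"
      using xi by (intro A) (auto intro!: Pol_closed)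
    then show ?thesis by (simp add: z word_add_mset right_diff_distrib)
  qed
  have "x \<in># image_mset fst N'" "i \<in># image_mset snd N'"
    using add.prems(3)[unfolded tally_eq_iff, THEN conjunct1, symmetric]
      add.prems(3)[unfolded tally_eq_iff, THEN conjunct2, symmetric] by (auto simp: z)
  then obtain y j where y: "(y, i) \<in># N'" and j: "(x, j) \<in># N'" by auto
  show ?case
  proof (cases "y = x")
    case True
    then obtain M where "N' = add_mset z M" using y z by (metis mset_add)
    then show ?thesis using cancel[of M] add.prems by auto
  next
    case False
    obtain M1 where M1: "N' = add_mset (y, i) M1" using y by (metis mset_add)
    then have "(x, j) \<in># M1" using j False by auto
    then obtain M where "M1 = add_mset (x, j) M" by (metis mset_add)
    then have N': "N' = add_mset (y, i) (add_mset (x, j) M)" using M1 by simp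
    let ?N'' = "add_mset z (add_mset (y, j) M)"
    have sub: "set_mset M \<subseteq> S \<times> T" "y \<in> S" "j \<in> T" using add.prems(2) N' by auto
    have "tally ?N'' = tally N'"
      by (simp add: tally_eq_iff N' z add_mset_commute)
    then have "word g (add_mset z N) - word g ?N'' \<in> A"
      using sub add.prems(3) by (intro cancel) auto
    moreover have "word g M * (K (1 / g x i) * L x i * (K (1 / g y j) * L y j)
        - K (1 / g x j) * L x j * (K (1 / g y i) * L y i)) \<in> A"
      using sub xi by (intro A swap Pol_word)
    ultimately have "(word g (add_mset z N) - word g ?N'') + word g M * (K (1 / g x i) * L x i * (K (1 / g y j) * L y j)
        - K (1 / g x j) * L x j * (K (1 / g y i) * L y i)) \<in> A" by (rule A(2))
    then show ?thesis by (simp add: N' z word_add_mset algebra_simps)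
  qed
qed

text \<open>
  A polynomial that vanishes on the matrices with entries \<open>l i * th x * g x i\<close> is a
  combination of the 2 x 2 minors of the entries divided by \<open>g x i\<close>: modulo these
  minors a polynomial is a combination of one word for each tally, and these words are independent
  functions by \<open>monomials_independent\<close>. Stating this for an arbitrary submodule
  \<open>A\<close> that contains the minors allows \<open>A\<close> to be a colon ideal later. A
  letter \<open>x\<close> with \<open>g x = 0\<close> vanishes on these matrices and has to be in
  \<open>A\<close> itself.
\<close>

theorem rank_one_vanishing:
  assumes A: "0 \<in> A" "\<And>f g. f \<in> A \<Longrightarrow> g \<in> A \<Longrightarrow> f + g \<in> A" "\<And>f g. f \<in> A \<Longrightarrow> g \<in> Pol T \<Longrightarrow> g * f \<in> A"
    and A_van: "A \<subseteq> van V"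
    and V: "\<And>l th. (\<And>i. l i \<noteq> 0) \<Longrightarrow> (\<And>x. th x \<noteq> 0) \<Longrightarrow> (\<lambda>x i. l i * th x * g x i) \<in> V"
    and good: "\<And>x. (\<forall>i\<in>T. g x i \<noteq> 0) \<or> (\<forall>i\<in>T. L x i \<in> A)"
    and swap: "\<And>x y i j. (x, y) \<in> {(1, 2), (1, 3), (2, 3)} \<Longrightarrow> i \<in> T \<Longrightarrow> j \<in> T \<Longrightarrow> i \<noteq> j \<Longrightarrow>
      (\<forall>i\<in>T. g x i \<noteq> 0) \<Longrightarrow> (\<forall>i\<in>T. g y i \<noteq> 0) \<Longrightarrow>
      K (g x j * g y i) * (L x i * L y j) - K (g x i * g y j) * (L x j * L y i) \<in> A"
    and f: "f \<in> Pol T" "f \<in> van V"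
  shows "f \<in> A"
proof -
  define S where "S = {x. \<forall>i\<in>T. g x i \<noteq> 0}"
  define W where "W = {N. set_mset N \<subseteq> S \<times> T}"
  define r where "r e = word g (SOME N. N \<in> W \<and> tally N = e)" for e
  define B where "B = {f. \<exists>E c. finite E \<and> E \<subseteq> tally ` W \<and> f - (\<Sum>e\<in>E. K (c e) * r e) \<in> A}"
  have A_scale: "K a * f \<in> A" if "f \<in> A" for a f using A(3)[OF that Pol_K] .
  have A_minus: "- f \<in> A" if "f \<in> A" for f using A_scale[OF that, of "-1"] by (simp add: K_simps)
  have swap1: "K (g x j * g y i) * (L x i * L y j) - K (g x i * g y j) * (L x j * L y i) \<in> A"
    if "x \<in> S" "y \<in> S" "i \<in> T" "j \<in> T" for x y i j
  proof -
    have "x = y \<or> (x, y) \<in> {(1, 2), (1, 3), (2, 3)} \<or> (y, x) \<in> {(1, 2), (1, 3), (2, 3)}"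
      using exhaust_3[of x] exhaust_3[of y] by (elim disjE) simp_all
    moreover have g: "\<forall>i\<in>T. g x i \<noteq> 0" "\<forall>i\<in>T. g y i \<noteq> 0" using that by (auto simp: S_def)
    moreover have ?thesis if "x = y \<or> i = j"
    proof -
      have "K (g x j * g y i) * (L x i * L y j) - K (g x i * g y j) * (L x j * L y i) = 0"
        using that by (elim disjE) (simp_all add: mult.commute)
      then show ?thesis using A(1) by simp
    qed
    moreover have ?thesis if "(x, y) \<in> {(1, 2), (1, 3), (2, 3)}" "i \<noteq> j"
      by (rule swap[OF that(1) \<open>i \<in> T\<close> \<open>j \<in> T\<close> that(2) g])
    moreover have ?thesis if "(y, x) \<in> {(1, 2), (1, 3), (2, 3)}" "i \<noteq> j"
      using swap[OF that(1) \<open>j \<in> T\<close> \<open>i \<in> T\<close> that(2)[symmetric] g(2,1)]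
      by (simp only: mult.commute)
    ultimately show ?thesis by meson
  qed
  have swap2: "K (1 / g x i) * L x i * (K (1 / g y j) * L y j) - K (1 / g x j) * L x j * (K (1 / g y i) * L y i) \<in> A"
    if "x \<in> S" "y \<in> S" "i \<in> T" "j \<in> T" for x y i j
  proof -
    have nz: "g x i \<noteq> 0" "g y i \<noteq> 0" "g x j \<noteq> 0" "g y j \<noteq> 0" using that by (auto simp: S_def)
    let ?u = "1 / (g x i * g y i * g x j * g y j)"
    have *: "1 / g x i * (1 / g y j) = ?u * (g x j * g y i)" "1 / g x j * (1 / g y i) = ?u * (g x i * g y j)"
      using nz by (auto simp: field_simps)
    have "K ?u * (K (g x j * g y i) * (L x i * L y j) - K (g x i * g y j) * (L x j * L y i)) \<in> A"
      using swap1[OF that] A_scale by blast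
    also have "K ?u * (K (g x j * g y i) * (L x i * L y j) - K (g x i * g y j) * (L x j * L y i)) =
      K (1 / g x i * (1 / g y j)) * (L x i * L y j) - K (1 / g x j * (1 / g y i)) * (L x j * L y i)"
      unfolding * K_mult[of ?u] by (simp add: algebra_simps)
    finally show ?thesis by (simp only: K_mult ac_simps)
  qed
  have r_word: "\<exists>N\<in>W. tally N = e \<and> r e = word g N" if "e \<in> tally ` W" for e
  proof -
    have "\<exists>N. N \<in> W \<and> tally N = e" using that by auto
    from someI_ex[OF this] show ?thesis unfolding r_def by blast
  qed
  have B_A: "f \<in> B" if "f \<in> A" for f
    unfolding B_def using that by (auto intro!: exI[of _ "{}"])
  have B_add: "f + h \<in> B" if fh: "f \<in> B" "h \<in> B" for f h
  proof -
    from fh obtain E c E' c' where E: "finite E" "E \<subseteq> tally ` W" "f - (\<Sum>e\<in>E. K (c e) * r e) \<in> A"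
      and E': "finite E'" "E' \<subseteq> tally ` W" "h - (\<Sum>e\<in>E'. K (c' e) * r e) \<in> A"
      unfolding B_def by blast
    let ?c = "\<lambda>e. (if e \<in> E then c e else 0) + (if e \<in> E' then c' e else 0)"
    have "(\<Sum>e\<in>E. K (c e) * r e) = (\<Sum>e\<in>E \<union> E'. K (if e \<in> E then c e else 0) * r e)"
      by (rule sum.mono_neutral_cong_left) (auto simp: E E' K_0)
    moreover have "(\<Sum>e\<in>E'. K (c' e) * r e) = (\<Sum>e\<in>E \<union> E'. K (if e \<in> E' then c' e else 0) * r e)"
      by (rule sum.mono_neutral_cong_left) (auto simp: E E' K_0)
    ultimately have "(\<Sum>e\<in>E. K (c e) * r e) + (\<Sum>e\<in>E'. K (c' e) * r e) = (\<Sum>e\<in>E \<union> E'. K (?c e) * r e)"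
      by (simp add: K_add distrib_right sum.distrib)
    moreover have "f + h - ((\<Sum>e\<in>E. K (c e) * r e) + (\<Sum>e\<in>E'. K (c' e) * r e)) \<in> A"
      using A(2)[OF E(3) E'(3)] by (simp add: algebra_simps)
    ultimately have "f + h - (\<Sum>e\<in>E \<union> E'. K (?c e) * r e) \<in> A" by simp
    then show ?thesis unfolding B_def using E E' by (auto intro!: exI[of _ "E \<union> E'"] exI[of _ ?c])
  qed
  have B_word: "K a * word g N \<in> B" if "N \<in> W" for a N
  proof -
    obtain N' where N': "N' \<in> W" "tally N' = tally N" "r (tally N) = word g N'"
      using r_word[OF imageI[OF \<open>N \<in> W\<close>]] by blast
    have "word g N - word g N' \<in> A"
      by (rule words_congruent[where T = T and S = S]) (use A swap2 that N' in \<open>auto simp: W_def\<close>)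
    then have "K a * word g N - K a * r (tally N) \<in> A"
      using A_scale N' by (simp add: right_diff_distrib[symmetric])
    then show ?thesis unfolding B_def using that
      by (auto intro!: exI[of _ "{tally N}"] exI[of _ "\<lambda>_. a"])
  qed
  have B_sum: "(\<Sum>x\<in>X. h x) \<in> B" if "\<And>x. x \<in> X \<Longrightarrow> h x \<in> B" for X :: "(3 + 'i \<Rightarrow> nat) set" and h
    using that by (induction X rule: infinite_finite_induct) (auto intro: B_add B_A A(1))
  have "f \<in> B" using f(1)
  proof (induction rule: Pol.induct)
    case (Pol_K a)
    then show ?case using B_word[of "{#}" a] by (simp add: W_def word_empty)
  next
    case (Pol_add f h)
    then show ?case by (intro B_add)
  next
    case (Pol_letter i f x)
    show ?case
    proof (cases "x \<in> S")
      case False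
      then have "L x i \<in> A" using good Pol_letter by (auto simp: S_def)
      then have "f * L x i \<in> A" using A(3) Pol_letter by auto
      then show ?thesis using B_A by (simp add: mult.commute)
    next
      case True
      from Pol_letter obtain E c where E: "finite E" "E \<subseteq> tally ` W" "f - (\<Sum>e\<in>E. K (c e) * r e) \<in> A"
        unfolding B_def by blast
      have "L x i * (f - (\<Sum>e\<in>E. K (c e) * r e)) \<in> B"
        using A(3)[OF E(3)] Pol_L Pol_letter B_A by auto
      moreover have "(\<Sum>e\<in>E. L x i * (K (c e) * r e)) \<in> B"
      proof (rule B_sum)
        fix e assume "e \<in> E"
        then obtain N where N: "N \<in> W" "r e = word g N"
          using r_word[OF subsetD[OF E(2)]] by blast
        have "K (c e * g x i) * word g (add_mset (x, i) N) \<in> B"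
          using N True Pol_letter by (intro B_word) (auto simp: W_def)
        moreover have "K (c e * g x i) * word g (add_mset (x, i) N) = L x i * (K (c e) * r e)"
        proof -
          have "K (g x i) * K (1 / g x i) = 1"
            using True Pol_letter by (simp add: K_mult[symmetric] K_1 S_def)
          moreover have "K (c e * g x i) * word g (add_mset (x, i) N) =
              (K (g x i) * K (1 / g x i)) * (L x i * (K (c e) * word g N))"
            unfolding word_add_mset K_mult by (simp only: ac_simps)
          ultimately show ?thesis unfolding N by simp
        qed
        ultimately show "L x i * (K (c e) * r e) \<in> B" by simp
      qed
      ultimately have "L x i * (f - (\<Sum>e\<in>E. K (c e) * r e)) + (\<Sum>e\<in>E. L x i * (K (c e) * r e)) \<in> B"
        by (rule B_add)
      then show ?thesis by (simp add: right_diff_distrib sum_distrib_left)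
    qed
  qed
  then obtain E c where E: "finite E" "E \<subseteq> tally ` W" and fA: "f - (\<Sum>e\<in>E. K (c e) * r e) \<in> A"
    unfolding B_def by blast
  have "c e = 0" if "e \<in> E" for e
  proof (rule monomials_independent[OF E(1) _ that])
    fix w :: "3 + 'i \<Rightarrow> complex" assume nz: "\<And>v. w v \<noteq> 0"
    let ?p = "\<lambda>x i. w (Inr i) * w (Inl x) * g x i"
    have "?p \<in> V" by (rule V) (auto simp: nz)
    then have "ev ?p (f - (\<Sum>e\<in>E. K (c e) * r e)) = 0" "ev ?p f = 0"
      using fA f(2) A_van by (auto simp: van_def)
    then have "(\<Sum>e\<in>E. c e * ev ?p (r e)) = 0" by (simp add: ev_simps ev_sum)
    moreover have "ev ?p (r e) = (\<Prod>v\<in>UNIV. w v ^ e v)" if "e \<in> E" for e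
    proof -
      obtain N where N: "N \<in> W" "tally N = e" "r e = word g N" 
        using r_word[OF subsetD[OF E(2) \<open>e \<in> E\<close>]] by (elim bexE conjE)
      have "ev ?p (word g N) = (\<Prod>v\<in>UNIV. (case v of Inl x \<Rightarrow> w (Inl x) | Inr i \<Rightarrow> w (Inr i)) ^ tally N v)"
        by (rule ev_word) (use N in \<open>auto simp: W_def S_def\<close>)
      moreover have "(case v of Inl x \<Rightarrow> w (Inl x) | Inr i \<Rightarrow> w (Inr i)) = w v" for v
        by (cases v) auto
      ultimately show ?thesis using N by (simp only:)
    qed
    ultimately show "(\<Sum>e\<in>E. c e * (\<Prod>v\<in>UNIV. w v ^ e v)) = 0" by simp
  qed
  then show ?thesis using fA by (simp add: K_0)
qed

section \<open>Submodules and cancellation\<close>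

definition submod :: "'i set \<Rightarrow> 'r set \<Rightarrow> bool" where
  "submod T A \<longleftrightarrow> 0 \<in> A \<and> (\<forall>f\<in>A. \<forall>g\<in>A. f + g \<in> A) \<and> (\<forall>f\<in>A. \<forall>g\<in>Pol T. g * f \<in> A)"

lemma submodD:
  assumes "submod T A"
  shows "0 \<in> A" "f \<in> A \<Longrightarrow> g \<in> A \<Longrightarrow> f + g \<in> A" "f \<in> A \<Longrightarrow> g \<in> Pol T \<Longrightarrow> g * f \<in> A"
    "f \<in> A \<Longrightarrow> K a * f \<in> A" "f \<in> A \<Longrightarrow> - f \<in> A" "f \<in> A \<Longrightarrow> g \<in> A \<Longrightarrow> f - g \<in> A"
proof -
  show *: "0 \<in> A" "f \<in> A \<Longrightarrow> g \<in> A \<Longrightarrow> f + g \<in> A" "f \<in> A \<Longrightarrow> g \<in> Pol T \<Longrightarrow> g * f \<in> A" for f g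
    using assms by (auto simp: submod_def)
  show **: "f \<in> A \<Longrightarrow> K a * f \<in> A" for f a using *(3) Pol_K by blast
  show ***: "f \<in> A \<Longrightarrow> - f \<in> A" for f using **[of f "-1"] by (simp add: K_simps)
  show "f \<in> A \<Longrightarrow> g \<in> A \<Longrightarrow> f - g \<in> A" using *(2)[of f "- g"] ***[of g] by simp
qed

lemma submod_mono: "submod T A \<Longrightarrow> T' \<subseteq> T \<Longrightarrow> submod T' A"
  unfolding submod_def using Pol_mono by blast

definition adjoin :: "'r set \<Rightarrow> 'r \<Rightarrow> 'i set \<Rightarrow> 'r set" where
  "adjoin A h T = {a + h * p | a p. a \<in> A \<and> p \<in> Pol T}"

lemma adjoinI: "a \<in> A \<Longrightarrow> p \<in> Pol T \<Longrightarrow> f = a + h * p \<Longrightarrow> f \<in> adjoin A h T"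
  by (auto simp: adjoin_def)

lemma adjoin_subset: "f \<in> A \<Longrightarrow> f \<in> adjoin A h T"
  using adjoinI[of f A 0 T f h] Pol_0 by simp

lemma submod_adjoin:
  assumes "submod T A"
  shows "submod T (adjoin A h T)"
  unfolding submod_def
proof (intro conjI ballI)
  show "0 \<in> adjoin A h T"
    using adjoin_subset submodD(1)[OF assms] by blast
next
  fix f g assume "f \<in> adjoin A h T" "g \<in> adjoin A h T"
  then obtain a p b q where *: "a \<in> A" "p \<in> Pol T" "b \<in> A" "q \<in> Pol T" "f = a + h * p" "g = b + h * q"
    by (auto simp: adjoin_def)
  then show "f + g \<in> adjoin A h T"
    using assms by (intro adjoinI[of "a + b" _ "p + q"] submodD(2)[OF assms] Pol_add) (auto simp: algebra_simps)
next
  fix f g assume "f \<in> adjoin A h T" "g \<in> Pol T"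
  then obtain a p where *: "a \<in> A" "p \<in> Pol T" "f = a + h * p" "g \<in> Pol T"
    by (auto simp: adjoin_def)
  then show "g * f \<in> adjoin A h T"
    using assms by (intro adjoinI[of "g * a" _ "g * p"] submodD(3)[OF assms] Pol_mult) (auto simp: algebra_simps)
qed

text \<open>
  The colon sets to which \<open>rank_one_vanishing\<close> and \<open>lines_at_vanishing\<close>
  are applied. The vanishing condition ensures that a polynomial and its normal form modulo the
  set have the same values.
\<close>

lemma submod_van_colon:
  assumes "submod T B"
  shows "submod T {g \<in> van V. h * g \<in> B}"
  unfolding submod_def
proof (intro conjI ballI; clarsimp simp: van_0 van_add van_mult)
  show "0 \<in> B" by (rule submodD(1)[OF assms])
next
  fix f g assume "h * f \<in> B" "h * g \<in> B"
  then show "h * (f + g) \<in> B" using submodD(2)[OF assms] by (simp add: distrib_left)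
next
  fix f g assume "h * f \<in> B" "g \<in> Pol T"
  then show "h * (g * f) \<in> B" using submodD(3)[OF assms, of "h * f" g] by (simp add: ac_simps)
qed

text \<open>
  A factor may be cancelled if it is nonzero on a dense part of the point set.
\<close>

lemma van_cancel:
  assumes "h * f \<in> van V" "f \<in> Pol T"
    and "\<And>p. p \<in> V \<Longrightarrow> ev p h = 0 \<Longrightarrow>
      \<exists>q. (\<forall>x i. isCont (\<lambda>t. q t x i) (0::complex)) \<and> q 0 = p \<and> (\<forall>t. t \<noteq> 0 \<longrightarrow> q t \<in> V \<and> ev (q t) h \<noteq> 0)"
  shows "f \<in> van V"
  unfolding van_def
proof (intro CollectI ballI)
  fix p assume "p \<in> V"
  have *: "ev q h * ev q f = 0" if "q \<in> V" for q
    using assms(1) that by (auto simp: van_def ev_mult)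
  show "ev p f = 0"
  proof (cases "ev p h = 0")
    case True
    from assms(3)[OF \<open>p \<in> V\<close> this] obtain q where q: "(\<forall>x i. isCont (\<lambda>t. q t x i) (0::complex)) \<and> q 0 = p \<and>
      (\<forall>t. t \<noteq> 0 \<longrightarrow> q t \<in> V \<and> ev (q t) h \<noteq> 0)"
      by blast
    have "ev (q 0) f = 0"
      by (rule ev_eq_0_limit[OF assms(2)]) (use q * in \<open>auto simp: eventually_at_filter intro!: always_eventually\<close>)
    then show ?thesis using q by simp
  next
    case False
    then show ?thesis using *[OF \<open>p \<in> V\<close>] by simp
  qed
qed

abbreviation X where "X i \<equiv> L 1 i"
abbreviation Y where "Y i \<equiv> L 2 i"
abbreviation Z where "Z i \<equiv> L 3 i"

definition pt :: "('i \<Rightarrow> complex) \<Rightarrow> ('i \<Rightarrow> complex) \<Rightarrow> ('i \<Rightarrow> complex) \<Rightarrow> 3 \<Rightarrow> 'i \<Rightarrow> complex" where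
  "pt l u v = (\<lambda>x i. if x = 1 then l i else if x = 2 then l i * u i else l i * v i)"

lemma pt_simps [simp]: "pt l u v 1 i = l i" "pt l u v 2 i = l i * u i" "pt l u v 3 i = l i * v i"
  by (auto simp: pt_def)

lemma isCont_pt:
  assumes "\<And>i. isCont (\<lambda>t. u t i) s" "\<And>i. isCont (\<lambda>t. v t i) s"
  shows "isCont (\<lambda>t. pt l (u t) (v t) x i) s"
  using exhaust_3[of x] by (auto intro!: continuous_intros assms)

lemma scale_at_pt: "scale_at n t (pt l u v) = pt (\<lambda>i. if i = n then t * l i else l i) u v"
  by (auto simp: scale_at_def pt_def fun_eq_iff)

definition rank_one_points :: "('i \<Rightarrow> complex) \<Rightarrow> ('i \<Rightarrow> complex) \<Rightarrow> (3 \<Rightarrow> 'i \<Rightarrow> complex) set" where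
  "rank_one_points g h = {pt l (\<lambda>i. t * g i) (\<lambda>i. s * h i) | l t s. \<forall>i. l i \<noteq> 0}"

lemma rank_one_pointsI: "(\<And>i. l i \<noteq> 0) \<Longrightarrow> pt l (\<lambda>i. t * g i) (\<lambda>i. s * h i) \<in> rank_one_points g h"
  unfolding rank_one_points_def by blast

lemma rank_one_vanishing_XYZ:
  assumes A: "submod T A" "A \<subseteq> van (rank_one_points g h)"
    and g: "\<And>i. i \<in> T \<Longrightarrow> g i \<noteq> 0"
    and h: "(\<forall>i\<in>T. h i \<noteq> 0) \<or> (\<forall>i\<in>T. Z i \<in> A)"
    and XY: "\<And>i j. i \<in> T \<Longrightarrow> j \<in> T \<Longrightarrow> i \<noteq> j \<Longrightarrow> K (g i) * (X i * Y j) - K (g j) * (X j * Y i) \<in> A"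
    and XZ: "\<And>i j. i \<in> T \<Longrightarrow> j \<in> T \<Longrightarrow> i \<noteq> j \<Longrightarrow> \<forall>i\<in>T. h i \<noteq> 0 \<Longrightarrow>
      K (h i) * (X i * Z j) - K (h j) * (X j * Z i) \<in> A"
    and YZ: "\<And>i j. i \<in> T \<Longrightarrow> j \<in> T \<Longrightarrow> i \<noteq> j \<Longrightarrow> \<forall>i\<in>T. h i \<noteq> 0 \<Longrightarrow>
      K (g j * h i) * (Y i * Z j) - K (g i * h j) * (Y j * Z i) \<in> A"
    and f: "f \<in> Pol T" "f \<in> van (rank_one_points g h)"
  shows "f \<in> A"
proof (rule rank_one_vanishing[where g = "pt (\<lambda>_. 1) g h" and T = T and V = "rank_one_points g h"])
  fix l :: "'i \<Rightarrow> complex" and th :: "3 \<Rightarrow> complex"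
  assume nz: "\<And>i. l i \<noteq> 0" "\<And>x. th x \<noteq> 0"
  have "l i * th x * pt (\<lambda>_. 1) g h x i =
      pt (\<lambda>i. l i * th 1) (\<lambda>i. th 2 / th 1 * g i) (\<lambda>i. th 3 / th 1 * h i) x i" for x i
    using exhaust_3[of x] nz by auto
  then have "(\<lambda>x i. l i * th x * pt (\<lambda>_. 1) g h x i) =
      pt (\<lambda>i. l i * th 1) (\<lambda>i. th 2 / th 1 * g i) (\<lambda>i. th 3 / th 1 * h i)"
    by (intro ext)
  also have "\<dots> \<in> rank_one_points g h" using nz by (intro rank_one_pointsI) simp
  finally show "(\<lambda>x i. l i * th x * pt (\<lambda>_. 1) g h x i) \<in> rank_one_points g h" .
next
  show "(\<forall>i\<in>T. pt (\<lambda>_. 1) g h x i \<noteq> 0) \<or> (\<forall>i\<in>T. L x i \<in> A)" for x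
    using exhaust_3[of x] g h by auto
next
  fix x y i j assume *: "(x, y) \<in> {(1::3, 2::3), (1, 3), (2, 3)}" "i \<in> T" "j \<in> T" "i \<noteq> j"
    "\<forall>i\<in>T. pt (\<lambda>_. 1) g h x i \<noteq> 0" "\<forall>i\<in>T. pt (\<lambda>_. 1) g h y i \<noteq> 0"
  then show "K (pt (\<lambda>_. 1) g h x j * pt (\<lambda>_. 1) g h y i) * (L x i * L y j) -
       K (pt (\<lambda>_. 1) g h x i * pt (\<lambda>_. 1) g h y j) * (L x j * L y i) \<in> A"
    using XY[of i j] XZ[of i j] YZ[of i j] by auto
qed (use assms submodD[OF A(1)] in auto)

end

locale collinear_letters = letter_algebra K L ev
  for K :: "complex \<Rightarrow> 'r::comm_ring_1" and L :: "3 \<Rightarrow> 'i::finite \<Rightarrow> 'r" and ev +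
  fixes al be :: "'i \<Rightarrow> complex"
  assumes distinct: "i \<noteq> j \<Longrightarrow> al i * be j - al j * be i \<noteq> 0"
begin

definition br :: "'i \<Rightarrow> 'i \<Rightarrow> complex" where
  "br i j = al i * be j - al j * be i"

lemma br_nonzero: "i \<noteq> j \<Longrightarrow> br i j \<noteq> 0"
  using distinct by (simp add: br_def)

lemma br_self [simp]: "br i i = 0"
  by (simp add: br_def)

text \<open>
  The maximal minor in three columns with the rows \<open>- be i * X i\<close>, \<open>al i * X
  i\<close>, \<open>y i\<close>. It says that the quotients \<open>y / X\<close> are the values of
  one linear form at three centres.
\<close>

definition minor_XX :: "('i \<Rightarrow> 'r) \<Rightarrow> 'i \<Rightarrow> 'i \<Rightarrow> 'i \<Rightarrow> 'r" where
  "minor_XX y i j k = K (br j k) * (X j * X k * y i) + K (br k i) * (X k * X i * y j)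
     + K (br i j) * (X i * X j * y k)"

text \<open>
  The maximal minor in three columns with the rows \<open>(a * al i + b * be i) * X i\<close>,
  \<open>y i\<close>, \<open>z i\<close>.
\<close>

definition minor_XYZ :: "('i \<Rightarrow> 'r) \<Rightarrow> ('i \<Rightarrow> 'r) \<Rightarrow> complex \<Rightarrow> complex \<Rightarrow> 'i \<Rightarrow> 'i \<Rightarrow> 'i \<Rightarrow> 'r" where
  "minor_XYZ y z a b i j k = K (a * al i + b * be i) * (X i * (y j * z k - y k * z j))
     + K (a * al j + b * be j) * (X j * (y k * z i - y i * z k))
     + K (a * al k + b * be k) * (X k * (y i * z j - y j * z i))"

text \<open>
  The coefficient of \<open>y m\<close> in \<open>quad_form\<close>. It vanishes if \<open>x i = l
  i * s * br i m\<close> and \<open>y i = l i * U (c i)\<close> for a linear form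
  \<open>U\<close>.
\<close>

definition triple_form :: "('i \<Rightarrow> 'r) \<Rightarrow> ('i \<Rightarrow> 'r) \<Rightarrow> 'i \<Rightarrow> 'i \<Rightarrow> 'i \<Rightarrow> 'i \<Rightarrow> 'r" where
  "triple_form x y m i j k = K (br j k * br i m) * (x j * x k * y i)
     + K (br k i * br j m) * (x k * x i * y j)
     + K (br i j * br k m) * (x i * x j * y k)"

text \<open>
  The 4 x 4 determinant with the columns \<open>(al i * y i, be i * y i, al i * z i, be i * z
  i)\<close>, ordered by the letters of the last index. If \<open>y i = l i * (u1 * al i + u2 * be
  i)\<close> and \<open>z i = l i * (v1 * al i + v2 * be i)\<close>, then \<open>v1 * al i * y i +
  v2 * be i * y i\<close> is equal to \<open>u1 * al i * z i + u2 * be i * z i\<close>, so the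
  rows are dependent.
\<close>

definition quad_form :: "('i \<Rightarrow> 'r) \<Rightarrow> ('i \<Rightarrow> 'r) \<Rightarrow> 'i \<Rightarrow> 'i \<Rightarrow> 'i \<Rightarrow> 'i \<Rightarrow> 'r" where
  "quad_form y z i j k m = y m * triple_form z y m i j k + z m * triple_form y z m i j k"

abbreviation lin :: "complex \<Rightarrow> complex \<Rightarrow> 'i \<Rightarrow> complex" where
  "lin a b \<equiv> \<lambda>i. a * al i + b * be i"

text \<open>
  The letters of the lines that do not meet the line of centres: \<open>u1, u2\<close> and
  \<open>v1, v2\<close> are the coefficients of the linear forms \<open>U\<close> and
  \<open>V\<close>.
\<close>

definition line_points :: "(3 \<Rightarrow> 'i \<Rightarrow> complex) set" where
  "line_points = {pt l (lin u1 u2) (lin v1 v2) | l u1 u2 v1 v2.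
     \<forall>i. l i \<noteq> 0}"

text \<open>
  The points of \<open>line_points\<close> at which the letter \<open>Z\<close> of
  \<open>m\<close> vanishes: a linear form that vanishes at \<open>c m\<close> is a multiple of
  the bracket with \<open>m\<close>.
\<close>

definition lines_at :: "'i \<Rightarrow> (3 \<Rightarrow> 'i \<Rightarrow> complex) set" where
  "lines_at m = {pt l (lin u1 u2) (\<lambda>i. s * br i m) | l u1 u2 s. \<forall>i. l i \<noteq> 0}"

lemma line_pointsI:
  "(\<And>i. l i \<noteq> 0) \<Longrightarrow> pt l (lin u1 u2) (lin v1 v2) \<in> line_points"
  unfolding line_points_def by blast

lemma lines_atI:
  "(\<And>i. l i \<noteq> 0) \<Longrightarrow> pt l (lin u1 u2) (\<lambda>i. s * br i m) \<in> lines_at m"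
  unfolding lines_at_def by blast

lemma br_multiple: "(\<lambda>i. s * br i m) = (\<lambda>i. (s * be m) * al i + (- (s * al m)) * be i)"
  by (auto simp: br_def algebra_simps)

lemma lines_at_subset: "lines_at m \<subseteq> line_points"
proof
  fix p assume "p \<in> lines_at m"
  then obtain l u1 u2 s where p: "p = pt l (lin u1 u2) (\<lambda>i. s * br i m)"
    and l: "\<forall>i. l i \<noteq> 0"
    unfolding lines_at_def by blast
  show "p \<in> line_points" unfolding p br_multiple by (rule line_pointsI) (use l in simp)
qed

lemma rank_one_subset_lines_at: "rank_one_points (\<lambda>i. br i n) (\<lambda>i. br i m) \<subseteq> lines_at m"
proof
  fix p assume "p \<in> rank_one_points (\<lambda>i. br i n) (\<lambda>i. br i m)"
  then obtain l t s where p: "p = pt l (\<lambda>i. t * br i n) (\<lambda>i. s * br i m)" and l: "\<forall>i. l i \<noteq> 0"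
    unfolding rank_one_points_def by blast
  show "p \<in> lines_at m" unfolding p br_multiple[of _ n] by (rule lines_atI) (use l in simp)
qed

lemma scale_line_points:
  assumes "p \<in> line_points" "t \<noteq> 0"
  shows "scale_at n t p \<in> line_points"
proof -
  obtain l u1 u2 v1 v2 where "p = pt l (lin u1 u2) (lin v1 v2)"
    "\<forall>i. l i \<noteq> 0" using assms(1) unfolding line_points_def by blast
  then show ?thesis using assms(2) by (simp add: scale_at_pt line_pointsI)
qed

lemma scale_lines_at:
  assumes "p \<in> lines_at m" "t \<noteq> 0"
  shows "scale_at n t p \<in> lines_at m"
proof -
  obtain l u1 u2 s where "p = pt l (lin u1 u2) (\<lambda>i. s * br i m)" "\<forall>i. l i \<noteq> 0"
    using assms(1) unfolding lines_at_def by blast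
  then show ?thesis using assms(2) by (simp add: scale_at_pt lines_atI)
qed

lemma exists_linear_form:
  assumes "m \<noteq> n"
  shows "\<exists>a b. a * al m + b * be m = (c::complex)"
proof (cases "al m = 0")
  case True
  then have "be m \<noteq> 0" using distinct[OF assms] by auto
  then show ?thesis using True by (auto intro!: exI[of _ "c / be m"])
next
  case False
  then show ?thesis by (intro exI[of _ "c / al m"] exI[of _ 0]) simp
qed

lemma cancel_Y_lines_at:
  assumes "Y n ^ b * f \<in> van (lines_at m)" "f \<in> Pol T" "n \<noteq> k"
  shows "f \<in> van (lines_at m)"
proof (rule van_cancel[OF assms(1,2)])
  fix p assume p: "p \<in> lines_at m" "ev p (Y n ^ b) = 0"
  then obtain l u1 u2 s where l: "p = pt l (lin u1 u2) (\<lambda>i. s * br i m)" "\<forall>i. l i \<noteq> 0"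
    by (auto simp: lines_at_def)
  have 0: "u1 * al n + u2 * be n = 0" using p(2) l by (auto simp: ev_simps)
  obtain a c where ac: "a * al n + c * be n = 1" using exists_linear_form[OF assms(3)] by blast
  let ?q = "\<lambda>t. pt l (\<lambda>i. (u1 + t * a) * al i + (u2 + t * c) * be i) (\<lambda>i. s * br i m)"
  have "(u1 + t * a) * al n + (u2 + t * c) * be n = t" for t
  proof -
    have "(u1 + t * a) * al n + (u2 + t * c) * be n =
        (u1 * al n + u2 * be n) + t * (a * al n + c * be n)" by (simp add: algebra_simps)
    then show ?thesis using 0 ac by simp
  qed
  then have "ev (?q t) (Y n ^ b) \<noteq> 0" if "t \<noteq> 0" for t using l that by (simp add: ev_simps)
  moreover have "?q t \<in> lines_at m" for t using l(2) by (intro lines_atI) simp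
  moreover have "isCont (\<lambda>t. ?q t x i) 0" for x i
    by (rule isCont_pt) (auto intro!: continuous_intros)
  ultimately show "\<exists>q. (\<forall>x i. isCont (\<lambda>t. q t x i) (0::complex)) \<and> q 0 = p \<and>
      (\<forall>t. t \<noteq> 0 \<longrightarrow> q t \<in> lines_at m \<and> ev (q t) (Y n ^ b) \<noteq> 0)"
    using l(1) by (intro exI[of _ ?q]) simp
qed

lemma cancel_Z_line_points:
  assumes "Z n * f \<in> van line_points" "f \<in> Pol T" "n \<noteq> k"
  shows "f \<in> van line_points"
proof (rule van_cancel[OF assms(1,2)])
  fix p assume p: "p \<in> line_points" "ev p (Z n) = 0"
  then obtain l u1 u2 v1 v2 where l: "p = pt l (lin u1 u2) (lin v1 v2)"
    "\<forall>i. l i \<noteq> 0"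
    by (auto simp: line_points_def)
  have 0: "v1 * al n + v2 * be n = 0" using p(2) l by (auto simp: ev_simps)
  obtain a c where ac: "a * al n + c * be n = 1" using exists_linear_form[OF assms(3)] by blast
  let ?q = "\<lambda>t. pt l (lin u1 u2) (\<lambda>i. (v1 + t * a) * al i + (v2 + t * c) * be i)"
  have "(v1 + t * a) * al n + (v2 + t * c) * be n = t" for t
  proof -
    have "(v1 + t * a) * al n + (v2 + t * c) * be n =
        (v1 * al n + v2 * be n) + t * (a * al n + c * be n)" by (simp add: algebra_simps)
    then show ?thesis using 0 ac by simp
  qed
  then have "ev (?q t) (Z n) \<noteq> 0" if "t \<noteq> 0" for t using l that by (simp add: ev_simps)
  moreover have "?q t \<in> line_points" for t using l(2) by (intro line_pointsI) simp
  moreover have "isCont (\<lambda>t. ?q t x i) 0" for x i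
    by (rule isCont_pt) (auto intro!: continuous_intros)
  ultimately show "\<exists>q. (\<forall>x i. isCont (\<lambda>t. q t x i) (0::complex)) \<and> q 0 = p \<and>
      (\<forall>t. t \<noteq> 0 \<longrightarrow> q t \<in> line_points \<and> ev (q t) (Z n) \<noteq> 0)"
    using l(1) by (intro exI[of _ ?q]) simp
qed

lemma cancel_Z_rank_one:
  assumes "Z n * f \<in> van (rank_one_points g h)" "f \<in> Pol T" "h n \<noteq> 0"
  shows "f \<in> van (rank_one_points g h)"
proof (rule van_cancel[OF assms(1,2)])
  fix p assume p: "p \<in> rank_one_points g h" "ev p (Z n) = 0"
  then obtain l t0 s where l: "p = pt l (\<lambda>i. t0 * g i) (\<lambda>i. s * h i)" "\<forall>i. l i \<noteq> 0"
    by (auto simp: rank_one_points_def)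
  have 0: "s = 0" using p(2) l assms(3) by (auto simp: ev_simps)
  let ?q = "\<lambda>t. pt l (\<lambda>i. t0 * g i) (\<lambda>i. t * h i)"
  have "ev (?q t) (Z n) \<noteq> 0" if "t \<noteq> 0" for t using l assms(3) that by (simp add: ev_simps)
  moreover have "?q t \<in> rank_one_points g h" for t using l(2) by (intro rank_one_pointsI) simp
  moreover have "isCont (\<lambda>t. ?q t x i) 0" for x i
    by (rule isCont_pt) (auto intro!: continuous_intros)
  ultimately show "\<exists>q. (\<forall>x i. isCont (\<lambda>t. q t x i) (0::complex)) \<and> q 0 = p \<and>
      (\<forall>t. t \<noteq> 0 \<longrightarrow> q t \<in> rank_one_points g h \<and> ev (q t) (Z n) \<noteq> 0)"
    using l(1) 0 by (intro exI[of _ ?q]) simp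
qed

section \<open>Polynomials that vanish where one letter is zero\<close>

context
  fixes m :: 'i and T0 :: "'i set" and A :: "'r set"
  assumes m: "m \<notin> T0"
    and A: "submod T0 A" "A \<subseteq> van (lines_at m)"
    and A_XZ: "\<And>i j. i \<in> T0 \<Longrightarrow> j \<in> T0 \<Longrightarrow> i \<noteq> j \<Longrightarrow>
      K (br j m) * (X j * Z i) - K (br i m) * (X i * Z j) \<in> A"
    and A_mxx: "\<And>i j k. {i, j, k} \<subseteq> T0 \<Longrightarrow> distinct [i, j, k] \<Longrightarrow> minor_XX (L 2) i j k \<in> A"
    and A_mxyz: "\<And>a b i j k. {i, j, k} \<subseteq> T0 \<Longrightarrow> distinct [i, j, k] \<Longrightarrow> minor_XYZ (L 2) (L 3) a b i j k \<in> A"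
    and A_tri: "\<And>i j k. {i, j, k} \<subseteq> T0 \<Longrightarrow> distinct [i, j, k] \<Longrightarrow> triple_form (L 3) (L 2) m i j k \<in> A"
begin

text \<open>
  At the points of the hypothesis \<open>Y i\<close> is proportional to \<open>br i n\<close> and
  \<open>Z i\<close> is zero. So \<open>g\<close> is a combination of the letters \<open>Z
  i\<close> and the 2 x 2 minors of \<open>X\<close> and \<open>Y\<close>, and the relations in
  \<open>A\<close> turn the product of \<open>X n\<close> with each of them into a multiple of
  \<open>Z n\<close> or \<open>Y n\<close>.
\<close>

lemma X_times_vanishing:
  assumes "n \<in> T0" "T \<subseteq> T0" "n \<notin> T" "g \<in> Pol T" "g \<in> van (rank_one_points (\<lambda>i. br i n) (\<lambda>i. 0))"
  shows "X n * g \<in> adjoin (adjoin A (Y n) T) (Z n) T"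
proof -
  let ?B = "adjoin (adjoin A (Y n) T) (Z n) T"
  have sub: "submod T A" using submod_mono A assms by blast
  let ?V = "rank_one_points (\<lambda>i. br i n) (\<lambda>i. 0)"
  have "g \<in> {g \<in> van ?V. X n * g \<in> ?B}"
  proof (rule rank_one_vanishing_XYZ[where T = T, OF _ _ _ _ _ _ _ assms(4,5)])
    show "submod T {g \<in> van ?V. X n * g \<in> ?B}"
      by (intro submod_van_colon submod_adjoin sub)
    show "br i n \<noteq> 0" if "i \<in> T" for i using that assms by (intro br_nonzero) auto
    have "Z i \<in> {g \<in> van ?V. X n * g \<in> ?B}" if "i \<in> T" for i
    proof -
      have nz: "br n m \<noteq> 0" using assms(1) m by (intro br_nonzero) auto
      have "K (br n m) * (X n * Z i) - K (br i m) * (X i * Z n) \<in> A"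
        using A_XZ[of i n] that assms by auto
      then have "K (1 / br n m) * (K (br n m) * (X n * Z i) - K (br i m) * (X i * Z n)) \<in> A"
        by (rule submodD(4)[OF sub])
      moreover have "K (1 / br n m) * (K (br n m) * (X n * Z i) - K (br i m) * (X i * Z n))
        = K (1 / br n m * br n m) * (X n * Z i) - Z n * (K (1 / br n m * br i m) * X i)"
        by (simp only: K_mult algebra_simps)
      ultimately have "X n * Z i - Z n * (K (br i m / br n m) * X i) \<in> A"
        using nz by (simp add: K_1)
      then have "X n * Z i \<in> ?B"
        using that by (intro adjoinI[OF adjoin_subset, of "X n * Z i - Z n * (K (br i m / br n m) * X i)" A
            "K (br i m / br n m) * X i"])
          (auto intro!: Pol_closed)
      then show ?thesis by (auto simp: van_def rank_one_points_def ev_simps)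
    qed
    then show "(\<forall>i\<in>T. (0::complex) \<noteq> 0) \<or> (\<forall>i\<in>T. Z i \<in> {g \<in> van ?V. X n * g \<in> ?B})" by blast
    show "K (br i n) * (X i * Y j) - K (br j n) * (X j * Y i) \<in> {g \<in> van ?V. X n * g \<in> ?B}"
      if "i \<in> T" "j \<in> T" "i \<noteq> j" for i j
    proof -
      have "- minor_XX (L 2) i j n \<in> A" using that assms by (intro submodD(5)[OF sub] A_mxx) auto
      moreover have "X n * (K (br i n) * (X i * Y j) - K (br j n) * (X j * Y i)) =
        - minor_XX (L 2) i j n + Y n * (K (br i j) * X i * X j)"
        by (simp add: minor_XX_def br_def K_simps algebra_simps)
      ultimately have "X n * (K (br i n) * (X i * Y j) - K (br j n) * (X j * Y i)) \<in> adjoin A (Y n) T"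
        using that by (intro adjoinI[of "- minor_XX (L 2) i j n" A "K (br i j) * X i * X j"]) (auto intro!: Pol_closed)
      then show ?thesis using adjoin_subset by (auto simp: van_def rank_one_points_def ev_simps)
    qed
  qed auto
  then show ?thesis by simp
qed

text \<open>
  Here \<open>Y i\<close> is proportional to \<open>br i n\<close> and \<open>Z i\<close> to
  \<open>br i m\<close>, and \<open>g\<close> is a combination of the 2 x 2 minors of these three
  rows. For the minors of \<open>X, Y\<close> the relation \<open>minor_XYZ\<close> is used, for
  those of \<open>Y, Z\<close> the relation \<open>triple_form\<close>.
\<close>

lemma Z_times_vanishing:
  assumes "n \<in> T0" "T \<subseteq> T0" "n \<notin> T" "g \<in> Pol T"
    "g \<in> van (rank_one_points (\<lambda>i. br i n) (\<lambda>i. br i m))"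
  shows "Z n * g \<in> adjoin A (Y n) T"
proof -
  let ?B = "adjoin A (Y n) T"
  have sub: "submod T A" using submod_mono A assms by blast
  let ?V = "rank_one_points (\<lambda>i. br i n) (\<lambda>i. br i m)"
  have nm: "n \<noteq> m" using assms m by auto
  have "g \<in> {g \<in> van ?V. Z n * g \<in> ?B}"
  proof (rule rank_one_vanishing_XYZ[where T = T, OF _ _ _ _ _ _ _ assms(4,5)])
    show "submod T {g \<in> van ?V. Z n * g \<in> ?B}"
      by (intro submod_van_colon submod_adjoin sub)
    show "br i n \<noteq> 0" if "i \<in> T" for i using that assms by (intro br_nonzero) auto
    show "(\<forall>i\<in>T. br i m \<noteq> 0) \<or> (\<forall>i\<in>T. Z i \<in> {g \<in> van ?V. Z n * g \<in> ?B})"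
      by (intro disjI1 ballI br_nonzero) (use assms m in auto)
    show "K (br i n) * (X i * Y j) - K (br j n) * (X j * Y i) \<in> {g \<in> van ?V. Z n * g \<in> ?B}"
      if ij: "i \<in> T" "j \<in> T" "i \<noteq> j" for i j
    proof -
      \<comment> \<open>In the relation for this linear form, \<open>?q\<close> moves the letter \<open>Z\<close> to \<open>n\<close>. By the Pluecker
        relation the remaining coefficients are the brackets with \<open>n\<close> times the value at \<open>m\<close>.\<close>
      obtain a b where ab: "a * al m + b * be m = -1" using exists_linear_form[of m n] nm by blast
      let ?w = "\<lambda>c. a * al c + b * be c"
      let ?q = "\<lambda>i. K (br n m) * (X n * Z i) - K (br i m) * (X i * Z n)"
      let ?a = "K (br n m) * minor_XYZ (L 2) (L 3) a b i j n - K (?w n) * Y i * ?q j + K (?w n) * Y j * ?q i"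
      let ?p = "K (br n m) * (K (?w i) * (X i * Z j) - K (?w j) * (X j * Z i))"
      have "?q i \<in> A" "?q j \<in> A" "minor_XYZ (L 2) (L 3) a b i j n \<in> A"
        using A_XZ[of i n] A_XZ[of j n] A_mxyz[of i j n] ij assms by auto
      then have "K (br n m) * minor_XYZ (L 2) (L 3) a b i j n \<in> A" "K (?w n) * Y i * ?q j \<in> A" "K (?w n) * Y j * ?q i \<in> A"
        using submodD(4)[OF sub, of "minor_XYZ (L 2) (L 3) a b i j n"] submodD(3)[OF sub, of "?q j" "K (?w n) * Y i"]
          submodD(3)[OF sub, of "?q i" "K (?w n) * Y j"] ij by (auto intro: Pol_closed)
      then have a: "?a \<in> A" by (intro submodD(2)[OF sub] submodD(6)[OF sub])
      have "Z n * (K (br i n) * (X i * Y j) - K (br j n) * (X j * Y i)) =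
        - K (?w m) * (Z n * (K (br i n) * (X i * Y j) - K (br j n) * (X j * Y i)))"
        unfolding ab by (simp add: K_simps)
      also have "\<dots> = ?a + Y n * ?p"
        by (simp add: minor_XYZ_def br_def K_simps algebra_simps)
      finally have "Z n * (K (br i n) * (X i * Y j) - K (br j n) * (X j * Y i)) \<in> ?B"
        using a ij by (intro adjoinI[of ?a A ?p]) (auto intro!: Pol_closed)
      then show ?thesis by (auto simp: van_def rank_one_points_def ev_simps)
    qed
    show "K (br i m) * (X i * Z j) - K (br j m) * (X j * Z i) \<in> {g \<in> van ?V. Z n * g \<in> ?B}"
      if ij: "i \<in> T" "j \<in> T" "i \<noteq> j" for i j
    proof -
      have "K (br i m) * (X i * Z j) - K (br j m) * (X j * Z i) \<in> A"
        using A_XZ[of j i] ij assms by auto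
      then have "Z n * (K (br i m) * (X i * Z j) - K (br j m) * (X j * Z i)) \<in> ?B"
        using assms by (intro adjoin_subset submodD(3)[OF A(1)] Pol_L) auto
      then show ?thesis by (auto simp: van_def rank_one_points_def ev_simps)
    qed
    show "K (br j n * br i m) * (Y i * Z j) - K (br i n * br j m) * (Y j * Z i) \<in> {g \<in> van ?V. Z n * g \<in> ?B}"
      if ij: "i \<in> T" "j \<in> T" "i \<noteq> j" for i j
    proof -
      have "triple_form (L 3) (L 2) m i j n \<in> A" using A_tri[of i j n] ij assms by auto
      moreover have "Z n * (K (br j n * br i m) * (Y i * Z j) - K (br i n * br j m) * (Y j * Z i)) =
        triple_form (L 3) (L 2) m i j n + Y n * (- (K (br i j * br n m) * Z i * Z j))"
        by (simp add: triple_form_def br_def K_simps algebra_simps)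
      ultimately have "Z n * (K (br j n * br i m) * (Y i * Z j) - K (br i n * br j m) * (Y j * Z i)) \<in> ?B"
        using ij by (intro adjoinI[of "triple_form (L 3) (L 2) m i j n" A "- (K (br i j * br n m) * Z i * Z j)"])
          (auto intro!: Pol_closed)
      then show ?thesis by (auto simp: van_def rank_one_points_def ev_simps)
    qed
  qed auto
  then show ?thesis by simp
qed

text \<open>
  The pure power of \<open>X n\<close> is treated at the points with \<open>Z = 0\<close>. This
  leaves a multiple of \<open>Z n\<close>, and the factor \<open>Z n\<close> may be cancelled
  because it is nonzero on a dense set.
\<close>

lemma XZ_forms_reduce:
  assumes n: "n \<in> T0" "T \<subseteq> T0" "n \<notin> T"
    and "F \<in> forms {1, 3} n T (Suc D)" "F \<in> van (rank_one_points (\<lambda>i. br i n) (\<lambda>i. br i m))"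
  shows "\<exists>a\<in>A. \<exists>g\<in>forms UNIV n T D. F = a + Y n * g"
  using assms(4,5)
proof (induction D arbitrary: F rule: less_induct)
  case (less D)
  let ?V = "rank_one_points (\<lambda>i. br i n) (\<lambda>i. br i m)"
  have nm: "br n m \<noteq> 0" using n m by (intro br_nonzero) auto
  have A_closed: "f \<in> A \<Longrightarrow> L x n ^ k * f \<in> A" for f x k
    using n by (intro submodD(3)[OF A(1)] Pol_power Pol_L)
  have A_V: "f \<in> A \<Longrightarrow> f \<in> van ?V" for f
    using A(2) van_mono[OF _ rank_one_subset_lines_at] by blast
  have Y_V: "Y n * f \<in> van ?V" for f
    by (auto simp: van_def rank_one_points_def ev_simps)
  obtain g F1 where F1: "g \<in> Pol T" "F1 \<in> forms {1, 3} n T D" "F = X n ^ Suc D * g + Z n * F1"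
    using forms_SucE_XZ[OF less.prems(1)] by blast
  have "g \<in> van (rank_one_points (\<lambda>i. br i n) (\<lambda>i. 0))"
    unfolding van_def
  proof (intro CollectI ballI)
    fix p assume "p \<in> rank_one_points (\<lambda>i. br i n) (\<lambda>i. 0)"
    then obtain l t where p: "p = pt l (\<lambda>i. t * br i n) (\<lambda>i. 0 * br i m)" "\<forall>i. l i \<noteq> 0"
      by (auto simp: rank_one_points_def)
    have "p \<in> ?V" unfolding p(1) by (rule rank_one_pointsI) (use p(2) in simp)
    then have "ev p F = 0" using less.prems(2) by (auto simp: van_def)
    then show "ev p g = 0" using p unfolding F1 by (simp add: ev_simps)
  qed
  from X_times_vanishing[OF n F1(1) this] obtain a p q where X: "a \<in> A" "p \<in> Pol T" "q \<in> Pol T"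
    "X n * g = a + Y n * p + Z n * q"
    by (auto simp: adjoin_def)
  define F2 where "F2 = F1 + X n ^ D * q"
  have F2: "F2 \<in> forms {1, 3} n T D"
    unfolding F2_def using F1 X by (intro forms_add forms_power_Pol) auto
  have F: "F = X n ^ D * a + Y n * (X n ^ D * p) + Z n * F2"
  proof -
    have "F = X n ^ D * (X n * g) + Z n * F1" unfolding F1(3) by (simp add: algebra_simps)
    then show ?thesis unfolding X(4) F2_def by (simp add: algebra_simps)
  qed
  have "Z n * F2 = F - X n ^ D * a - Y n * (X n ^ D * p)" unfolding F by simp
  also have "\<dots> \<in> van ?V"
    using less.prems(2) A_V[OF A_closed[OF X(1)]] Y_V by (intro van_diff)
  finally have F2_van: "F2 \<in> van ?V"
    by (rule cancel_Z_rank_one[OF _ forms_Pol[OF F2]]) (rule nm)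
  have Xp: "X n ^ D * p \<in> forms UNIV n T D" using X by (intro forms_power_Pol) auto
  show ?case
  proof (cases D)
    case 0
    then have "Z n * F2 \<in> adjoin A (Y n) T"
      using F2 F2_van by (intro Z_times_vanishing n) auto
    then obtain b r where "b \<in> A" "r \<in> Pol T" "Z n * F2 = b + Y n * r" by (auto simp: adjoin_def)
    moreover from this have "X n ^ D * a + b \<in> A" using A_closed[OF X(1)] submodD(2)[OF A(1)] by blast
    ultimately have "F = (X n ^ D * a + b) + Y n * (X n ^ D * p + r)" "X n ^ D * a + b \<in> A"
      "X n ^ D * p + r \<in> forms UNIV n T D"
      using F Xp 0 by (auto simp: algebra_simps intro: forms_add Pol_add)
    then show ?thesis by blast
  next
    case (Suc E)
    then obtain b r where b: "b \<in> A" "r \<in> forms UNIV n T E" "F2 = b + Y n * r"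
      using less.IH[of E F2] F2 F2_van by auto
    have "X n ^ D * a + Z n * b \<in> A"
      using A_closed[OF X(1)] A_closed[OF b(1), of 3 1] submodD(2)[OF A(1)] by simp
    moreover have "X n ^ D * p + Z n * r \<in> forms UNIV n T D"
      using Xp b(2) unfolding Suc by (intro forms_add forms_letter) auto
    moreover have "F = (X n ^ D * a + Z n * b) + Y n * (X n ^ D * p + Z n * r)"
      unfolding F b(3) by (simp add: algebra_simps)
    ultimately show ?thesis by blast
  qed
qed

text \<open>
  The part of \<open>f\<close> without \<open>Y n\<close> vanishes at the points where \<open>Y
  n\<close> is zero. By \<open>XZ_forms_reduce\<close> it can be replaced by a multiple of
  \<open>Y n\<close>, and \<open>Y n\<close> may be cancelled.
\<close>

lemma lines_at_vanishing:
  assumes "f \<in> Pol T0" "f \<in> van (lines_at m)"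
  shows "f \<in> A"
proof -
  have "f \<in> A" if "finite T" "T \<subseteq> T0" "f \<in> Pol T" "f \<in> van (lines_at m)" for T f
    using that
  proof (induction T arbitrary: f rule: finite_induct)
    case empty
    then obtain a where "f = K a" using Pol_empty by blast
    moreover have "pt (\<lambda>_. 1) (lin 0 0) (\<lambda>i. 0 * br i m) \<in> lines_at m"
      by (rule lines_atI) simp
    ultimately have "f = 0" using empty(3) by (auto simp: van_def ev_K K_0)
    then show ?case using submodD(1)[OF A(1)] by simp
  next
    case (insert n T)
    have n: "n \<in> T0" "T \<subseteq> T0" "n \<notin> T" using insert by auto
    have nm: "n \<noteq> m" using n m by auto
    have forms: "f \<in> A" if "f \<in> forms UNIV n T D" "f \<in> van (lines_at m)" for f D
      using that
    proof (induction D arbitrary: f)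
      case 0
      then show ?case using insert.IH n by auto
    next
      case (Suc D)
      obtain h f2 where h: "h \<in> forms {1, 3} n T (Suc D)" "f2 \<in> forms UNIV n T D" "f = h + Y n * f2"
        using forms_SucE_Y[OF Suc.prems(1)] by blast
      have "h = f - Y n * f2" using h(3) by simp
      also have "\<dots> \<in> van (rank_one_points (\<lambda>i. br i n) (\<lambda>i. br i m))"
        using van_mono[OF Suc.prems(2) rank_one_subset_lines_at]
        by (intro van_diff) (auto simp: van_def rank_one_points_def ev_simps)
      finally obtain a g where a: "a \<in> A" "g \<in> forms UNIV n T D" "h = a + Y n * g"
        using XZ_forms_reduce[OF n h(1)] by blast
      have f: "f = a + Y n * (g + f2)" unfolding h(3) a(3) by (simp add: algebra_simps)
      have gf: "g + f2 \<in> forms UNIV n T D" using a h by (intro forms_add)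
      have "Y n ^ 1 * (g + f2) = f - a" unfolding f by simp
      also have "\<dots> \<in> van (lines_at m)" using Suc.prems a(1) A(2) by (intro van_diff) auto
      finally have "g + f2 \<in> van (lines_at m)"
        by (rule cancel_Y_lines_at[OF _ forms_Pol[OF gf] nm])
      then have "g + f2 \<in> A" using Suc.IH gf by blast
      then have "Y n * (g + f2) \<in> A" using n by (intro submodD(3)[OF A(1)] Pol_L)
      then show ?case unfolding f using a(1) submodD(2)[OF A(1)] by blast
    qed
    show ?case
      by (rule homogeneous_suffices[OF insert.prems(2,3) n(3) scale_lines_at _ _ forms])
        (use submodD[OF A(1)] in auto)
  qed
  then show ?thesis using assms by auto
qed

end

section \<open>All lines\<close>

text \<open>
  The two peeling steps of the introduction are the facts \<open>X_step\<close> and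
  \<open>Y_step\<close> below. The inner induction on \<open>a\<close> trades the remaining power
  \<open>a\<close> of \<open>X n\<close> for the power \<open>b\<close> of \<open>Y n\<close>.
\<close>

theorem line_points_vanishing:
  assumes ideal: "0 \<in> I" "\<And>f g. f \<in> I \<Longrightarrow> g \<in> I \<Longrightarrow> f + g \<in> I" "\<And>f g. f \<in> I \<Longrightarrow> g * f \<in> I"
    and I: "I \<subseteq> van line_points"
    and I_mxx: "\<And>x i j k. x \<in> {2, 3} \<Longrightarrow> distinct [i, j, k] \<Longrightarrow> minor_XX (L x) i j k \<in> I"
    and I_mxyz: "\<And>a b i j k. distinct [i, j, k] \<Longrightarrow> minor_XYZ (L 2) (L 3) a b i j k \<in> I"
    and I_quad: "\<And>i j k l. distinct [i, j, k, l] \<Longrightarrow> quad_form (L 2) (L 3) i j k l \<in> I"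
    and two: "CARD('i) \<ge> 2"
    and f: "f \<in> Pol UNIV" "f \<in> van line_points"
  shows "f \<in> I"
proof -
  have I_minus: "- f \<in> I" if "f \<in> I" for f using ideal(3)[OF that, of "-1"] by simp
  have I_diff: "f - g \<in> I" if "f \<in> I" "g \<in> I" for f g using ideal(2)[OF that(1) I_minus[OF that(2)]] by simp
  have subI: "submod T I" for T using ideal by (auto simp: submod_def)
  have "f \<in> I" if "finite T" "f \<in> Pol T" "f \<in> van line_points" for T f
    using that
  proof (induction T arbitrary: f rule: finite_induct)
    case empty
    then obtain a where "f = K a" using Pol_empty by blast
    moreover have "pt (\<lambda>_. 1) (lin 0 0) (lin 0 0) \<in> line_points"
      by (rule line_pointsI) simp
    ultimately have "f = 0" using empty(2) by (auto simp: van_def ev_K K_0)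
    then show ?case using ideal(1) by simp
  next
    case (insert n T)
    obtain k where k: "n \<noteq> k"
      using two by (metis UNIV_I card_2_iff' card_le_Suc0_iff_eq finite not_less_eq_eq numeral_2_eq_2)
    have Z_0: "Z n * h \<in> van (lines_at n)" for h
      by (auto simp: van_def lines_at_def ev_simps)
    have X_step: "X n * g \<in> adjoin (adjoin I (Y n) T) (Z n) T"
      if g: "g \<in> Pol T" "g \<in> van (rank_one_points (\<lambda>i. br i n) (\<lambda>i. br i n))" for g
    proof -
      let ?B = "adjoin (adjoin I (Y n) T) (Z n) T"
      let ?V = "rank_one_points (\<lambda>i. br i n) (\<lambda>i. br i n)"
      have adj: "i + Y n * p + Z n * q \<in> ?B" if "i \<in> I" "p \<in> Pol T" "q \<in> Pol T" for i p q
        using that by (intro adjoinI[of "i + Y n * p" _ q] adjoinI[of i _ p]) auto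
      have "g \<in> {g \<in> van ?V. X n * g \<in> ?B}"
      proof (rule rank_one_vanishing_XYZ[where T = T, OF _ _ _ _ _ _ _ g])
        show "submod T {g \<in> van ?V. X n * g \<in> ?B}"
          by (intro submod_van_colon submod_adjoin subI)
        show "br i n \<noteq> 0" if "i \<in> T" for i using that insert.hyps by (intro br_nonzero) auto
        then show "(\<forall>i\<in>T. br i n \<noteq> 0) \<or> (\<forall>i\<in>T. Z i \<in> {g \<in> van ?V. X n * g \<in> ?B})"
          by blast
        fix i j assume ij: "i \<in> T" "j \<in> T" "i \<noteq> j"
        then have d: "distinct [i, j, n]" using insert.hyps by auto
        have "X n * (K (br i n) * (X i * Y j) - K (br j n) * (X j * Y i)) =
          - minor_XX (L 2) i j n + Y n * (K (br i j) * X i * X j) + Z n * 0"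
          by (simp add: minor_XX_def br_def K_simps algebra_simps)
        also have "\<dots> \<in> ?B" using ij d I_mxx by (intro adj I_minus Pol_closed) auto
        finally show "K (br i n) * (X i * Y j) - K (br j n) * (X j * Y i) \<in> {g \<in> van ?V. X n * g \<in> ?B}"
          by (auto simp: van_def rank_one_points_def ev_simps)
        have "X n * (K (br i n) * (X i * Z j) - K (br j n) * (X j * Z i)) =
          - minor_XX (L 3) i j n + Y n * 0 + Z n * (K (br i j) * X i * X j)"
          by (simp add: minor_XX_def br_def K_simps algebra_simps)
        also have "\<dots> \<in> ?B" using ij d I_mxx by (intro adj I_minus Pol_closed) auto
        finally show "K (br i n) * (X i * Z j) - K (br j n) * (X j * Z i) \<in> {g \<in> van ?V. X n * g \<in> ?B}"
          by (auto simp: van_def rank_one_points_def ev_simps)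
        \<comment> \<open>With this linear form the 2 x 2 minor is the coefficient of \<open>X n\<close> in the relation.\<close>
        obtain a b where ab: "a * al n + b * be n = 1" using exists_linear_form[OF k] by blast
        let ?w = "\<lambda>c. K (a * al c + b * be c)"
        have "X n * (Y i * Z j - Y j * Z i) = minor_XYZ (L 2) (L 3) a b i j n + Y n * (?w i * X i * Z j - ?w j * X j * Z i)
          + Z n * (?w j * X j * Y i - ?w i * X i * Y j)"
          unfolding minor_XYZ_def ab by (simp add: K_1 algebra_simps)
        also have "\<dots> \<in> ?B" using ij d I_mxyz by (intro adj Pol_closed) auto
        finally have "K (br j n * br i n) * (X n * (Y i * Z j - Y j * Z i)) \<in> ?B"
          by (intro submodD(4)[of T] submod_adjoin subI)
        then have "X n * (K (br j n * br i n) * (Y i * Z j) - K (br i n * br j n) * (Y j * Z i)) \<in> ?B"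
          by (simp add: algebra_simps)
        then show "K (br j n * br i n) * (Y i * Z j) - K (br i n * br j n) * (Y j * Z i) \<in> {g \<in> van ?V. X n * g \<in> ?B}"
          by (auto simp: van_def rank_one_points_def ev_simps)
      qed auto
      then show ?thesis by simp
    qed
    have Y_step: "Y n * g \<in> adjoin I (Z n) T" if g: "g \<in> Pol T" "g \<in> van (lines_at n)" for g
    proof -
      let ?B = "adjoin I (Z n) T"
      have I_van: "i \<in> I \<Longrightarrow> i \<in> van (lines_at n)" for i
        using I van_mono[OF _ lines_at_subset] by blast
      have I_B: "i \<in> I \<Longrightarrow> Y n * i \<in> ?B" for i
        by (intro adjoin_subset ideal(3))
      have "g \<in> {g \<in> van (lines_at n). Y n * g \<in> ?B}"
      proof (rule lines_at_vanishing[OF insert.hyps(2) _ _ _ _ _ _ g])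
        show "submod T {g \<in> van (lines_at n). Y n * g \<in> ?B}"
          by (intro submod_van_colon submod_adjoin subI)
        show "{g \<in> van (lines_at n). Y n * g \<in> ?B} \<subseteq> van (lines_at n)" by blast
        show "minor_XX (L 2) i j k \<in> {g \<in> van (lines_at n). Y n * g \<in> ?B}" if "distinct [i, j, k]" for i j k
          using I_mxx[of 2, OF _ that] I_van I_B by auto
        show "minor_XYZ (L 2) (L 3) a b i j k \<in> {g \<in> van (lines_at n). Y n * g \<in> ?B}" if "distinct [i, j, k]" for a b i j k
          using I_mxyz[OF that] I_van I_B by auto
        show "K (br j n) * (X j * Z i) - K (br i n) * (X i * Z j) \<in> {g \<in> van (lines_at n). Y n * g \<in> ?B}"
          if ij: "i \<in> T" "j \<in> T" "i \<noteq> j" for i j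
        proof -
          have d: "distinct [i, j, n]" using insert.hyps ij by auto
          \<comment> \<open>The linear form of this relation is the bracket with \<open>n\<close>, so the term with \<open>X n\<close> is missing.\<close>
          have "Y n * (K (br j n) * (X j * Z i) - K (br i n) * (X i * Z j)) =
            minor_XYZ (L 2) (L 3) (be n) (- al n) i j n + Z n * (K (br j n) * X j * Y i - K (br i n) * X i * Y j)"
            by (simp add: minor_XYZ_def br_def K_simps algebra_simps)
          then have "Y n * (K (br j n) * (X j * Z i) - K (br i n) * (X i * Z j)) \<in> ?B"
            by (rule adjoinI[rotated 2]) (use ij d I_mxyz in \<open>auto intro!: Pol_closed\<close>)
          then show ?thesis by (auto simp: van_def lines_at_def ev_simps)
        qed
        show "triple_form (L 3) (L 2) n i j k \<in> {g \<in> van (lines_at n). Y n * g \<in> ?B}"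
          if ijk: "{i, j, k} \<subseteq> T" "distinct [i, j, k]" for i j k
        proof -
          have d: "distinct [i, j, k, n]" using insert.hyps ijk by auto
          have "Y n * triple_form (L 3) (L 2) n i j k = quad_form (L 2) (L 3) i j k n + Z n * (- triple_form (L 2) (L 3) n i j k)"
            by (simp add: quad_form_def)
          moreover have "- triple_form (L 2) (L 3) n i j k \<in> Pol T"
            unfolding triple_form_def using ijk by (intro Pol_closed) auto
          ultimately have "Y n * triple_form (L 3) (L 2) n i j k \<in> ?B"
            using I_quad[OF d] by (intro adjoinI)
          moreover have "triple_form (L 3) (L 2) n i j k \<in> van (lines_at n)"
          proof -
            have "ev (pt l (lin u1 u2) (\<lambda>i. s * br i n)) (triple_form (L 3) (L 2) n i j k) =
               l i * l j * l k * s\<^sup>2 * br i n * br j n * br k n *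
               (br j k * (u1 * al i + u2 * be i) + br k i * (u1 * al j + u2 * be j) + br i j * (u1 * al k + u2 * be k))"
              for l u1 u2 s
              by (simp add: triple_form_def ev_simps power2_eq_square) (simp add: algebra_simps)
            moreover have "br j k * (u1 * al i + u2 * be i) + br k i * (u1 * al j + u2 * be j) +
               br i j * (u1 * al k + u2 * be k) = 0" for u1 u2
              by (simp add: br_def algebra_simps)
            ultimately show ?thesis by (auto simp: van_def lines_at_def)
          qed
          ultimately show ?thesis by blast
        qed
      qed
      then show ?thesis by simp
    qed
    have forms: "f \<in> I" if "f \<in> forms UNIV n T D" "f \<in> van line_points" for f D
      using that
    proof (induction D arbitrary: f)
      case 0
      then show ?case using insert.IH by auto
    next
      case (Suc D)
      have "Y n ^ b * h + Z n * f2 \<in> I"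
        if "a + b = Suc D" "h \<in> forms UNIV n T a" "f2 \<in> forms UNIV n T D"
          "Y n ^ b * h + Z n * f2 \<in> van line_points" for a b h f2
        using that
      proof (induction a arbitrary: b h f2)
        case (0 b h f2)
        have b: "Y n ^ b = Y n ^ D * Y n" using 0 by simp
        have "Y n ^ b * h = (Y n ^ b * h + Z n * f2) - Z n * f2" by simp
        also have "\<dots> \<in> van (lines_at n)"
          using van_mono[OF 0(4) lines_at_subset] Z_0 by (intro van_diff)
        finally have "h \<in> van (lines_at n)"
          by (rule cancel_Y_lines_at[OF _ _ k]) (use 0(2) in simp)
        then have "Y n * h \<in> adjoin I (Z n) T" using 0(2) by (intro Y_step) auto
        then obtain i p where ip: "i \<in> I" "p \<in> Pol T" "Y n * h = i + Z n * p" by (auto simp: adjoin_def)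
        have eq: "Y n ^ b * h + Z n * f2 = Y n ^ D * i + Z n * (Y n ^ D * p + f2)"
        proof -
          have "Y n ^ b * h + Z n * f2 = Y n ^ D * (Y n * h) + Z n * f2" unfolding b by (simp add: ac_simps)
          then show ?thesis unfolding ip(3) by (simp add: algebra_simps)
        qed
        have forms: "Y n ^ D * p + f2 \<in> forms UNIV n T D"
          using ip 0 by (intro forms_add forms_power_Pol) auto
        have "Z n * (Y n ^ D * p + f2) = (Y n ^ b * h + Z n * f2) - Y n ^ D * i" unfolding eq by simp
        also have "\<dots> \<in> van line_points" using 0(4) ideal(3)[OF ip(1)] I by (intro van_diff) auto
        finally have "Y n ^ D * p + f2 \<in> van line_points"
          by (rule cancel_Z_line_points[OF _ forms_Pol[OF forms] k])
        then have "Y n ^ D * p + f2 \<in> I" using Suc.IH forms by blast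
        then have "Z n * (Y n ^ D * p + f2) \<in> I" by (rule ideal(3))
        then show ?case unfolding eq using ideal(2)[OF ideal(3)[OF ip(1)]] by blast
      next
        case (Suc a b h f2)
        obtain g h2 h3 where h: "g \<in> Pol T" "h2 \<in> forms UNIV n T a" "h3 \<in> forms UNIV n T a"
          "h = X n ^ Suc a * g + Y n * h2 + Z n * h3"
          using forms_SucE_XYZ[OF Suc.prems(2)] by blast
        have "Y n ^ b * h = (Y n ^ b * h + Z n * f2) - Z n * f2" by simp
        also have "\<dots> \<in> van (lines_at n)"
          using van_mono[OF Suc.prems(4) lines_at_subset] Z_0 by (intro van_diff)
        finally have "h \<in> van (lines_at n)"
          by (rule cancel_Y_lines_at[OF _ forms_Pol[OF Suc.prems(2)] k])
        then have h_van: "h \<in> van (rank_one_points (\<lambda>i. br i n) (\<lambda>i. br i n))"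
          by (rule van_mono[OF _ rank_one_subset_lines_at])
        have "g \<in> van (rank_one_points (\<lambda>i. br i n) (\<lambda>i. br i n))"
          unfolding van_def
        proof (intro CollectI ballI)
          fix p assume p: "p \<in> rank_one_points (\<lambda>i. br i n) (\<lambda>i. br i n)"
          then have "ev p h = 0" using h_van by (simp add: van_def)
          moreover have "p 1 n \<noteq> 0" "p 2 n = 0" "p 3 n = 0" using p by (auto simp: rank_one_points_def)
          ultimately show "ev p g = 0" unfolding h(4) by (simp add: ev_simps)
        qed
        from X_step[OF h(1) this] obtain i p q where i: "i \<in> I" "p \<in> Pol T" "q \<in> Pol T"
          "X n * g = i + Y n * p + Z n * q" by (auto simp: adjoin_def)
        let ?i = "Y n ^ b * X n ^ a * i"
        let ?h = "X n ^ a * p + h2" and ?f2 = "Y n ^ b * (X n ^ a * q + h3) + f2"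
        have eq: "Y n ^ b * h + Z n * f2 = ?i + (Y n ^ Suc b * ?h + Z n * ?f2)"
        proof -
          have "h = X n ^ a * (X n * g) + Y n * h2 + Z n * h3" unfolding h(4) by (simp add: algebra_simps)
          then show ?thesis unfolding i(4) by (simp add: algebra_simps)
        qed
        have D: "D = b + a" using Suc.prems(1) by simp
        have "?i \<in> I" using i(1) ideal(3) by blast
        moreover have "Y n ^ Suc b * ?h + Z n * ?f2 \<in> I"
        proof (rule Suc.IH)
          show "a + Suc b = Suc D" using Suc.prems(1) by simp
          show "?h \<in> forms UNIV n T a" using h i by (intro forms_add forms_power_Pol) auto
          show "?f2 \<in> forms UNIV n T D"
            using Suc.prems(3) h i unfolding D by (intro forms_add forms_power_Pol forms_letter_power) auto
          have "Y n ^ Suc b * ?h + Z n * ?f2 = (Y n ^ b * h + Z n * f2) - ?i" unfolding eq by simp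
          also have "\<dots> \<in> van line_points" using Suc.prems(4) \<open>?i \<in> I\<close> I by (intro van_diff) auto
          finally show "Y n ^ Suc b * ?h + Z n * ?f2 \<in> van line_points" .
        qed
        ultimately show ?case unfolding eq by (rule ideal(2))
      qed
      \<comment> \<open>Initially all of \<open>f\<close> is the coefficient of the power \<open>0\<close> of \<open>Y n\<close>.\<close>
      from this[of "Suc D" 0 f 0] show ?case using Suc.prems forms_0 by simp
    qed
    show ?case
      by (rule homogeneous_suffices[OF insert.prems insert.hyps(2) scale_line_points ideal(1,2) forms])
  qed
  then show ?thesis using f by auto
qed

section \<open>The quadrilinear form\<close>

lemma quad_form_commute: "quad_form y z i j k m = quad_form z y i j k m"
  by (simp add: quad_form_def add.commute)

lemma quad_form_swap_first: "quad_form y z j i k m = - quad_form y z i j k m"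
  by (simp add: quad_form_def triple_form_def br_def K_simps algebra_simps)

lemma quad_form_swap_middle: "quad_form y z i k j m = - quad_form y z i j k m"
  by (simp add: quad_form_def triple_form_def br_def K_simps algebra_simps)

lemma quad_form_swap_last: "quad_form y z i j m k = - quad_form y z i j k m"
  by (simp add: quad_form_def triple_form_def br_def K_simps algebra_simps)

text \<open>
  The relation \<open>P\<close> is the Pluecker relation between the brackets \<open>p = [1
  2]\<close>, \<open>q = [1 3]\<close>, \<open>r = [2 3]\<close>, \<open>a = [1 4]\<close>,
  \<open>b = [2 4]\<close>, \<open>c = [3 4]\<close> of four points, here with \<open>g * [i 4] *
  x\<^sub>i\<close> added to \<open>y\<^sub>i\<close>.
\<close>

lemma quad_shift_identity:
  fixes p q r a b c g :: "'a::comm_ring_1"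
  assumes P: "p * c - q * b + r * a = 0"
  shows "y4 * (r * a * (z2 * z3 * (y1 + g * (a * x1))) - q * b * (z3 * z1 * (y2 + g * (b * x2)))
        + p * c * (z1 * z2 * (y3 + g * (c * x3))))
      + z4 * (r * a * ((y2 + g * (b * x2)) * (y3 + g * (c * x3)) * z1)
        - q * b * ((y3 + g * (c * x3)) * (y1 + g * (a * x1)) * z2)
        + p * c * ((y1 + g * (a * x1)) * (y2 + g * (b * x2)) * z3))
    = y4 * (r * a * (z2 * z3 * y1) - q * b * (z3 * z1 * y2) + p * c * (z1 * z2 * y3))
      + z4 * (r * a * (y2 * y3 * z1) - q * b * (y3 * y1 * z2) + p * c * (y1 * y2 * z3))
      + g * (p * c * z1 * (b * (x2 * (y3 * z4 - y4 * z3)) + c * (x3 * (y4 * z2 - y2 * z4)))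
        - r * a * z3 * (a * (x1 * (y2 * z4 - y4 * z2)) + b * (x2 * (y4 * z1 - y1 * z4)))
        + b * z4 * (q * a * (x1 * (y2 * z3 - y3 * z2)) + (r * a - p * c) * (x2 * (y3 * z1 - y1 * z3))
          - q * c * (x3 * (y1 * z2 - y2 * z1))))
      + g * g * a * b * c * z4 * (r * (x2 * x3 * z1) - q * (x3 * x1 * z2) + p * (x1 * x2 * z3))"
    (is "?l = ?r")
proof -
  have "?l - ?r = g * (p * c - q * b + r * a) * (b * y4 * x2 * z1 * z3 + a * x1 * y2 * z3 * z4 + c * x3 * y2 * z1 * z4)"
    by (simp add: algebra_simps)
  then show ?thesis unfolding P by simp
qed

text \<open>
  With \<open>A + B + C = 0\<close> the expression \<open>Q\<close> is the 4 x 4 determinant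
  \<open>quad_form\<close>, and a linear substitution of the pair \<open>(y, z)\<close> multiplies
  it by the square of the determinant. The difference of the two sides is an explicit multiple of
  \<open>A + B + C\<close>.
\<close>

lemma quad_linear_identity:
  fixes A B C :: "'a::comm_ring_1"
  assumes P: "A + B + C = 0"
    and Q: "\<And>y1 y2 y3 y4 z1 z2 z3 z4. Q y1 y2 y3 y4 z1 z2 z3 z4 =
      A * (y4 * y1 * z2 * z3 + z4 * z1 * y2 * y3) + B * (y4 * y2 * z3 * z1 + z4 * z2 * y3 * y1)
        + C * (y4 * y3 * z1 * z2 + z4 * z3 * y1 * y2)"
  shows "Q (a * y1 + b * z1) (a * y2 + b * z2) (a * y3 + b * z3) (a * y4 + b * z4)
      (c * y1 + d * z1) (c * y2 + d * z2) (c * y3 + d * z3) (c * y4 + d * z4)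
    = (a * d - b * c) * (a * d - b * c) * Q y1 y2 y3 y4 z1 z2 z3 z4"
    (is "?l = ?r")
proof -
  have "?l - ?r = (A + B + C) * (2 * a * a * c * c * y1 * y2 * y3 * y4 + 2 * b * b * d * d * z1 * z2 * z3 * z4
     + a * c * (a * d + b * c) * (z1 * y2 * y3 * y4 + y1 * z2 * y3 * y4 + y1 * y2 * z3 * y4 + y1 * y2 * y3 * z4)
     + b * d * (a * d + b * c) * (y1 * z2 * z3 * z4 + z1 * y2 * z3 * z4 + z1 * z2 * y3 * z4 + z1 * z2 * z3 * y4)
     + 2 * a * b * c * d * (y1 * y2 * z3 * z4 + y1 * z2 * y3 * z4 + y1 * z2 * z3 * y4
        + z1 * z2 * y3 * y4 + z1 * y2 * z3 * y4 + z1 * y2 * y3 * z4))"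
    unfolding Q by (simp add: algebra_simps)
  then show ?thesis unfolding P by simp
qed

lemma bracket_form: "be m * al x + - al m * be x = br x m"
  by (simp add: br_def algebra_simps)

lemma plucker:
  "K (br i j) * K (br k m) - K (br i k) * K (br j m) + K (br j k) * K (br i m) = 0"
proof -
  have "K (br i j) * K (br k m) - K (br i k) * K (br j m) + K (br j k) * K (br i m) = K 0"
    unfolding K_mult[symmetric] K_diff[symmetric] K_add[symmetric]
    by (rule arg_cong[where f = K]) (simp add: br_def algebra_simps)
  then show ?thesis by (simp add: K_0)
qed

lemma quad_form_linear:
  "quad_form (\<lambda>i. K a * y i + K b * z i) (\<lambda>i. K c * y i + K d * z i) i j k m =
     K ((a * d - b * c) * (a * d - b * c)) * quad_form y z i j k m"
proof -
  define Q where "Q y1 y2 y3 y4 z1 z2 z3 z4 =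
      K (br j k) * K (br i m) * (y4 * y1 * z2 * z3 + z4 * z1 * y2 * y3)
        + - (K (br i k) * K (br j m)) * (y4 * y2 * z3 * z1 + z4 * z2 * y3 * y1)
        + K (br i j) * K (br k m) * (y4 * y3 * z1 * z2 + z4 * z3 * y1 * y2)" for y1 y2 y3 y4 z1 z2 z3 z4
  have "br k i = - br i k" by (simp add: br_def)
  then have eq: "quad_form y z i j k m = Q (y i) (y j) (y k) (y m) (z i) (z j) (z k) (z m)" for y z
    unfolding quad_form_def triple_form_def Q_def by (simp add: K_mult K_minus algebra_simps)
  have P: "K (br j k) * K (br i m) + - (K (br i k) * K (br j m)) + K (br i j) * K (br k m) = 0"
    using plucker[of i j k m] by (simp add: algebra_simps)
  show ?thesis
    unfolding eq K_mult K_diff by (rule quad_linear_identity[OF P Q_def])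
qed

text \<open>
  Adding to \<open>y\<close> a linear form that vanishes at \<open>c m\<close>, times
  \<open>X\<close>, changes \<open>quad_form\<close> by a combination of minors. The linear form
  in the third minor has the values \<open>br x k * br i m + br x i * br k m\<close>; it is forced
  by comparing the coefficients of \<open>z m\<close>.
\<close>

lemma quad_form_shift:
  "quad_form (\<lambda>i. y i + K g * (K (br i m) * X i)) z i j k m = quad_form y z i j k m
     + K g * (K (br i j * br k m) * z i * minor_XYZ y z (be m) (- al m) j k m
        - K (br j k * br i m) * z k * minor_XYZ y z (be m) (- al m) i j m
        + K (br j m) * z m * minor_XYZ y z (be k * br i m + be i * br k m) (- (al k * br i m + al i * br k m)) i j k)
     + K (g * g * br i m * br j m * br k m) * z m * minor_XX z i j k"
proof -
  have form: "(be k * br i m + be i * br k m) * al x + - (al k * br i m + al i * br k m) * be x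
      = br x k * br i m + br x i * br k m" for x
    by (simp add: br_def algebra_simps)
  have anti: "br k i = - br i k" "br j i = - br i j" "br k j = - br j k" by (auto simp: br_def)
  note id = quad_shift_identity[OF plucker[of i j k m], where g = "K g" and
      ?x1.0 = "X i" and ?x2.0 = "X j" and ?x3.0 = "X k" and ?y1.0 = "y i" and ?y2.0 = "y j" and
      ?y3.0 = "y k" and ?y4.0 = "y m" and ?z1.0 = "z i" and ?z2.0 = "z j" and ?z3.0 = "z k" and ?z4.0 = "z m"]
  show ?thesis
    using id
    unfolding quad_form_def triple_form_def minor_XYZ_def minor_XX_def bracket_form form
    by (simp add: anti K_mult K_add K_diff K_minus K_0 mult.assoc)
qed

end

section \<open>Evaluation of polynomials\<close>

definition mono_val :: "'m::finite monomial \<Rightarrow> ('m \<Rightarrow> complex^3) \<Rightarrow> complex" where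
  "mono_val mon x = (\<Prod>(i, j)\<in>UNIV. (x j $ i) ^ Poly_Mapping.lookup mon (i, j))"

lemma eval_mpoly_superset:
  assumes "finite S" "Poly_Mapping.keys p \<subseteq> S"
  shows "eval_mpoly p x = (\<Sum>mon\<in>S. Poly_Mapping.lookup p mon * mono_val mon x)"
  unfolding eval_mpoly_def mono_val_def
  by (rule sum.mono_neutral_left) (use assms in \<open>auto simp: in_keys_iff\<close>)

lemma eval_mpoly_add: "eval_mpoly (p + q) x = eval_mpoly p x + eval_mpoly q x"
proof -
  let ?S = "Poly_Mapping.keys p \<union> Poly_Mapping.keys q"
  have "eval_mpoly (p + q) x = (\<Sum>mon\<in>?S. Poly_Mapping.lookup (p + q) mon * mono_val mon x)"
    by (rule eval_mpoly_superset) (auto simp: keys_add)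
  also have "\<dots> = (\<Sum>mon\<in>?S. Poly_Mapping.lookup p mon * mono_val mon x)
      + (\<Sum>mon\<in>?S. Poly_Mapping.lookup q mon * mono_val mon x)"
    by (simp add: lookup_add distrib_right sum.distrib)
  finally show ?thesis
    by (simp add: eval_mpoly_superset[of ?S p] eval_mpoly_superset[of ?S q])
qed

lemma eval_mpoly_0: "eval_mpoly 0 x = 0"
  by (simp add: eval_mpoly_def)

lemma eval_mpoly_sum: "eval_mpoly (\<Sum>y\<in>S. g y) x = (\<Sum>y\<in>S. eval_mpoly (g y) x)"
  by (induction S rule: infinite_finite_induct) (auto simp: eval_mpoly_0 eval_mpoly_add)

lemma eval_mpoly_single: "eval_mpoly (Poly_Mapping.single mon a) x = a * mono_val mon x"
  using eval_mpoly_superset[of "{mon}" "Poly_Mapping.single mon a" x] by (simp add: lookup_single)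

lemma mono_val_add: "mono_val (mon + mon') x = mono_val mon x * mono_val mon' x"
  by (simp add: mono_val_def lookup_add power_add prod.distrib case_prod_beta)

lemma mpoly_sum_monomials:
  "p = (\<Sum>mon\<in>Poly_Mapping.keys p. Poly_Mapping.single mon (Poly_Mapping.lookup p mon))"
  by (rule poly_mapping_eqI)
    (simp add: lookup_sum lookup_single when_def in_keys_iff)

lemma eval_mpoly_mult: "eval_mpoly (p * q) x = eval_mpoly p x * eval_mpoly q x"
proof -
  have "p * q = (\<Sum>mon\<in>Poly_Mapping.keys p. \<Sum>mon'\<in>Poly_Mapping.keys q.
      Poly_Mapping.single (mon + mon') (Poly_Mapping.lookup p mon * Poly_Mapping.lookup q mon'))"
    using arg_cong2[OF mpoly_sum_monomials[of p] mpoly_sum_monomials[of q], of "(*)"]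
    by (simp only: sum_product mult_single)
  then have "eval_mpoly (p * q) x = (\<Sum>mon\<in>Poly_Mapping.keys p. \<Sum>mon'\<in>Poly_Mapping.keys q.
      (Poly_Mapping.lookup p mon * mono_val mon x) * (Poly_Mapping.lookup q mon' * mono_val mon' x))"
    by (simp add: eval_mpoly_sum eval_mpoly_single mono_val_add ac_simps)
  then show ?thesis
    by (simp add: sum_product eval_mpoly_superset[of "Poly_Mapping.keys p" p]
        eval_mpoly_superset[of "Poly_Mapping.keys q" q])
qed

lemma Const_add: "Const (a + b) = Const a + Const b"
  by (simp add: Const_def single_add)

lemma Const_mult: "Const (a * b) = Const a * Const b"
  by (simp add: Const_def mult_single)

lemma Const_1: "Const 1 = 1"
  by (simp add: Const_def)

lemma Const_0: "Const 0 = 0"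
  by (simp add: Const_def)

lemma Const_sum: "Const (\<Sum>x\<in>S. g x) = (\<Sum>x\<in>S. Const (g x))"
  by (induction S rule: infinite_finite_induct) (auto simp: Const_0 Const_add)

lemma eval_mpoly_Const: "eval_mpoly (Const a) x = a"
  by (simp add: Const_def eval_mpoly_single mono_val_def)

lemma eval_mpoly_Var: "eval_mpoly (Var (k, i)) x = x i $ k"
proof -
  have "eval_mpoly (Var (k, i)) x = (\<Prod>v\<in>UNIV. if v = (k, i) then x i $ k else 1)"
    unfolding Var_def eval_mpoly_single mono_val_def mult_1
  proof (intro prod.cong refl)
    fix v :: "3 \<times> 'a"
    show "(case v of (k', i') \<Rightarrow> x i' $ k' ^ Poly_Mapping.lookup (Poly_Mapping.single (k, i) 1) (k', i')) =
        (if v = (k, i) then x i $ k else 1)"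
      by (cases "v = (k, i)") (auto simp: lookup_single when_def split: prod.split)
  qed
  then show ?thesis by simp
qed

section \<open>Vanishing on the Zariski closure\<close>

definition multidegree :: "'m::finite monomial \<Rightarrow> 'm \<Rightarrow> nat" where
  "multidegree mon j = (\<Sum>i\<in>UNIV. Poly_Mapping.lookup mon (i, j))"

definition component :: "'m::finite mpoly \<Rightarrow> ('m \<Rightarrow> nat) \<Rightarrow> 'm mpoly" where
  "component f d = (\<Sum>mon | mon \<in> Poly_Mapping.keys f \<and> multidegree mon = d.
     Poly_Mapping.single mon (Poly_Mapping.lookup f mon))"

lemma multihomogeneous_component: "multihomogeneous (component f d)"
proof -
  have "Poly_Mapping.keys (component f d) \<subseteq> (\<Union>mon\<in>{mon. mon \<in> Poly_Mapping.keys f \<and> multidegree mon = d}.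
      Poly_Mapping.keys (Poly_Mapping.single mon (Poly_Mapping.lookup f mon)))"
    unfolding component_def by (rule keys_sum)
  then have "multidegree mon = d" if "mon \<in> Poly_Mapping.keys (component f d)" for mon
    using that by (auto split: if_splits)
  then show ?thesis
    unfolding multihomogeneous_def multidegree_def by (auto simp: fun_eq_iff)
qed

lemma sum_components: "f = (\<Sum>d\<in>multidegree ` Poly_Mapping.keys f. component f d)"
  unfolding component_def
  by (rule trans[OF mpoly_sum_monomials[of f] sum.image_gen[OF finite_keys]])

lemma mono_val_scale:
  "mono_val mon (\<lambda>j. t j *s x j) = (\<Prod>j\<in>UNIV. t j ^ multidegree mon j) * mono_val mon x"
proof -
  have "(\<Prod>(i, j)\<in>UNIV. t j ^ Poly_Mapping.lookup mon (i, j)) = (\<Prod>j\<in>UNIV. \<Prod>i\<in>UNIV. t j ^ Poly_Mapping.lookup mon (i, j))"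
    by (subst prod.swap) (simp add: prod.cartesian_product)
  also have "\<dots> = (\<Prod>j\<in>UNIV. t j ^ multidegree mon j)"
    by (simp add: multidegree_def power_sum)
  finally show ?thesis
    by (simp add: mono_val_def power_mult_distrib prod.distrib case_prod_beta)
qed

lemma eval_component_scale:
  "eval_mpoly (component f d) (\<lambda>j. t j *s x j) = eval_mpoly (component f d) x * (\<Prod>j\<in>UNIV. t j ^ d j)"
  unfolding component_def eval_mpoly_sum eval_mpoly_single mono_val_scale sum_distrib_right
  by (rule sum.cong) auto

text \<open>
  The scalings of the coordinates of the factors are independent, so all components of a
  polynomial that vanishes at every tuple of coordinates of a point vanish there.
\<close>

lemma vanishing_component:
  assumes "f \<in> vanishing_ideal S" "\<And>X j. X \<in> S \<Longrightarrow> proj_point (X j)"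
  shows "component f d \<in> vanishing_ideal S"
  unfolding vanishing_ideal_def vanishes_at_def
proof (intro CollectI ballI allI impI)
  fix X x assume X: "X \<in> S" and x: "\<forall>j. x j \<in> X j \<and> x j \<noteq> 0"
  show "eval_mpoly (component f d) x = 0"
  proof (cases "d \<in> multidegree ` Poly_Mapping.keys f")
    case True
    show ?thesis
    proof (rule monomials_independent[OF _ _ True])
      fix t :: "'a \<Rightarrow> complex" assume t: "\<And>j. t j \<noteq> 0"
      have "t j *s x j \<in> X j \<and> t j *s x j \<noteq> 0" for j
        using assms(2)[OF X, of j] x t by (auto simp: proj_point_def intro: vec.subspace_scale)
      moreover have "vanishes_at f X" using assms(1) X by (simp add: vanishing_ideal_def)
      ultimately have "eval_mpoly f (\<lambda>j. t j *s x j) = 0"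
        unfolding vanishes_at_def by (elim allE[of _ "\<lambda>j. t j *s x j"]) simp
      then show "(\<Sum>d\<in>multidegree ` Poly_Mapping.keys f.
          eval_mpoly (component f d) x * (\<Prod>j\<in>UNIV. t j ^ d j)) = 0"
        using arg_cong[OF sum_components[of f], of "\<lambda>f. eval_mpoly f (\<lambda>j. t j *s x j)"]
        by (simp only: eval_mpoly_sum eval_component_scale)
    qed simp
  next
    case False
    then have "component f d = 0" unfolding component_def by (intro sum.neutral) auto
    then show ?thesis by (simp add: eval_mpoly_0)
  qed
qed

text \<open>
  The components of a polynomial that vanishes on \<open>S\<close> are multihomogeneous and vanish
  on \<open>S\<close>, so their common zero set is closed and contains the closure.
\<close>

lemma vanishing_ideal_closure:
  assumes "\<And>X j. X \<in> S \<Longrightarrow> proj_point (X j)"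
  shows "vanishing_ideal (zariski_closed hull S) = vanishing_ideal S"
proof
  show "vanishing_ideal (zariski_closed hull S) \<subseteq> vanishing_ideal S"
    unfolding vanishing_ideal_def using hull_subset[of S zariski_closed] by blast
  show "vanishing_ideal S \<subseteq> vanishing_ideal (zariski_closed hull S)"
  proof
    fix f assume f: "f \<in> vanishing_ideal S"
    define Z where "Z = {X. (\<forall>j. proj_point (X j)) \<and> (\<forall>p\<in>range (component f). vanishes_at p X)}"
    have "zariski_closed Z"
      unfolding zariski_closed_def Z_def using multihomogeneous_component by blast
    moreover have "S \<subseteq> Z"
      using assms vanishing_component[OF f] by (auto simp: Z_def vanishing_ideal_def)
    ultimately have "zariski_closed hull S \<subseteq> Z" by (intro hull_minimal)
    moreover have "vanishes_at f X" if "X \<in> Z" for X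
      unfolding vanishes_at_def
    proof (intro allI impI)
      fix x assume "\<forall>j. x j \<in> X j \<and> x j \<noteq> 0"
      then have "eval_mpoly (component f d) x = 0" for d
        using that by (auto simp: Z_def vanishes_at_def)
      then show "eval_mpoly f x = 0"
        using arg_cong[OF sum_components[of f], of "\<lambda>f. eval_mpoly f x"]
        by (simp add: eval_mpoly_sum)
    qed
    ultimately show "f \<in> vanishing_ideal (zariski_closed hull S)"
      unfolding vanishing_ideal_def by blast
  qed
qed

section \<open>Ideals generated by sets\<close>

lemma module_mult: "module ((*) :: 'a::comm_ring_1 \<Rightarrow> 'a \<Rightarrow> 'a)"
  by unfold_locales (auto simp: algebra_simps)

lemma ideal_generated_0: "0 \<in> ideal_generated S"
  unfolding ideal_generated_def by (rule module.span_zero[OF module_mult])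

lemma ideal_generated_add: "f \<in> ideal_generated S \<Longrightarrow> g \<in> ideal_generated S \<Longrightarrow> f + g \<in> ideal_generated S"
  unfolding ideal_generated_def by (rule module.span_add[OF module_mult])

lemma ideal_generated_mult: "f \<in> ideal_generated S \<Longrightarrow> g * f \<in> ideal_generated S"
  unfolding ideal_generated_def by (rule module.span_scale[OF module_mult])

lemma ideal_generated_base: "f \<in> S \<Longrightarrow> f \<in> ideal_generated S"
  unfolding ideal_generated_def by (rule module.span_base[OF module_mult])

lemma ideal_generated_subset:
  assumes "0 \<in> J" "\<And>f g. f \<in> J \<Longrightarrow> g \<in> J \<Longrightarrow> f + g \<in> J" "\<And>f g. f \<in> J \<Longrightarrow> g * f \<in> J" "S \<subseteq> J"
  shows "ideal_generated S \<subseteq> J"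
  unfolding ideal_generated_def
  by (rule module.span_minimal[OF module_mult assms(4)])
    (use assms in \<open>auto simp: module.subspace_def[OF module_mult]\<close>)

lemma sum_ideals:
  fixes f :: "'b \<Rightarrow> 'a::comm_ring_1 set"
  assumes "finite A"
    and "\<And>x. x \<in> A \<Longrightarrow> 0 \<in> f x"
    and "\<And>x g h. x \<in> A \<Longrightarrow> g \<in> f x \<Longrightarrow> h \<in> f x \<Longrightarrow> g + h \<in> f x"
    and "\<And>x g h. x \<in> A \<Longrightarrow> g \<in> f x \<Longrightarrow> h * g \<in> f x"
  shows "0 \<in> (\<Sum>x\<in>A. f x)"
    "g \<in> (\<Sum>x\<in>A. f x) \<Longrightarrow> h \<in> (\<Sum>x\<in>A. f x) \<Longrightarrow> g + h \<in> (\<Sum>x\<in>A. f x)"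
    "g \<in> (\<Sum>x\<in>A. f x) \<Longrightarrow> k * g \<in> (\<Sum>x\<in>A. f x)"
    "x \<in> A \<Longrightarrow> f x \<subseteq> (\<Sum>x\<in>A. f x)"
    "0 \<in> J \<Longrightarrow> (\<And>g h. g \<in> J \<Longrightarrow> h \<in> J \<Longrightarrow> g + h \<in> J) \<Longrightarrow> (\<And>x. x \<in> A \<Longrightarrow> f x \<subseteq> J) \<Longrightarrow> (\<Sum>x\<in>A. f x) \<subseteq> J"
proof -
  have eq: "(\<Sum>x\<in>A. f x) = {\<Sum>x\<in>A. s x | s. \<forall>x\<in>A. s x \<in> f x}"
    using assms(1) by (rule set_sum_alt)
  show "0 \<in> (\<Sum>x\<in>A. f x)"
    unfolding eq using assms(2) by (auto intro!: exI[of _ "\<lambda>_. 0"])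
  show "g + h \<in> (\<Sum>x\<in>A. f x)" if gh: "g \<in> (\<Sum>x\<in>A. f x)" "h \<in> (\<Sum>x\<in>A. f x)"
  proof -
    obtain s t where "\<forall>x\<in>A. s x \<in> f x" "g = (\<Sum>x\<in>A. s x)" "\<forall>x\<in>A. t x \<in> f x" "h = (\<Sum>x\<in>A. t x)"
      using gh unfolding eq by blast
    then show ?thesis unfolding eq using assms(3)
      by (auto intro!: exI[of _ "\<lambda>x. s x + t x"] simp: sum.distrib)
  qed
  show "k * g \<in> (\<Sum>x\<in>A. f x)" if g: "g \<in> (\<Sum>x\<in>A. f x)"
  proof -
    obtain s where "\<forall>x\<in>A. s x \<in> f x" "g = (\<Sum>x\<in>A. s x)"
      using g unfolding eq by blast
    then show ?thesis unfolding eq using assms(4)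
      by (auto intro!: exI[of _ "\<lambda>x. k * s x"] simp: sum_distrib_left)
  qed
  show "f x \<subseteq> (\<Sum>x\<in>A. f x)" if x: "x \<in> A"
  proof
    fix g assume "g \<in> f x"
    moreover have "(\<Sum>y\<in>A. if y = x then g else 0) = g"
      using assms(1) x by simp
    ultimately show "g \<in> (\<Sum>x\<in>A. f x)"
      unfolding eq using assms(2) by (auto intro!: exI[of _ "\<lambda>y. if y = x then g else 0"])
  qed
  show "(\<Sum>x\<in>A. f x) \<subseteq> J" if J: "0 \<in> J" "\<And>g h. g \<in> J \<Longrightarrow> h \<in> J \<Longrightarrow> g + h \<in> J" "\<And>x. x \<in> A \<Longrightarrow> f x \<subseteq> J"
  proof
    fix g assume "g \<in> (\<Sum>x\<in>A. f x)"
    then obtain s where s: "\<forall>x\<in>A. s x \<in> f x" "g = (\<Sum>x\<in>A. s x)"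
      unfolding eq by blast
    have "(\<Sum>x\<in>B. s x) \<in> J" if "B \<subseteq> A" for B
      using finite_subset[OF that assms(1)] that
    proof (induction B rule: finite_induct)
      case empty
      then show ?case using J(1) by simp
    next
      case (insert x B)
      then have "s x \<in> J" using J(3)[of x] s(1) by blast
      then show ?case using insert J(2) by simp
    qed
    then show "g \<in> J" unfolding s by simp
  qed
qed

lemma I_tilde_ideal:
  shows "0 \<in> I_tilde C c f"
    "g \<in> I_tilde C c f \<Longrightarrow> h \<in> I_tilde C c f \<Longrightarrow> g + h \<in> I_tilde C c f"
    "g \<in> I_tilde C c f \<Longrightarrow> h * g \<in> I_tilde C c f"
    "g \<in> minors3 (M_matrix C) \<Longrightarrow> g \<in> I_tilde C c f"
    "\<sigma> \<in> collinear_quadruples C \<Longrightarrow> det (Phi C c (f \<sigma>) \<sigma>) \<in> I_tilde C c f"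
proof -
  let ?M = "ideal_generated (minors3 (M_matrix C))"
  let ?Q = "\<Sum>\<sigma>\<in>collinear_quadruples C. ideal_generated {det (Phi C c (f \<sigma>) \<sigma>)}"
  note S = sum_ideals[of "collinear_quadruples C" "\<lambda>\<sigma>. ideal_generated {det (Phi C c (f \<sigma>) \<sigma>)}",
      OF finite ideal_generated_0 ideal_generated_add ideal_generated_mult]
  have *: "I_tilde C c f = ?M + ?Q" by (simp add: I_tilde_def)
  show "0 \<in> I_tilde C c f"
    unfolding * using set_plus_intro[OF ideal_generated_0 S(1)] by simp
  show "g + h \<in> I_tilde C c f" if gh: "g \<in> I_tilde C c f" "h \<in> I_tilde C c f"
  proof -
    obtain a b a' b' where "g = a + b" "a \<in> ?M" "b \<in> ?Q" "h = a' + b'" "a' \<in> ?M" "b' \<in> ?Q"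
      using gh unfolding * by (elim set_plus_elim)
    then have eq: "g + h = (a + a') + (b + b')" and "a + a' \<in> ?M" "b + b' \<in> ?Q"
      by (simp_all only: ac_simps S(2) ideal_generated_add)
    then show ?thesis unfolding * eq by (intro set_plus_intro)
  qed
  show "h * g \<in> I_tilde C c f" if g: "g \<in> I_tilde C c f"
  proof -
    obtain a b where "g = a + b" "a \<in> ?M" "b \<in> ?Q"
      using g unfolding * by (elim set_plus_elim)
    then have eq: "h * g = h * a + h * b" and "h * a \<in> ?M" "h * b \<in> ?Q"
      by (simp_all only: distrib_left S(3) ideal_generated_mult)
    then show ?thesis unfolding * eq by (intro set_plus_intro)
  qed
  show "g \<in> I_tilde C c f" if "g \<in> minors3 (M_matrix C)"
    unfolding * using set_plus_intro[OF ideal_generated_base[OF that] S(1)] by simp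
  show "det (Phi C c (f \<sigma>) \<sigma>) \<in> I_tilde C c f" if "\<sigma> \<in> collinear_quadruples C"
  proof -
    have "det (Phi C c (f \<sigma>) \<sigma>) \<in> ?Q"
      by (rule subsetD[OF sum_ideals(4)[of _ "\<lambda>\<sigma>. ideal_generated {det (Phi C c (f \<sigma>) \<sigma>)}" \<sigma>]])
        (use that in \<open>auto intro: ideal_generated_0 ideal_generated_add ideal_generated_mult ideal_generated_base\<close>)
    then show ?thesis unfolding * using set_plus_intro[OF ideal_generated_0, of _ ?Q] by simp
  qed
qed

lemma I_tilde_subset:
  assumes "0 \<in> J" "\<And>g h. g \<in> J \<Longrightarrow> h \<in> J \<Longrightarrow> g + h \<in> J" "\<And>g h. g \<in> J \<Longrightarrow> h * g \<in> J"
    and "minors3 (M_matrix C) \<subseteq> J"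
    and "\<And>\<sigma>. \<sigma> \<in> collinear_quadruples C \<Longrightarrow> det (Phi C c (f \<sigma>) \<sigma>) \<in> J"
  shows "I_tilde C c f \<subseteq> J"
proof -
  have "(\<Sum>\<sigma>\<in>collinear_quadruples C. ideal_generated {det (Phi C c (f \<sigma>) \<sigma>)}) \<subseteq> J"
    by (rule sum_ideals(5)[OF finite ideal_generated_0 ideal_generated_add ideal_generated_mult])
      (assumption | rule assms(1,2) ideal_generated_subset[OF assms(1-3)] | use assms(5) in simp)+
  moreover have "ideal_generated (minors3 (M_matrix C)) \<subseteq> J"
    using assms by (intro ideal_generated_subset) auto
  ultimately show ?thesis
    unfolding I_tilde_def using assms(2) by (auto elim!: set_plus_elim)
qed

section \<open>The determinant of ten points on a quadric\<close>

lemma UNIV_10: "(UNIV :: 10 set) = {1, 2, 3, 4, 5, 6, 7, 8, 9, 10}"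
  by (rule sym, rule card_subset_eq) auto

lemma forall_10: "(\<forall>i::10. P i) \<longleftrightarrow>
    P 1 \<and> P 2 \<and> P 3 \<and> P 4 \<and> P 5 \<and> P 6 \<and> P 7 \<and> P 8 \<and> P 9 \<and> P 10"
  using UNIV_10 by (metis UNIV_I empty_iff insert_iff)

lemma sum_10: "sum f (UNIV :: 10 set) =
    f 1 + f 2 + f 3 + f 4 + f 5 + f 6 + f 7 + f 8 + f 9 + f 10"
  unfolding UNIV_10 by (simp add: ac_simps)

lemma vector_10:
  "(vector [x1, x2, x3, x4, x5, x6, x7, x8, x9, x10] :: 'a::zero^10) $ 1 = x1"
  "(vector [x1, x2, x3, x4, x5, x6, x7, x8, x9, x10] :: 'a::zero^10) $ 2 = x2"
  "(vector [x1, x2, x3, x4, x5, x6, x7, x8, x9, x10] :: 'a::zero^10) $ 3 = x3"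
  "(vector [x1, x2, x3, x4, x5, x6, x7, x8, x9, x10] :: 'a::zero^10) $ 4 = x4"
  "(vector [x1, x2, x3, x4, x5, x6, x7, x8, x9, x10] :: 'a::zero^10) $ 5 = x5"
  "(vector [x1, x2, x3, x4, x5, x6, x7, x8, x9, x10] :: 'a::zero^10) $ 6 = x6"
  "(vector [x1, x2, x3, x4, x5, x6, x7, x8, x9, x10] :: 'a::zero^10) $ 7 = x7"
  "(vector [x1, x2, x3, x4, x5, x6, x7, x8, x9, x10] :: 'a::zero^10) $ 8 = x8"
  "(vector [x1, x2, x3, x4, x5, x6, x7, x8, x9, x10] :: 'a::zero^10) $ 9 = x9"
  "(vector [x1, x2, x3, x4, x5, x6, x7, x8, x9, x10] :: 'a::zero^10) $ 10 = x10"
  unfolding vector_def by simp_all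

lemma vector_4:
  "(vector [x1, x2, x3, x4] :: 'a::zero^4) $ 1 = x1"
  "(vector [x1, x2, x3, x4] :: 'a::zero^4) $ 2 = x2"
  "(vector [x1, x2, x3, x4] :: 'a::zero^4) $ 3 = x3"
  "(vector [x1, x2, x3, x4] :: 'a::zero^4) $ 4 = x4"
  unfolding vector_def by simp_all

text \<open>
  The polarization of the quadratic map \<open>veronese\<close>.
\<close>

definition polar :: "'a::comm_ring_1^4 \<Rightarrow> 'a^4 \<Rightarrow> 'a^10" where
  "polar u v = vector [2 * (u$1 * v$1), 2 * (u$2 * v$2), 2 * (u$3 * v$3), 2 * (u$4 * v$4),
     u$1 * v$2 + u$2 * v$1, u$1 * v$3 + u$3 * v$1, u$1 * v$4 + u$4 * v$1,
     u$2 * v$3 + u$3 * v$2, u$2 * v$4 + u$4 * v$2, u$3 * v$4 + u$4 * v$3]"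

lemma veronese_add: "veronese (u + v) = veronese u + veronese v + polar u v"
  unfolding vec_eq_iff forall_10 veronese_def Let_def polar_def vector_add_component vector_10
  by (simp add: power2_eq_square algebra_simps)

lemma veronese_scale: "veronese (a *s v) = (a * a) *s veronese v"
  unfolding vec_eq_iff forall_10 veronese_def Let_def vector_smult_component vector_10
  by (simp add: power2_eq_square algebra_simps)

lemma polar_add_left: "polar (u + w) v = polar u v + polar w v"
  unfolding vec_eq_iff forall_10 polar_def vector_add_component vector_10
  by (simp add: algebra_simps)

lemma polar_add_right: "polar u (v + w) = polar u v + polar u w"
  unfolding vec_eq_iff forall_10 polar_def vector_add_component vector_10
  by (simp add: algebra_simps)

lemma polar_scale_left: "polar (a *s u) v = a *s polar u v"
  unfolding vec_eq_iff forall_10 polar_def vector_smult_component vector_10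
  by (simp add: algebra_simps)

lemma polar_scale_right: "polar u (a *s v) = a *s polar u v"
  unfolding vec_eq_iff forall_10 polar_def vector_smult_component vector_10
  by (simp add: algebra_simps)

lemmas polar_linear = polar_add_left polar_add_right polar_scale_left polar_scale_right

lemma const_vec_add: "const_vec (u + v) = const_vec u + const_vec v"
  by (simp add: const_vec_def vec_eq_iff Const_add)

lemma const_vec_scale: "const_vec (a *s v) = Const a *s const_vec v"
  by (simp add: const_vec_def vec_eq_iff Const_mult)

lemma Const_2: "Const 2 = 2"
  using Const_add[of 1 1] by (simp add: Const_1)

lemma veronese_const: "veronese (const_vec v) = const_vec (veronese v)"
  unfolding vec_eq_iff forall_10 veronese_def Let_def const_vec_def vec_lambda_beta vector_10
  by (simp add: power2_eq_square Const_mult)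

lemma polar_const: "polar (const_vec u) (const_vec v) = const_vec (polar u v)"
  unfolding vec_eq_iff forall_10 polar_def const_vec_def vec_lambda_beta vector_10
  by (simp add: Const_mult Const_add Const_2)

text \<open>
  Lagrange interpolation: a binary quadratic form is determined by its values at three points. The
  coefficients are quotients of brackets.
\<close>

lemma quadratic_interpolation:
  fixes a b a0 b0 a1 b1 a2 b2 :: complex
  assumes "a0 * b1 - a1 * b0 \<noteq> 0" "a0 * b2 - a2 * b0 \<noteq> 0" "a1 * b2 - a2 * b1 \<noteq> 0"
  obtains k0 k1 k2 where "a * a = k0 * (a0 * a0) + k1 * (a1 * a1) + k2 * (a2 * a2)"
    "a * b = k0 * (a0 * b0) + k1 * (a1 * b1) + k2 * (a2 * b2)"
    "b * b = k0 * (b0 * b0) + k1 * (b1 * b1) + k2 * (b2 * b2)"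
proof -
  define p q r where "p = a0 * b1 - a1 * b0" and "q = a0 * b2 - a2 * b0" and "r = a1 * b2 - a2 * b1"
  define u v w where "u = a * b0 - a0 * b" and "v = a * b1 - a1 * b" and "w = a * b2 - a2 * b"
  have nz: "p \<noteq> 0" "q \<noteq> 0" "r \<noteq> 0" using assms by (auto simp: p_def q_def r_def)
  have *: "p * q * r * (x) = r * v * w * x0 - q * u * w * x1 + p * u * v * x2"
    if "(x, x0, x1, x2) \<in> {(a * a, a0 * a0, a1 * a1, a2 * a2), (a * b, a0 * b0, a1 * b1, a2 * b2),
      (b * b, b0 * b0, b1 * b1, b2 * b2)}" for x x0 x1 x2
    using that by (elim insertE emptyE) (simp_all add: p_def q_def r_def u_def v_def w_def algebra_simps)
  have **: "x = v * w / (p * q) * x0 + (- (u * w / (p * r))) * x1 + u * v / (q * r) * x2"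
    if "(x, x0, x1, x2) \<in> {(a * a, a0 * a0, a1 * a1, a2 * a2), (a * b, a0 * b0, a1 * b1, a2 * b2),
      (b * b, b0 * b0, b1 * b1, b2 * b2)}" for x x0 x1 x2
    using *[OF that] nz by (simp add: field_simps)
  show ?thesis by (rule that) (rule **; simp)+
qed

lemma veronese_interpolation:
  fixes u v :: "complex^4"
  assumes "a0 * b1 - a1 * b0 \<noteq> 0" "a0 * b2 - a2 * b0 \<noteq> 0" "a1 * b2 - a2 * b1 \<noteq> 0"
  obtains k0 k1 k2 where "veronese (a *s u + b *s v) = k0 *s veronese (a0 *s u + b0 *s v)
     + k1 *s veronese (a1 *s u + b1 *s v) + k2 *s veronese (a2 *s u + b2 *s v)"
proof -
  obtain k0 k1 k2 where k: "a * a = k0 * (a0 * a0) + k1 * (a1 * a1) + k2 * (a2 * a2)"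
    "a * b = k0 * (a0 * b0) + k1 * (a1 * b1) + k2 * (a2 * b2)"
    "b * b = k0 * (b0 * b0) + k1 * (b1 * b1) + k2 * (b2 * b2)"
    using quadratic_interpolation[OF assms] by blast
  have v: "veronese (a *s u + b *s v) = (a * a) *s veronese u + (b * b) *s veronese v + (a * b) *s polar u v" for a b
    by (simp add: veronese_add veronese_scale polar_linear)
  show ?thesis
    by (rule that[of k0 k1 k2]) (unfold v k, simp add: vec_eq_iff algebra_simps)
qed

lemma matrix_mult_row: "(A ** B) $ i = (\<Sum>l\<in>UNIV. A $ i $ l *s B $ l)"
  by (simp add: matrix_matrix_mult_def vec_eq_iff)

lemma det_Const: "det (\<chi> i. const_vec (A $ i)) = Const (det A)"
proof -
  have prod: "Const (\<Prod>x\<in>S. g x) = (\<Prod>x\<in>S. Const (g x))" for S :: "'b set" and g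
    by (induction S rule: infinite_finite_induct) (auto simp: Const_1 Const_mult)
  have of_int: "Const (of_int (sign p)) = of_int (sign p)" for p :: "'b \<Rightarrow> 'b"
    using Const_add[of 1 "-1"] by (cases p rule: sign_cases) (auto simp: Const_1 Const_0 add_eq_0_iff)
  show ?thesis
    unfolding det_def Const_sum Const_mult prod of_int by (simp add: const_vec_def)
qed

lemma det_unit_rows:
  fixes Q :: "'a::comm_ring_1^10^10"
  assumes "\<And>i j. i \<in> {1, 2, 3, 4, 5, 6} \<Longrightarrow> Q $ i $ j = (if i = j then 1 else 0)"
  shows "det Q = (\<Sum>p | p permutes {7, 8, 9, 10}. of_int (sign p) * (\<Prod>i\<in>{7, 8, 9, 10}. Q $ i $ p i))"
proof -
  have "det Q = (\<Sum>p | p permutes {7, 8, 9, 10}. of_int (sign p) * (\<Prod>i\<in>UNIV. Q $ i $ p i))"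
    unfolding det_def
  proof (rule sum.mono_neutral_right)
    show "finite {p. p permutes (UNIV :: 10 set)}" by (simp add: finite_permutations)
    show "{p. p permutes {7, 8, 9, 10}} \<subseteq> {p. p permutes (UNIV :: 10 set)}"
      using permutes_subset by blast
    show "\<forall>p\<in>{p. p permutes UNIV} - {p. p permutes {7, 8, 9, 10}}.
        of_int (sign p) * (\<Prod>i\<in>UNIV. Q $ i $ p i) = 0"
    proof
      fix p assume p: "p \<in> {p. p permutes UNIV} - {p. p permutes {7, 8, 9, 10 :: 10}}"
      then obtain i where i: "i \<notin> {7, 8, 9, 10}" "p i \<noteq> i"
        by (auto simp: permutes_def)
      then have "i \<in> {1, 2, 3, 4, 5, 6}" using UNIV_10 by blast
      then have "Q $ i $ p i = 0" using assms[of i "p i"] i by auto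
      then have "(\<Prod>i\<in>UNIV. Q $ i $ p i) = 0" by (intro prod_zero) auto
      then show "of_int (sign p) * (\<Prod>i\<in>UNIV. Q $ i $ p i) = 0" by simp
    qed
  qed
  also have "\<dots> = (\<Sum>p | p permutes {7, 8, 9, 10}. of_int (sign p) * (\<Prod>i\<in>{7, 8, 9, 10}. Q $ i $ p i))"
  proof (rule sum.cong)
    fix p assume p: "p \<in> {p. p permutes {7, 8, 9, 10 :: 10}}"
    have "(\<Prod>i\<in>UNIV. Q $ i $ p i) = (\<Prod>i\<in>{7, 8, 9, 10}. Q $ i $ p i)"
    proof (rule prod.mono_neutral_right)
      show "\<forall>i\<in>UNIV - {7, 8, 9, 10}. Q $ i $ p i = 1"
      proof
        fix i assume "i \<in> UNIV - {7, 8, 9, 10 :: 10}"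
        then have "i \<in> {1, 2, 3, 4, 5, 6}" "p i = i"
          using UNIV_10 p by (blast, auto simp: permutes_def)
        then show "Q $ i $ p i = 1" using assms[of i i] by simp
      qed
    qed auto
    then show "of_int (sign p) * (\<Prod>i\<in>UNIV. Q $ i $ p i) =
        of_int (sign p) * (\<Prod>i\<in>{7, 8, 9, 10}. Q $ i $ p i)" by simp
  qed simp
  finally show ?thesis .
qed

text \<open>
  A 4 x 4 minor, expanded along its first two rows.
\<close>

definition minor4 :: "('n \<Rightarrow> 'a) \<Rightarrow> ('n \<Rightarrow> 'a) \<Rightarrow> ('n \<Rightarrow> 'a) \<Rightarrow> ('n \<Rightarrow> 'a::comm_ring_1) \<Rightarrow> 'n \<Rightarrow> 'n \<Rightarrow> 'n \<Rightarrow> 'n \<Rightarrow> 'a" where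
  "minor4 p q r s i j k l =
     (p i * q j - p j * q i) * (r k * s l - r l * s k)
     - (p i * q k - p k * q i) * (r j * s l - r l * s j)
     + (p i * q l - p l * q i) * (r j * s k - r k * s j)
     + (p j * q k - p k * q j) * (r i * s l - r l * s i)
     - (p j * q l - p l * q j) * (r i * s k - r k * s i)
     + (p k * q l - p l * q k) * (r i * s j - r j * s i)"

lemma sum_permutations_4:
  fixes g :: "10 \<Rightarrow> 10 \<Rightarrow> 'a::comm_ring_1"
  shows "(\<Sum>p | p permutes {7, 8, 9, 10}. of_int (sign p) * (\<Prod>i\<in>{7, 8, 9, 10}. g i (p i)))
    = minor4 (\<lambda>i. g i 7) (\<lambda>i. g i 8) (\<lambda>i. g i 9) (\<lambda>i. g i 10) 7 8 9 10"
proof -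
  have 1: "finite {8, 9, 10 :: 10}" "(7 :: 10) \<notin> {8, 9, 10}" by auto
  have 2: "finite {9, 10 :: 10}" "(8 :: 10) \<notin> {9, 10}" by auto
  have 3: "finite {10 :: 10}" "(9 :: 10) \<notin> {10}" by auto
  show ?thesis
    unfolding sum_over_permutations_insert[OF 1] sum_over_permutations_insert[OF 2]
      sum_over_permutations_insert[OF 3] permutes_sing
    by (simp add: sign_swap_id permutation_swap_id permutation_compose sign_compose sign_id swap_id_eq minor4_def algebra_simps)
qed

definition independent4 :: "complex^4 \<Rightarrow> complex^4 \<Rightarrow> complex^4 \<Rightarrow> complex^4 \<Rightarrow> bool" where
  "independent4 u v p q \<longleftrightarrow> (\<forall>a b c d. a *s u + b *s v + c *s p + d *s q = 0 \<longrightarrow> a = 0 \<and> b = 0 \<and> c = 0 \<and> d = 0)"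

lemma independent4_span:
  assumes "independent4 u v p q"
  obtains a b c d where "x = a *s u + b *s v + c *s p + d *s q"
proof -
  define B where "B = (transpose (vector [u, v, p, q]) :: complex^4^4)"
  have B: "B *v y = y$1 *s u + y$2 *s v + y$3 *s p + y$4 *s q" for y
    by (simp add: B_def matrix_vector_mult_def transpose_def vec_eq_iff sum_4 vector_4 mult.commute)
  have "\<forall>y. B *v y = 0 \<longrightarrow> y = 0"
  proof (intro allI impI)
    fix y assume "B *v y = 0"
    then have "y$1 = 0 \<and> y$2 = 0 \<and> y$3 = 0 \<and> y$4 = 0"
      using assms unfolding independent4_def B by blast
    then show "y = 0" by (simp add: vec_eq_iff forall_4)
  qed
  then obtain B' where "B' ** B = mat 1" using matrix_left_invertible_ker[of B] by blast
  then have "B ** B' = mat 1" using matrix_left_right_inverse by blast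
  then have "B *v (B' *v x) = x" by (simp add: matrix_vector_mul_assoc)
  then show ?thesis by (intro that[of "(B' *v x)$1" "(B' *v x)$2" "(B' *v x)$3" "(B' *v x)$4"]) (simp only: B)
qed

text \<open>
  A vector of ten coefficients as a quadratic form, paired with the monomials in the order of
  \<open>veronese\<close>.
\<close>

definition quadric :: "complex^10 \<Rightarrow> complex^4 \<Rightarrow> complex" where
  "quadric x v = (\<Sum>j\<in>UNIV. veronese v $ j * x $ j)"

definition quadric_polar :: "complex^10 \<Rightarrow> complex^4 \<Rightarrow> complex^4 \<Rightarrow> complex" where
  "quadric_polar x u v = (\<Sum>j\<in>UNIV. polar u v $ j * x $ j)"

lemma quadric_add: "quadric x (u + v) = quadric x u + quadric x v + quadric_polar x u v"
  by (simp add: quadric_def quadric_polar_def veronese_add distrib_right sum.distrib)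

lemma quadric_polar_linear:
  "quadric_polar x (u + w) v = quadric_polar x u v + quadric_polar x w v"
  "quadric_polar x u (v + w) = quadric_polar x u v + quadric_polar x u w"
  "quadric_polar x (a *s u) v = a * quadric_polar x u v"
  "quadric_polar x u (a *s v) = a * quadric_polar x u v"
  by (simp_all add: quadric_polar_def polar_linear distrib_right sum.distrib sum_distrib_left mult.assoc)

lemma quadric_zero:
  assumes "\<And>v. quadric x v = 0"
  shows "x = 0"
proof -
  have *: "quadric x (vector [a, b, c, d]) =
      a\<^sup>2 * x $ 1 + b\<^sup>2 * x $ 2 + c\<^sup>2 * x $ 3 + d\<^sup>2 * x $ 4 + a * b * x $ 5 + a * c * x $ 6 + a * d * x $ 7
        + b * c * x $ 8 + b * d * x $ 9 + c * d * x $ 10" for a b c d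
    unfolding quadric_def veronese_def Let_def sum_10 vector_10 vector_4 ..
  note z = assms[of "vector [a, b, c, d]" for a b c d, unfolded *]
  have 1: "x $ 1 = 0" "x $ 2 = 0" "x $ 3 = 0" "x $ 4 = 0"
    using z[of 1 0 0 0] z[of 0 1 0 0] z[of 0 0 1 0] z[of 0 0 0 1] by simp_all
  then show ?thesis
    using z[of 1 1 0 0] z[of 1 0 1 0] z[of 1 0 0 1] z[of 0 1 1 0] z[of 0 1 0 1] z[of 0 0 1 1]
    unfolding vec_eq_iff forall_10 by simp
qed

lemma quadric_zero_on_line:
  assumes "a0 * b1 - a1 * b0 \<noteq> 0" "a0 * b2 - a2 * b0 \<noteq> 0" "a1 * b2 - a2 * b1 \<noteq> 0"
    and "quadric x (a0 *s u + b0 *s v) = 0" "quadric x (a1 *s u + b1 *s v) = 0"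
      "quadric x (a2 *s u + b2 *s v) = 0"
  shows "quadric x (a *s u + b *s v) = 0"
proof -
  obtain k0 k1 k2 where "veronese (a *s u + b *s v) = k0 *s veronese (a0 *s u + b0 *s v)
     + k1 *s veronese (a1 *s u + b1 *s v) + k2 *s veronese (a2 *s u + b2 *s v)"
    using veronese_interpolation[OF assms(1-3)] by blast
  then have "quadric x (a *s u + b *s v) = k0 * quadric x (a0 *s u + b0 *s v)
     + k1 * quadric x (a1 *s u + b1 *s v) + k2 * quadric x (a2 *s u + b2 *s v)"
    by (simp add: quadric_def distrib_right sum.distrib sum_distrib_left mult.assoc)
  then show ?thesis using assms by simp
qed

text \<open>
  A quadric in the kernel contains three points on each of two skew lines, hence both lines, and
  the lines are conjugate with respect to it. So it is zero.
\<close>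

lemma det_two_lines_nonzero:
  fixes P :: "complex^10^10"
  assumes ind: "independent4 E1 E2 f1 f2" and st: "s \<noteq> 0" "t \<noteq> 0"
    and br: "a0 * b1 - a1 * b0 \<noteq> 0" "a0 * b2 - a2 * b0 \<noteq> 0" "a1 * b2 - a2 * b1 \<noteq> 0"
    and P: "P = vector [veronese (a0 *s E1 + b0 *s E2), veronese (a1 *s E1 + b1 *s E2),
      veronese (a2 *s E1 + b2 *s E2), veronese f1, veronese f2, veronese (s *s f1 + t *s f2),
      polar E1 f1, polar E2 f1, polar E1 f2, polar E2 f2]"
  shows "det P \<noteq> 0"
proof -
  have "x = 0" if "P *v x = 0" for x
  proof (rule quadric_zero)
    have row: "(\<Sum>j\<in>UNIV. P $ i $ j * x $ j) = 0" for i
      using that by (simp add: matrix_vector_mult_def vec_eq_iff)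
    note rows = row[of 1] row[of 2] row[of 3] row[of 4] row[of 5] row[of 6] row[of 7] row[of 8] row[of 9] row[of 10]
    note rows = rows[unfolded P vector_10, folded quadric_def quadric_polar_def]
    have E: "quadric x (a *s E1 + b *s E2) = 0" for a b
      using quadric_zero_on_line[OF br rows(1-3)] .
    have F: "quadric x (a *s f1 + b *s f2) = 0" for a b
      by (rule quadric_zero_on_line[of 1 1 0 0 t s]) (use rows st in simp_all)
    fix v
    obtain a b c d where "v = a *s E1 + b *s E2 + c *s f1 + d *s f2"
      using independent4_span[OF ind] by metis
    then have v: "v = (a *s E1 + b *s E2) + (c *s f1 + d *s f2)" by (simp add: add.assoc)
    show "quadric x v = 0"
      unfolding v quadric_add[of x "a *s E1 + b *s E2"] E F by (simp add: quadric_polar_linear rows)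
  qed
  then obtain B where "B ** P = mat 1" using matrix_left_invertible_ker[of P] by blast
  then have "invertible P" using invertible_left_inverse by blast
  then show ?thesis using invertible_det_nz by blast
qed

lemma veronese_point_combination:
  fixes y z :: "'a::comm_ring_1"
  shows "veronese (c - z *s f + y *s g) = veronese c + (z * z) *s veronese f + (y * y) *s veronese g
     - z *s polar c f + y *s polar c g - (z * y) *s polar f g"
  unfolding vec_eq_iff forall_10 veronese_def Let_def polar_def vector_add_component vector_minus_component
    vector_smult_component vector_10
  by (simp add: power2_eq_square algebra_simps)

text \<open>
  The rows of the matrix are combinations of ten constant rows: the squares of three points on
  each line and the four mixed products \<open>polar\<close>. The coefficient matrix
  \<open>Q\<close> starts with six unit rows, so its determinant is the 4 x 4 block of the
  coefficients of the mixed products. The determinant of the constant rows is nonzero by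
  \<open>det_two_lines_nonzero\<close>.
\<close>

lemma det_veronese:
  fixes E1 E2 f1 f2 :: "complex^4" and a b :: "nat \<Rightarrow> complex" and y z :: "nat \<Rightarrow> 'm mpoly"
  assumes ind: "independent4 E1 E2 f1 f2" and st: "s \<noteq> 0" "t \<noteq> 0"
    and br: "a 0 * b 1 - a 1 * b 0 \<noteq> 0" "a 0 * b 2 - a 2 * b 0 \<noteq> 0" "a 1 * b 2 - a 2 * b 1 \<noteq> 0"
  defines "c \<equiv> \<lambda>n. a n *s E1 + b n *s E2"
  defines "e \<equiv> \<lambda>n. const_vec (c n) - z n *s const_vec f1 + y n *s const_vec f2"
  obtains k where "k \<noteq> 0"
    "det (vector [veronese (const_vec (c 0)), veronese (const_vec (c 1)), veronese (const_vec (c 2)),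
        veronese (const_vec f1), veronese (const_vec f2), veronese (const_vec (s *s f1 + t *s f2)),
        veronese (e 0), veronese (e 1), veronese (e 2), veronese (e 3)] :: 'm mpoly^10^10) =
     Const k * minor4 (\<lambda>n. - z n * Const (a n)) (\<lambda>n. - z n * Const (b n))
       (\<lambda>n. y n * Const (a n)) (\<lambda>n. y n * Const (b n)) 0 1 2 3"
proof -
  define P :: "complex^10^10" where "P = vector [veronese (a 0 *s E1 + b 0 *s E2), veronese (a 1 *s E1 + b 1 *s E2),
      veronese (a 2 *s E1 + b 2 *s E2), veronese f1, veronese f2, veronese (s *s f1 + t *s f2),
      polar E1 f1, polar E2 f1, polar E1 f2, polar E2 f2]"
  have "\<forall>n. \<exists>k. veronese (c n) = fst k *s veronese (c 0) + fst (snd k) *s veronese (c 1) + snd (snd k) *s veronese (c 2)"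
  proof
    fix n
    obtain k0 k1 k2 where "veronese (c n) = k0 *s veronese (c 0) + k1 *s veronese (c 1) + k2 *s veronese (c 2)"
      unfolding c_def by (rule veronese_interpolation[OF br])
    then show "\<exists>k. veronese (c n) = fst k *s veronese (c 0) + fst (snd k) *s veronese (c 1) + snd (snd k) *s veronese (c 2)"
      by (intro exI[of _ "(k0, k1, k2)"]) simp
  qed
  then obtain k where k: "\<And>n. veronese (c n) =
      fst (k n) *s veronese (c 0) + fst (snd (k n)) *s veronese (c 1) + snd (snd (k n)) *s veronese (c 2)"
    by metis
  \<comment> \<open>The entries 4 to 6 come from the squares of \<open>f1, f2\<close> and from \<open>polar f1 f2\<close>, which is a
    combination of the squares of the three points on their line.\<close>
  define q :: "nat \<Rightarrow> 'm mpoly^10" where "q n = vector [Const (fst (k n)), Const (fst (snd (k n))), Const (snd (snd (k n))),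
     z n * z n + z n * y n * Const (s / t), y n * y n + z n * y n * Const (t / s), - (z n * y n * Const (1 / (s * t))),
     - z n * Const (a n), - z n * Const (b n), y n * Const (a n), y n * Const (b n)]" for n
  define Q :: "'m mpoly^10^10" where "Q = vector [axis 1 1, axis 2 1, axis 3 1, axis 4 1, axis 5 1, axis 6 1,
     q 0, q 1, q 2, q 3]"
  define P' :: "'m mpoly^10^10" where "P' = (\<chi> i. const_vec (P $ i))"
  have axis_row: "(\<Sum>l\<in>UNIV. axis i (1 :: 'm mpoly) $ l *s P' $ l) = P' $ i" for i
  proof -
    have "(\<Sum>l\<in>UNIV. axis i (1 :: 'm mpoly) $ l *s P' $ l) = (\<Sum>l\<in>UNIV. if l = i then P' $ l else 0)"
      by (rule sum.cong) (auto simp: axis_def)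
    then show ?thesis by simp
  qed
  have const_vec_diff: "const_vec (u - v) = const_vec u - const_vec v" for u v :: "complex^10"
    using const_vec_add[of "u - v" v] by (metis add_diff_cancel_right' diff_add_cancel)
  have polar_f: "polar f1 f2 = (1 / (s * t)) *s veronese (s *s f1 + t *s f2) - (s / t) *s veronese f1 - (t / s) *s veronese f2"
    using st by (simp add: veronese_add veronese_scale polar_linear vec_eq_iff field_simps)
  have q_row: "(\<Sum>l\<in>UNIV. q n $ l *s P' $ l) = veronese (e n)" for n
  proof -
    have "veronese (e n) = const_vec (veronese (c n)) + (z n * z n) *s const_vec (veronese f1) + (y n * y n) *s const_vec (veronese f2)
     - z n *s const_vec (polar (c n) f1) + y n *s const_vec (polar (c n) f2) - (z n * y n) *s const_vec (polar f1 f2)"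
      unfolding e_def veronese_point_combination veronese_const polar_const ..
    moreover have "polar (c n) f1 = a n *s polar E1 f1 + b n *s polar E2 f1"
      "polar (c n) f2 = a n *s polar E1 f2 + b n *s polar E2 f2"
      by (simp_all add: c_def polar_linear)
    ultimately have "veronese (e n) = Const (fst (k n)) *s const_vec (veronese (c 0)) + Const (fst (snd (k n))) *s const_vec (veronese (c 1))
      + Const (snd (snd (k n))) *s const_vec (veronese (c 2))
      + (z n * z n) *s const_vec (veronese f1) + (y n * y n) *s const_vec (veronese f2)
      - z n *s (Const (a n) *s const_vec (polar E1 f1) + Const (b n) *s const_vec (polar E2 f1))
      + y n *s (Const (a n) *s const_vec (polar E1 f2) + Const (b n) *s const_vec (polar E2 f2))
      - (z n * y n) *s (Const (1 / (s * t)) *s const_vec (veronese (s *s f1 + t *s f2))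
         - Const (s / t) *s const_vec (veronese f1) - Const (t / s) *s const_vec (veronese f2))"
      unfolding k[of n] polar_f by (simp only: const_vec_add const_vec_diff const_vec_scale)
    then show ?thesis
      unfolding sum_10 q_def vector_10 P'_def vec_lambda_beta P_def c_def
      by (simp add: vec_eq_iff algebra_simps)
  qed
  have eq: "vector [veronese (const_vec (c 0)), veronese (const_vec (c 1)), veronese (const_vec (c 2)),
        veronese (const_vec f1), veronese (const_vec f2), veronese (const_vec (s *s f1 + t *s f2)),
        veronese (e 0), veronese (e 1), veronese (e 2), veronese (e 3)] = Q ** P'" (is "?V = _")
    unfolding vec_eq_iff[of ?V] forall_10 matrix_mult_row Q_def vector_10 axis_row q_row
    by (simp add: P'_def P_def vector_10 veronese_const c_def)
  have "det Q = minor4 (\<lambda>i. Q $ i $ 7) (\<lambda>i. Q $ i $ 8) (\<lambda>i. Q $ i $ 9) (\<lambda>i. Q $ i $ 10) 7 8 9 10"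
  proof -
    have "Q $ i $ j = (if i = j then 1 else 0)" if "i \<in> {1, 2, 3, 4, 5, 6}" for i j
      using that by (auto simp: Q_def vector_10 axis_def)
    then show ?thesis by (subst det_unit_rows) (simp, rule sum_permutations_4)
  qed
  also have "\<dots> = minor4 (\<lambda>n. - z n * Const (a n)) (\<lambda>n. - z n * Const (b n))
       (\<lambda>n. y n * Const (a n)) (\<lambda>n. y n * Const (b n)) 0 1 2 3"
    unfolding minor4_def Q_def q_def vector_10 ..
  finally have "det ?V = Const (det P) * minor4 (\<lambda>n. - z n * Const (a n)) (\<lambda>n. - z n * Const (b n))
       (\<lambda>n. y n * Const (a n)) (\<lambda>n. y n * Const (b n)) 0 1 2 3"
    unfolding eq det_mul P'_def det_Const by (simp add: mult.commute)
  moreover have "det P \<noteq> 0"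
    by (rule det_two_lines_nonzero[OF ind st br]) (simp add: P_def)
  ultimately show ?thesis using that by blast
qed

section \<open>Minors with arbitrary rows\<close>

text \<open>
  An injective map becomes strictly monotone after composition with the permutation that sends the
  \<open>k\<close>-th element to the argument of the \<open>k\<close>-th value.
\<close>

lemma exists_sorting_permutation:
  fixes r :: "'k::{finite,linorder} \<Rightarrow> 'n::linorder"
  assumes "inj r"
  obtains p where "p permutes UNIV" "strict_mono (r \<circ> p)"
proof -
  define rk where "rk x = card {y. y < x}" for x :: 'k
  define rkr where "rkr x = card {y. r y < r x}" for x
  have rk_mono: "rk x < rk y" if "x < y" for x y
    unfolding rk_def using that by (intro psubset_card_mono) auto
  have rkr_mono: "rkr x < rkr y" if "r x < r y" for x y
    unfolding rkr_def using that by (intro psubset_card_mono) auto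
  have "inj rk"
  proof (rule injI)
    fix x y assume "rk x = rk y"
    then show "x = y" using rk_mono[of x y] rk_mono[of y x] by (cases x y rule: linorder_cases) auto
  qed
  have "inj rkr"
  proof (rule injI)
    fix x y assume "rkr x = rkr y"
    then have "r x = r y"
      using rkr_mono[of x y] rkr_mono[of y x] by (cases "r x" "r y" rule: linorder_cases) auto
    then show "x = y" using assms by (simp add: inj_eq)
  qed
  have "rk x < CARD('k)" for x
    unfolding rk_def by (rule psubset_card_mono) auto
  then have "range rk \<subseteq> {..<CARD('k)}" by auto
  moreover have "rkr x < CARD('k)" for x
    unfolding rkr_def by (rule psubset_card_mono) auto
  then have "range rkr \<subseteq> {..<CARD('k)}" by auto
  ultimately have ranges: "range rk = {..<CARD('k)}" "range rkr = {..<CARD('k)}"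
    using card_image[OF \<open>inj rk\<close>] card_image[OF \<open>inj rkr\<close>] by (simp_all add: card_subset_eq)
  define p where "p x = (THE y. rkr y = rk x)" for x
  have p: "rkr (p x) = rk x" for x
  proof -
    have "rk x \<in> range rkr" unfolding ranges(2) ranges(1)[symmetric] by simp
    then obtain y where "rk x = rkr y" by auto
    then have "(THE y. rkr y = rk x) = y"
      using \<open>inj rkr\<close> by (intro the_equality) (simp_all add: inj_eq)
    then show ?thesis using \<open>rk x = rkr y\<close> by (simp add: p_def)
  qed
  have "inj p"
  proof (rule injI)
    fix x y assume "p x = p y"
    then have "rk x = rk y" using p[of x] p[of y] by simp
    then show "x = y" using \<open>inj rk\<close> by (simp add: inj_eq)
  qed
  then have "bij p" using finite_UNIV_inj_surj[of p] by (simp add: bij_def)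
  then have "p permutes UNIV" by (intro bij_imp_permutes) auto
  moreover have "strict_mono (r \<circ> p)"
  proof (rule strict_monoI)
    fix x y :: 'k assume "x < y"
    then have *: "rkr (p x) < rkr (p y)" using rk_mono p by simp
    have "r (p x) < r (p y)"
    proof (cases "r (p x)" "r (p y)" rule: linorder_cases)
      case equal
      then show ?thesis using assms * by (simp add: inj_eq)
    next
      case greater
      then show ?thesis using rkr_mono[of "p y" "p x"] * by simp
    qed
    then show "(r \<circ> p) x < (r \<circ> p) y" by simp
  qed
  ultimately show ?thesis using that by blast
qed

text \<open>
  The minors of the definition have increasing row and column indices. Other indices give zero or
  a minor up to sign.
\<close>

lemma minor_in_ideal:
  fixes A :: "'a::comm_ring_1^('n::{finite,linorder})^('k::{finite,linorder})"
  assumes J: "minors3 A \<subseteq> J" "0 \<in> J" "\<And>f g. f \<in> J \<Longrightarrow> g * f \<in> J"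
  shows "det (\<chi> i j. A $ r i $ s j :: 'a^3^3) \<in> J"
proof -
  let ?B = "\<chi> i j. A $ r i $ s j :: 'a^3^3"
  consider "\<not> inj r" | "\<not> inj s" | "inj r" "inj s" by blast
  then show ?thesis
  proof cases
    case 1
    then obtain i j where "i \<noteq> j" "r i = r j" by (auto simp: inj_def)
    then have "det ?B = 0" by (intro det_identical_rows[of i j]) (auto simp: row_def)
    then show ?thesis using J by simp
  next
    case 2
    then obtain i j where "i \<noteq> j" "s i = s j" by (auto simp: inj_def)
    then have "det ?B = 0" by (intro det_identical_columns[of i j]) (auto simp: column_def)
    then show ?thesis using J by simp
  next
    case 3
    obtain p where p: "p permutes UNIV" "strict_mono (r \<circ> p)" using exists_sorting_permutation[OF 3(1)] .
    obtain q where q: "q permutes UNIV" "strict_mono (s \<circ> q)" using exists_sorting_permutation[OF 3(2)] .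
    let ?D = "\<chi> i j. A $ (r \<circ> p) i $ (s \<circ> q) j :: 'a^3^3"
    have "?D = (\<chi> i j. (\<chi> i. ?B $ p i) $ i $ q j)" by (simp add: vec_eq_iff)
    then have D: "det ?D = of_int (sign q) * (of_int (sign p) * det ?B)"
      using det_permute_columns[OF q(1), of "\<chi> i. ?B $ p i"] det_permute_rows[OF p(1), of ?B] by simp
    have sq: "(of_int (sign p) :: 'a) * of_int (sign p) = 1" for p :: "3 \<Rightarrow> 3"
      by (cases p rule: sign_cases) auto
    have "of_int (sign p) * of_int (sign q) * det ?D = (of_int (sign p) * of_int (sign p)) * (of_int (sign q) * of_int (sign q)) * det ?B"
      unfolding D by (simp only: ac_simps)
    then have "det ?B = of_int (sign p) * of_int (sign q) * det ?D" by (simp add: sq)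
    moreover have "det ?D \<in> J" using J(1) p(2) q(2) unfolding minors3_def by blast
    ultimately show ?thesis using J(3) by simp
  qed
qed

definition minor3 :: "('i \<Rightarrow> 'a) \<Rightarrow> ('i \<Rightarrow> 'a) \<Rightarrow> ('i \<Rightarrow> 'a::comm_ring_1) \<Rightarrow> 'i \<Rightarrow> 'i \<Rightarrow> 'i \<Rightarrow> 'a" where
  "minor3 u v w i j k = u i * (v j * w k - v k * w j) + u j * (v k * w i - v i * w k) + u k * (v i * w j - v j * w i)"

lemma minor3_rotate: "minor3 u v w = minor3 v w u"
  by (intro ext) (simp add: minor3_def algebra_simps)

lemma minor3_sum:
  "minor3 (\<lambda>i. \<Sum>r\<in>S. a r * u r i) v w i j k = (\<Sum>r\<in>S. a r * minor3 (u r) v w i j k)"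
  by (induction S rule: infinite_finite_induct) (simp_all add: minor3_def algebra_simps)

section \<open>Cameras with centres on a line\<close>

text \<open>
  Cameras with collinear centres, with coordinates \<open>al, be\<close> of the centres in a basis
  \<open>E1, E2\<close> of their line and a complement spanned by \<open>F1, F2\<close>.
\<close>

locale line_cameras =
  fixes C :: "'m::{finite,linorder} \<Rightarrow> complex^4^3" and c :: "'m \<Rightarrow> complex^4"
    and al be :: "'m \<Rightarrow> complex" and E1 E2 F1 F2 :: "complex^4"
  assumes kernel: "C i *v x = 0 \<longleftrightarrow> (\<exists>t. x = t *s c i)"
    and c_eq: "c i = al i *s E1 + be i *s E2"
    and brackets: "i \<noteq> j \<Longrightarrow> al i * be j - al j * be i \<noteq> 0"
    and basis: "independent4 E1 E2 F1 F2"
    and two: "CARD('m) \<ge> 2"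
begin

text \<open>
  The linear form \<open>h\<^sub>i \<bullet> v\<close> in the variables of camera
  \<open>i\<close>, where \<open>h\<^sub>i = C\<^sub>i\<^sup>T \<ell>\<^sub>i\<close>
  (\<open>dotp_back_plane\<close>). It depends only on the image \<open>C i *v v\<close>, so it is
  zero at the centre.
\<close>

definition H :: "complex^4 \<Rightarrow> 'm \<Rightarrow> 'm mpoly" where
  "H v i = (\<Sum>k\<in>UNIV. Const ((C i *v v) $ k) * Var (k, i))"

lemma H_add: "H (u + v) i = H u i + H v i"
  by (simp add: H_def matrix_vector_right_distrib Const_add distrib_right sum.distrib)

lemma H_scale: "H (a *s v) i = Const a * H v i"
  by (simp add: H_def vector_scalar_commute Const_mult sum_distrib_left mult.assoc)

lemma H_center: "H (t *s c i) i = 0"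
proof -
  have "C i *v (t *s c i) = 0" using kernel by blast
  then show ?thesis by (simp add: H_def Const_0)
qed

lemma dotp_back_plane: "dotp (back_plane C i) (const_vec v) = H v i"
proof -
  have "dotp (back_plane C i) (const_vec v) =
      (\<Sum>r\<in>UNIV. \<Sum>k\<in>UNIV. Const (C i $ k $ r) * Var (k, i) * Const (v $ r))"
    by (simp add: dotp_def back_plane_def const_vec_def matrix_vector_mult_def map_matrix_def
        transpose_def sum_distrib_right)
  also have "\<dots> = (\<Sum>k\<in>UNIV. \<Sum>r\<in>UNIV. Const (C i $ k $ r) * Var (k, i) * Const (v $ r))"
    by (rule sum.swap)
  also have "\<dots> = H v i"
    by (simp add: H_def matrix_vector_mult_def Const_sum Const_mult sum_distrib_left sum_distrib_right ac_simps)
  finally show ?thesis .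
qed

lemma back_plane_axis: "back_plane C i $ r = H (axis r 1) i"
proof -
  have "dotp (back_plane C i) (const_vec (axis r 1)) = (\<Sum>s\<in>UNIV. if s = r then back_plane C i $ r else 0)"
    unfolding dotp_def const_vec_def by (rule sum.cong) (auto simp: axis_def Const_0 Const_1)
  then show ?thesis by (simp add: dotp_back_plane)
qed

lemma H_coordinates: "H v i = (\<Sum>r\<in>UNIV. Const (v $ r) * H (axis r 1) i)"
  unfolding dotp_back_plane[symmetric, of v i] by (simp add: dotp_def const_vec_def back_plane_axis mult.commute)

text \<open>
  The three vectors that give the letters of camera \<open>i\<close>. The first is chosen such
  that \<open>E1\<close> and \<open>E2\<close> are its multiples by \<open>- be i\<close> and
  \<open>al i\<close> modulo \<open>c i\<close>; one of \<open>al i, be i\<close> may be zero.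
\<close>

definition base :: "3 \<Rightarrow> 'm \<Rightarrow> complex^4" where
  "base x i = (if x = 1 then (if al i \<noteq> 0 then (1 / al i) *s E2 else (- 1 / be i) *s E1)
     else if x = 2 then F1 else F2)"

lemma base_simps: "base 2 i = F1" "base 3 i = F2"
  by (simp_all add: base_def)

lemma coordinates_nonzero: "al i \<noteq> 0 \<or> be i \<noteq> 0"
proof -
  have "\<exists>j. j \<noteq> i" using two by (metis UNIV_I card_2_iff' card_le_Suc0_iff_eq finite not_less_eq_eq numeral_2_eq_2)
  then obtain j where "j \<noteq> i" by blast
  then show ?thesis using brackets[of i j] by auto
qed

lemma E1_eq: "\<exists>t. E1 = (- be i) *s base 1 i + t *s c i"
proof (cases "al i = 0")
  case True
  then show ?thesis using coordinates_nonzero[of i]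
    by (intro exI[of _ 0]) (simp add: base_def vec_eq_iff)
next
  case False
  then show ?thesis
    by (intro exI[of _ "1 / al i"]) (simp add: base_def vec_eq_iff c_eq field_simps)
qed

lemma E2_eq: "\<exists>t. E2 = al i *s base 1 i + t *s c i"
proof (cases "al i = 0")
  case True
  then show ?thesis using coordinates_nonzero[of i]
    by (intro exI[of _ "1 / be i"]) (simp add: base_def vec_eq_iff c_eq)
next
  case False
  then show ?thesis
    by (intro exI[of _ 0]) (simp add: base_def vec_eq_iff)
qed

definition letter :: "3 \<Rightarrow> 'm \<Rightarrow> 'm mpoly" where
  "letter x i = H (base x i) i"

lemma H_E1: "H E1 i = Const (- be i) * letter 1 i"
proof -
  obtain t where t: "E1 = (- be i) *s base 1 i + t *s c i" using E1_eq by blast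
  have "H E1 i = H ((- be i) *s base 1 i) i + H (t *s c i) i" by (subst t) (rule H_add)
  then show ?thesis unfolding H_center unfolding letter_def H_scale by simp
qed

lemma H_E2: "H E2 i = Const (al i) * letter 1 i"
proof -
  obtain t where t: "E2 = al i *s base 1 i + t *s c i" using E2_eq by blast
  have "H E2 i = H (al i *s base 1 i) i + H (t *s c i) i" by (subst t) (rule H_add)
  then show ?thesis unfolding H_center unfolding letter_def H_scale by simp
qed

lemma H_F: "H F1 i = letter 2 i" "H F2 i = letter 3 i"
  by (simp_all add: letter_def base_simps)

definition frame :: "'m \<Rightarrow> complex^3^3" where
  "frame i = (\<chi> x. C i *v base x i)"

lemma invertible_frame: "invertible (frame i)"
proof -
  have "y = 0" if y: "transpose (frame i) *v y = 0" for y
  proof -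
    have "transpose (frame i) *v y = (\<Sum>x\<in>UNIV. y $ x *s frame i $ x)"
      by (simp add: matrix_vector_mult_def transpose_def vec_eq_iff mult.commute)
    also have "\<dots> = C i *v (y$1 *s base 1 i + y$2 *s F1 + y$3 *s F2)"
      by (simp add: sum_3 frame_def matrix_vector_right_distrib vector_scalar_commute base_simps)
    finally have "transpose (frame i) *v y = C i *v (y$1 *s base 1 i + y$2 *s F1 + y$3 *s F2)" .
    then obtain t where t: "y$1 *s base 1 i + y$2 *s F1 + y$3 *s F2 = t *s c i"
      using y kernel by metis
    have ind: "a = 0 \<and> b = 0 \<and> d = 0 \<and> e = 0" if "a *s E1 + b *s E2 + d *s F1 + e *s F2 = 0" for a b d e
      using basis that unfolding independent4_def by blast
    show "y = 0"
    proof (cases "al i = 0")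
      case True
      then have "(- y$1 / be i) *s E1 + (- t * be i) *s E2 + y$2 *s F1 + y$3 *s F2 = 0"
        using t coordinates_nonzero[of i] by (simp add: base_def c_eq vec_eq_iff algebra_simps)
      from ind[OF this] show ?thesis using True coordinates_nonzero[of i] by (simp add: vec_eq_iff forall_3)
    next
      case False
      then have "(- t * al i) *s E1 + (y$1 / al i - t * be i) *s E2 + y$2 *s F1 + y$3 *s F2 = 0"
        using t by (simp add: base_def c_eq vec_eq_iff algebra_simps)
      from ind[OF this] show ?thesis using False by (auto simp: vec_eq_iff forall_3)
    qed
  qed
  then obtain B where "B ** transpose (frame i) = mat 1"
    using matrix_left_invertible_ker[of "transpose (frame i)"] by blast
  then have "invertible (transpose (frame i))" using invertible_left_inverse by blast
  then show ?thesis unfolding invertible_det_nz by simp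
qed

lemma frame_inverse: "frame i ** matrix_inv (frame i) = mat 1" "matrix_inv (frame i) ** frame i = mat 1"
proof -
  have "frame i ** matrix_inv (frame i) = mat 1 \<and> matrix_inv (frame i) ** frame i = mat 1"
    using someI_ex[OF invertible_frame[unfolded invertible_def]] unfolding matrix_inv_def .
  then show "frame i ** matrix_inv (frame i) = mat 1" "matrix_inv (frame i) ** frame i = mat 1" by auto
qed

definition point :: "(3 \<Rightarrow> 'm \<Rightarrow> complex) \<Rightarrow> 'm \<Rightarrow> complex^3" where
  "point p i = matrix_inv (frame i) *v (\<chi> x. p x i)"

definition ev :: "(3 \<Rightarrow> 'm \<Rightarrow> complex) \<Rightarrow> 'm mpoly \<Rightarrow> complex" where
  "ev p f = eval_mpoly f (point p)"

lemma eval_H: "eval_mpoly (H v i) x = (\<Sum>k\<in>UNIV. (C i *v v) $ k * x i $ k)"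
  by (simp add: H_def eval_mpoly_sum eval_mpoly_mult eval_mpoly_Const eval_mpoly_Var)

lemma eval_letter: "eval_mpoly (letter x i) y = (frame i *v y i) $ x"
  unfolding letter_def eval_H by (simp add: frame_def matrix_vector_mult_def)

sublocale collinear_letters Const letter ev al be
proof
  show "ev p (letter x i) = p x i" for p x i
    unfolding ev_def eval_letter point_def matrix_vector_mul_assoc frame_inverse by simp
  show "al i * be j - al j * be i \<noteq> 0" if "i \<noteq> j" for i j by (rule brackets[OF that])
qed (simp_all add: Const_add Const_mult Const_1 ev_def eval_mpoly_add eval_mpoly_mult eval_mpoly_Const)

lemma Var_in_Pol: "Var (k, i) \<in> Pol UNIV"
proof -
  have "(\<Sum>x\<in>UNIV. Const (matrix_inv (frame i) $ k $ x) * letter x i) =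
    (\<Sum>x\<in>UNIV. \<Sum>k'\<in>UNIV. Const (matrix_inv (frame i) $ k $ x * frame i $ x $ k') * Var (k', i))"
    by (simp add: letter_def H_def frame_def sum_distrib_left Const_mult mult.assoc)
  also have "\<dots> = (\<Sum>k'\<in>UNIV. \<Sum>x\<in>UNIV. Const (matrix_inv (frame i) $ k $ x * frame i $ x $ k') * Var (k', i))"
    by (rule sum.swap)
  also have "\<dots> = (\<Sum>k'\<in>UNIV. Const ((matrix_inv (frame i) ** frame i) $ k $ k') * Var (k', i))"
    by (simp add: matrix_matrix_mult_def Const_sum sum_distrib_right)
  also have "\<dots> = (\<Sum>k'\<in>UNIV. if k' = k then Var (k', i) else 0)"
    unfolding frame_inverse by (rule sum.cong) (auto simp: mat_def Const_0 Const_1)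
  finally have "Var (k, i) = (\<Sum>x\<in>UNIV. Const (matrix_inv (frame i) $ k $ x) * letter x i)" by simp
  then show ?thesis by (auto intro!: Pol_sum Pol_closed)
qed

lemma Pol_UNIV: "f \<in> Pol UNIV"
proof -
  have power: "Poly_Mapping.single (Poly_Mapping.single v n) 1 = Var v ^ n" for v :: "3 \<times> 'm" and n
  proof (induction n)
    case (Suc n)
    have "Poly_Mapping.single v (Suc n) = Poly_Mapping.single v 1 + Poly_Mapping.single v n"
      by (simp flip: single_add)
    then have "Poly_Mapping.single (Poly_Mapping.single v (Suc n)) 1 =
        Var v * Poly_Mapping.single (Poly_Mapping.single v n) 1"
      by (simp add: Var_def mult_single)
    then show ?case using Suc by simp
  qed simp
  have prod: "Poly_Mapping.single (\<Sum>v\<in>S. g v) 1 = (\<Prod>v\<in>S. Poly_Mapping.single (g v) (1::complex))"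
    for S :: "(3 \<times> 'm) set" and g :: "3 \<times> 'm \<Rightarrow> 'm monomial"
  proof -
    have "Poly_Mapping.single (a + b) 1 = Poly_Mapping.single a 1 * Poly_Mapping.single b (1::complex)"
      for a b :: "'m monomial" by (simp add: mult_single)
    then show ?thesis by (induction S rule: infinite_finite_induct) simp_all
  qed
  have "Poly_Mapping.single mon a \<in> Pol UNIV" for mon :: "'m monomial" and a
  proof -
    have "mon = (\<Sum>v\<in>Poly_Mapping.keys mon. Poly_Mapping.single v (Poly_Mapping.lookup mon v))"
      by (rule poly_mapping_eqI) (simp add: lookup_sum lookup_single when_def in_keys_iff)
    then have "Poly_Mapping.single mon 1 = Poly_Mapping.single
        (\<Sum>v\<in>Poly_Mapping.keys mon. Poly_Mapping.single v (Poly_Mapping.lookup mon v)) (1::complex)" by simp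
    also have "\<dots> = (\<Prod>v\<in>Poly_Mapping.keys mon. Var v ^ Poly_Mapping.lookup mon v)"
      unfolding prod power ..
    finally have "Poly_Mapping.single mon 1 = (\<Prod>v\<in>Poly_Mapping.keys mon. Var v ^ Poly_Mapping.lookup mon v)" .
    moreover have "(\<Prod>v\<in>S. Var v ^ n v) \<in> Pol UNIV" for S :: "(3 \<times> 'm) set" and n
      by (induction S rule: infinite_finite_induct) (auto intro!: Pol_closed Var_in_Pol)
    ultimately have "Const a * Poly_Mapping.single mon 1 \<in> Pol UNIV" by (simp add: Pol_scale)
    then show ?thesis by (simp add: Const_def mult_single)
  qed
  then have "(\<Sum>mon\<in>Poly_Mapping.keys f. Poly_Mapping.single mon (Poly_Mapping.lookup f mon)) \<in> Pol UNIV"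
    by (intro Pol_sum)
  then show ?thesis using mpoly_sum_monomials[of f] by simp
qed

section \<open>Minors and the quadrilinear form in the ideal\<close>

text \<open>
  A maximal minor of the matrix of the values \<open>H v i\<close> is linear in each row vector
  \<open>v\<close>, and for unit vectors it is a minor of \<open>M_matrix\<close>.
\<close>

lemma minor3_in_ideal:
  assumes J: "minors3 (M_matrix C) \<subseteq> J" "0 \<in> J" "\<And>f g. f \<in> J \<Longrightarrow> g \<in> J \<Longrightarrow> f + g \<in> J" "\<And>f g. f \<in> J \<Longrightarrow> g * f \<in> J"
  shows "minor3 (H p) (H q) (H r) i j k \<in> J"
proof -
  have J_sum: "(\<Sum>x\<in>S. g x) \<in> J" if "\<And>x. g x \<in> J" for S :: "4 set" and g
    by (induction S rule: infinite_finite_induct) (auto simp: that J)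
  have H_eta: "H v = (\<lambda>i. \<Sum>r\<in>UNIV. Const (v $ r) * H (axis r 1) i)" for v
    using H_coordinates by (intro ext)
  have lin: "minor3 (H v) g h i j k \<in> J" if "\<And>r. minor3 (H (axis r 1)) g h i j k \<in> J" for v g h
    unfolding H_eta[of v] minor3_sum by (intro J_sum J(4) that)
  have base: "minor3 (H (axis a 1)) (H (axis b 1)) (H (axis d 1)) i j k \<in> J" for a b d
  proof -
    define R where "R = (\<lambda>x::3. if x = 1 then a else if x = 2 then b else d)"
    define S where "S = (\<lambda>x::3. if x = 1 then i else if x = 2 then j else k)"
    have "det (\<chi> x y. M_matrix C $ R x $ S y :: 'm mpoly^3^3) \<in> J"
      by (rule minor_in_ideal) (use J in auto)
    moreover have "det (\<chi> x y. M_matrix C $ R x $ S y :: 'm mpoly^3^3) =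
        minor3 (H (axis a 1)) (H (axis b 1)) (H (axis d 1)) i j k"
      unfolding det_3 by (simp add: M_matrix_def transpose_def back_plane_axis minor3_def R_def S_def algebra_simps)
    ultimately show ?thesis by simp
  qed
  show ?thesis
    apply (rule lin)
    apply (subst minor3_rotate, rule lin)
    apply (subst minor3_rotate, rule lin)
    apply (subst minor3_rotate, rule base)
    done
qed

lemma minor_XX_minor3: "minor_XX (H v) i j k = minor3 (H E1) (H E2) (H v) i j k"
  unfolding minor_XX_def minor3_def H_E1 H_E2 br_def by (simp add: K_simps algebra_simps)

lemma minor_XYZ_minor3: "minor_XYZ (H u) (H v) a b i j k = minor3 (H (a *s E2 + (- b) *s E1)) (H u) (H v) i j k"
  unfolding minor_XYZ_def minor3_def H_add H_scale H_E1 H_E2 by (simp add: K_simps algebra_simps)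

lemma letter_eq_H: "letter 2 = H F1" "letter 3 = H F2"
  by (auto simp: H_F)

context
  fixes J :: "'m mpoly set"
  assumes J: "minors3 (M_matrix C) \<subseteq> J" "0 \<in> J" "\<And>f g. f \<in> J \<Longrightarrow> g \<in> J \<Longrightarrow> f + g \<in> J" "\<And>f g. f \<in> J \<Longrightarrow> g * f \<in> J"
begin

lemma J_minor_XX: "minor_XX (H v) i j k \<in> J"
  unfolding minor_XX_minor3 by (rule minor3_in_ideal[OF J])

lemma J_minor_XYZ: "minor_XYZ (H u) (H v) a b i j k \<in> J"
  unfolding minor_XYZ_minor3 by (rule minor3_in_ideal[OF J])

lemma J_diff: "f \<in> J \<Longrightarrow> g \<in> J \<Longrightarrow> f - g \<in> J"
  using J(3)[of f "- g"] J(4)[of g "-1"] by simp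

lemma H_shift: "H (v + g *s c m) = (\<lambda>i. H v i + Const g * (Const (br i m) * letter 1 i))"
  by (intro ext) (simp add: H_add H_scale c_eq H_E1 H_E2 br_def K_simps algebra_simps)

lemma J_shift_last: "quad_form (H (p + g *s c m)) (H q) i j k m - quad_form (H p) (H q) i j k m \<in> J"
  unfolding H_shift quad_form_shift
  by (simp, intro J(3) J_diff J(4) J_minor_XX J_minor_XYZ)

lemma J_shift_last2: "quad_form (H (p + g *s c k)) (H q) i j k m - quad_form (H p) (H q) i j k m \<in> J"
  using J(4)[OF J_shift_last[of p g k q i j m], of "-1"]
  unfolding quad_form_swap_last[of _ _ i j k m] by simp

text \<open>
  The vector \<open>a *s E1 + b *s E2\<close> is a combination of \<open>c k\<close> and \<open>c
  m\<close>, and the value of \<open>H\<close> at \<open>c m\<close> is \<open>br i m * X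
  i\<close>. So \<open>quad_form_shift\<close> applies twice.
\<close>

lemma J_shift:
  assumes "k \<noteq> m"
  shows "quad_form (H (p + (a *s E1 + b *s E2))) (H q) i j k m - quad_form (H p) (H q) i j k m \<in> J"
proof -
  let ?d = "al k * be m - al m * be k"
  have "a *s E1 + b *s E2 = ((a * be m - b * al m) / ?d) *s c k + ((b * al k - a * be k) / ?d) *s c m" (is "_ = ?g *s _ + ?h *s _")
  proof -
    have "a = ?g * al k + ?h * al m" "b = ?g * be k + ?h * be m"
    proof -
      have "?g * al k + ?h * al m = ((a * be m - b * al m) * al k + (b * al k - a * be k) * al m) / ?d"
        "?g * be k + ?h * be m = ((a * be m - b * al m) * be k + (b * al k - a * be k) * be m) / ?d"
        by (simp_all add: add_divide_distrib)
      moreover have "(a * be m - b * al m) * al k + (b * al k - a * be k) * al m = a * ?d"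
        "(a * be m - b * al m) * be k + (b * al k - a * be k) * be m = b * ?d"
        by (simp_all add: algebra_simps)
      ultimately show "a = ?g * al k + ?h * al m" "b = ?g * be k + ?h * be m"
        using brackets[OF assms] by simp_all
    qed
    then have "a *s E1 + b *s E2 = (?g * al k + ?h * al m) *s E1 + (?g * be k + ?h * be m) *s E2" by metis
    then show ?thesis by (simp add: c_eq vec_eq_iff algebra_simps)
  qed
  then have eq: "p + (a *s E1 + b *s E2) = (p + ?g *s c k) + ?h *s c m" by (simp add: add.assoc)
  have "(quad_form (H ((p + ?g *s c k) + ?h *s c m)) (H q) i j k m - quad_form (H (p + ?g *s c k)) (H q) i j k m)
     + (quad_form (H (p + ?g *s c k)) (H q) i j k m - quad_form (H p) (H q) i j k m) \<in> J"
    by (intro J(3) J_shift_last J_shift_last2)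
  then show ?thesis unfolding eq by simp
qed

text \<open>
  Modulo \<open>E1, E2\<close> the points \<open>f1, f2\<close> are combinations of \<open>F1,
  F2\<close>. The part along \<open>E1, E2\<close> only contributes minors, and the rest
  contributes the square of the determinant of the combinations.
\<close>

lemma quad_form_change_line:
  assumes "k \<noteq> m" and ind: "independent4 E1 E2 f1 f2" and f: "quad_form (H f1) (H f2) i j k m \<in> J"
  shows "quad_form (H F1) (H F2) i j k m \<in> J"
proof -
  obtain e1 e2 a b where f1: "f1 = e1 *s E1 + e2 *s E2 + a *s F1 + b *s F2" using independent4_span[OF basis] .
  obtain e3 e4 d e where f2: "f2 = e3 *s E1 + e4 *s E2 + d *s F1 + e *s F2" using independent4_span[OF basis] .
  let ?p = "a *s F1 + b *s F2" and ?q = "d *s F1 + e *s F2"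
  have f1': "f1 = ?p + (e1 *s E1 + e2 *s E2)" and f2': "f2 = ?q + (e3 *s E1 + e4 *s E2)"
    unfolding f1 f2 by (simp_all add: ac_simps)
  have "quad_form (H f1) (H f2) i j k m - quad_form (H ?p) (H f2) i j k m \<in> J"
    unfolding f1' by (rule J_shift[OF assms(1)])
  moreover have "quad_form (H f2) (H ?p) i j k m - quad_form (H ?q) (H ?p) i j k m \<in> J"
    unfolding f2' by (rule J_shift[OF assms(1)])
  ultimately have "quad_form (H f1) (H f2) i j k m - ((quad_form (H f1) (H f2) i j k m - quad_form (H ?p) (H f2) i j k m)
    + (quad_form (H f2) (H ?p) i j k m - quad_form (H ?q) (H ?p) i j k m)) \<in> J"
    by (intro J_diff[OF f J(3)])
  then have "quad_form (H ?p) (H ?q) i j k m \<in> J"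
    by (simp add: quad_form_commute[of "H f2"] quad_form_commute[of "H ?q"])
  moreover have "quad_form (H ?p) (H ?q) i j k m = Const ((a * e - b * d) * (a * e - b * d)) * quad_form (H F1) (H F2) i j k m"
  proof -
    have "H ?p = (\<lambda>i. Const a * H F1 i + Const b * H F2 i)" "H ?q = (\<lambda>i. Const d * H F1 i + Const e * H F2 i)"
      by (auto simp: H_add H_scale)
    then show ?thesis by (simp only: quad_form_linear)
  qed
  ultimately have *: "Const ((a * e - b * d) * (a * e - b * d)) * quad_form (H F1) (H F2) i j k m \<in> J" by simp
  have nz: "a * e - b * d \<noteq> 0"
  proof
    assume 0: "a * e - b * d = 0"
    have ind0: "x = 0 \<and> y = 0 \<and> z = 0 \<and> w = 0" if "x *s E1 + y *s E2 + z *s f1 + w *s f2 = 0" for x y z w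
      using ind that unfolding independent4_def by blast
    have 1: "e *s f1 + (- b) *s f2 = (e * e1 - b * e3) *s E1 + (e * e2 - b * e4) *s E2 + (a * e - b * d) *s F1"
      unfolding f1 f2 by (simp add: vec_eq_iff algebra_simps)
    have "(- (e * e1 - b * e3)) *s E1 + (- (e * e2 - b * e4)) *s E2 + e *s f1 + (- b) *s f2 = 0"
      using 1 unfolding 0 by (simp add: vec_eq_iff algebra_simps)
    from ind0[OF this] have "e = 0" "b = 0" by simp_all
    have 2: "d *s f1 + (- a) *s f2 = (d * e1 - a * e3) *s E1 + (d * e2 - a * e4) *s E2 - (a * e - b * d) *s F2"
      unfolding f1 f2 by (simp add: vec_eq_iff algebra_simps)
    have "(- (d * e1 - a * e3)) *s E1 + (- (d * e2 - a * e4)) *s E2 + d *s f1 + (- a) *s f2 = 0"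
      using 2 unfolding 0 by (simp add: vec_eq_iff algebra_simps)
    from ind0[OF this] have "d = 0" "a = 0" by simp_all
    have "(- e1) *s E1 + (- e2) *s E2 + 1 *s f1 + 0 *s f2 = 0"
      unfolding f1 \<open>a = 0\<close> \<open>b = 0\<close> by (simp add: vec_eq_iff)
    from ind0[OF this] show False by simp
  qed
  have "Const (1 / ((a * e - b * d) * (a * e - b * d))) * (Const ((a * e - b * d) * (a * e - b * d)) * quad_form (H F1) (H F2) i j k m) \<in> J"
    using * by (rule J(4))
  then show ?thesis using nz by (simp add: mult.assoc[symmetric] K_mult[symmetric] K_1)
qed

end

end

lemma cross_product_multiple:
  fixes u v w :: "complex^3"
  assumes "cprod u v \<noteq> 0" "(\<Sum>k\<in>UNIV. u $ k * w $ k) = 0" "(\<Sum>k\<in>UNIV. v $ k * w $ k) = 0"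
  obtains t where "w = t *s cprod u v"
proof -
  define n where "n = cprod u v"
  have n: "n $ 1 = u$2 * v$3 - u$3 * v$2" "n $ 2 = u$3 * v$1 - u$1 * v$3" "n $ 3 = u$1 * v$2 - u$2 * v$1"
    by (simp_all add: n_def cprod_def)
  have u: "u$1 * w$1 + u$2 * w$2 + u$3 * w$3 = 0" and v: "v$1 * w$1 + v$2 * w$2 + v$3 * w$3 = 0"
    using assms(2,3) by (simp_all add: sum_3)
  have "w$2 * n$3 - w$3 * n$2 = u$1 * (v$1 * w$1 + v$2 * w$2 + v$3 * w$3) - v$1 * (u$1 * w$1 + u$2 * w$2 + u$3 * w$3)"
    "w$3 * n$1 - w$1 * n$3 = u$2 * (v$1 * w$1 + v$2 * w$2 + v$3 * w$3) - v$2 * (u$1 * w$1 + u$2 * w$2 + u$3 * w$3)"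
    "w$1 * n$2 - w$2 * n$1 = u$3 * (v$1 * w$1 + v$2 * w$2 + v$3 * w$3) - v$3 * (u$1 * w$1 + u$2 * w$2 + u$3 * w$3)"
    by (simp_all add: n algebra_simps)
  then have e: "w$2 * n$3 = w$3 * n$2" "w$3 * n$1 = w$1 * n$3" "w$1 * n$2 = w$2 * n$1"
    unfolding u v by simp_all
  have "n \<noteq> 0" using assms(1) by (simp add: n_def)
  then consider "n$1 \<noteq> 0" | "n$2 \<noteq> 0" | "n$3 \<noteq> 0" by (auto simp: vec_eq_iff forall_3)
  then have "\<exists>t. w = t *s n"
  proof cases
    case 1
    then show ?thesis using e by (intro exI[of _ "w$1 / n$1"]) (simp add: vec_eq_iff forall_3 field_simps)
  next
    case 2
    then show ?thesis using e by (intro exI[of _ "w$2 / n$2"]) (simp add: vec_eq_iff forall_3 field_simps)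
  next
    case 3
    then show ?thesis using e by (intro exI[of _ "w$3 / n$3"]) (simp add: vec_eq_iff forall_3 field_simps)
  qed
  then show ?thesis using that by (auto simp: n_def)
qed

lemma cross_product_nonzero:
  fixes u v :: "complex^3"
  assumes "\<And>x y. x *s u + y *s v = 0 \<Longrightarrow> x = 0 \<and> y = 0"
  shows "cprod u v \<noteq> 0"
proof
  assume "cprod u v = 0"
  then have e: "u$2 * v$3 = u$3 * v$2" "u$3 * v$1 = u$1 * v$3" "u$1 * v$2 = u$2 * v$1"
    by (simp_all add: cprod_def vec_eq_iff forall_3)
  have "u \<noteq> 0" using assms[of 1 0] by auto
  then consider "u$1 \<noteq> 0" | "u$2 \<noteq> 0" | "u$3 \<noteq> 0" by (auto simp: vec_eq_iff forall_3)
  then show False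
  proof cases
    case 1
    then show False using assms[of "v$1" "- u$1"] e by (simp add: vec_eq_iff forall_3 algebra_simps)
  next
    case 2
    then show False using assms[of "v$2" "- u$2"] e by (simp add: vec_eq_iff forall_3 algebra_simps)
  next
    case 3
    then show False using assms[of "v$3" "- u$3"] e by (simp add: vec_eq_iff forall_3 algebra_simps)
  qed
qed

lemma cross_product_orthogonal:
  "(\<Sum>k\<in>UNIV. u $ k * cprod u v $ k) = (0::complex)" "(\<Sum>k\<in>UNIV. v $ k * cprod u v $ k) = (0::complex)"
  by (simp_all add: sum_3 cprod_def algebra_simps)

lemma span_pair: "x \<in> vec.span {a, b} \<longleftrightarrow> (\<exists>s t. x = s *s a + t *s (b :: complex^'n))"
  by (simp add: vec.span_breakdown_eq vec.span_singleton image_iff) (metis add.commute diff_add_cancel add_diff_cancel_left' )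

lemma independent_pair:
  fixes a b :: "complex^'n"
  assumes "\<And>x y. x *s a + y *s b = 0 \<Longrightarrow> x = 0 \<and> y = 0"
  shows "vec.independent {a, b}" "a \<noteq> b"
proof -
  show ab: "a \<noteq> b" using assms[of 1 "-1"] by auto
  show "vec.independent {a, b}"
    using assms ab by (auto simp: vec.dependent_finite)
qed

lemma proj_line_span_pair:
  fixes a b :: "complex^'n"
  shows "proj_line (vec.span {a, b}) \<longleftrightarrow> (\<forall>x y. x *s a + y *s b = 0 \<longrightarrow> x = 0 \<and> y = 0)"
proof
  assume "\<forall>x y. x *s a + y *s b = 0 \<longrightarrow> x = 0 \<and> y = 0"
  then have pair: "\<And>x y. x *s a + y *s b = 0 \<Longrightarrow> x = 0 \<and> y = 0" by simp
  have "vec.independent {a, b}" "a \<noteq> b" by (rule independent_pair, erule pair)+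
  then have "vec.dim {a, b} = 2" using vec.dim_eq_card_independent[of "{a, b}"] by simp
  then show "proj_line (vec.span {a, b})" by (simp add: proj_line_def vec.dim_span)
next
  assume "proj_line (vec.span {a, b})"
  then have dim: "vec.dim {a, b} = 2" by (simp add: proj_line_def vec.dim_span)
  have "a \<noteq> b"
  proof
    assume "a = b"
    then have "vec.dim {a, b} \<le> card {a}" using vec.dim_le_card'[of "{a}"] by simp
    then show False using dim by simp
  qed
  moreover have ind: "vec.independent {a, b}"
    by (rule vec.card_le_dim_spanning[of "{a, b}" "{a, b}"])
      (use dim \<open>a \<noteq> b\<close> in \<open>simp_all add: vec.span_superset\<close>)
  ultimately show "\<forall>x y. x *s a + y *s b = 0 \<longrightarrow> x = 0 \<and> y = 0"
  proof (intro allI impI)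
    fix x y assume 0: "x *s a + y *s b = 0"
    have sum: "(\<Sum>v\<in>{a, b}. (if v = a then x else y) *s v) = 0" using \<open>a \<noteq> b\<close> 0 by simp
    have "(if v = a then x else y) = 0" if "v \<in> {a, b}" for v
      by (rule vec.independentD[OF ind _ _ sum that]) auto
    from this[of a] this[of b] show "x = 0 \<and> y = 0" using \<open>a \<noteq> b\<close> by simp
  qed
qed

lemma permutations_of_four:
  assumes swap: "\<And>a b c d. Q a b c d \<Longrightarrow> Q b a c d" "\<And>a b c d. Q a b c d \<Longrightarrow> Q a c b d" "\<And>a b c d. Q a b c d \<Longrightarrow> Q a b d c"
    and Q: "Q a b c d" and d: "{i, j, k, m} = {a, b, c, d}" "distinct [i, j, k, m]"
  shows "Q i j k m"
proof -
  have abcd: "Q a b c d" "Q a b d c" "Q a c b d" "Q a c d b" "Q a d b c" "Q a d c b" if "Q a b c d" for a b c d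
    using that swap(3)[OF that] swap(2)[OF that] swap(3)[OF swap(2)[OF that]] swap(2)[OF swap(3)[OF that]]
      swap(3)[OF swap(2)[OF swap(3)[OF that]]] by simp_all
  have "Q a b c d" "Q b a c d" "Q c a b d" "Q d a b c"
    using Q swap(1)[OF Q] swap(1)[OF swap(2)[OF Q]] swap(1)[OF swap(2)[OF swap(3)[OF Q]]] by simp_all
  note all = this[THEN abcd(1)] this[THEN abcd(2)] this[THEN abcd(3)] this[THEN abcd(4)] this[THEN abcd(5)] this[THEN abcd(6)]
  have "i \<in> {a, b, c, d}" "j \<in> {a, b, c, d}" "k \<in> {a, b, c, d}" "m \<in> {a, b, c, d}" using d by auto
  then show ?thesis using d(2) by (elim insertE emptyE) (simp_all add: all)
qed

context line_cameras
begin

lemma basis0: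
  "a *s E1 + b *s E2 + d *s F1 + e *s F2 = 0 \<Longrightarrow> a = 0 \<and> b = 0 \<and> d = 0 \<and> e = 0"
  using basis unfolding independent4_def by blast

lemma ev_H_line_point:
  assumes p: "p = pt l (lin u1 u2) (lin v1 v2)"
  shows "\<exists>a b. \<forall>i. ev p (H v i) = l i * (a * al i + b * be i)"
proof -
  obtain a b d e where v: "v = a *s E1 + b *s E2 + d *s F1 + e *s F2" using independent4_span[OF basis] .
  have "ev p (H v i) = l i * ((b + d * u1 + e * v1) * al i + (- a + d * u2 + e * v2) * be i)" for i
    unfolding v H_add H_scale H_E1 H_E2 H_F by (simp add: ev_simps p algebra_simps)
  then show ?thesis by blast
qed

lemma minors_vanish: "minors3 (M_matrix C) \<subseteq> van line_points"
proof
  fix g assume "g \<in> minors3 (M_matrix C)"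
  then obtain r s where g: "g = det (\<chi> i j. M_matrix C $ r i $ s j :: 'm mpoly^3^3)"
    unfolding minors3_def by blast
  show "g \<in> van line_points"
    unfolding van_def line_points_def
  proof (intro CollectI ballI, clarify)
    fix l u1 u2 v1 v2
    let ?p = "pt l (lin u1 u2) (lin v1 v2)"
    have "\<exists>a. \<forall>i. ev ?p (M_matrix C $ x $ i) = l i * (fst a * al i + snd a * be i)" for x
    proof -
      obtain a b where "\<forall>i. ev ?p (H (axis x 1) i) = l i * (a * al i + b * be i)"
        using ev_H_line_point[OF refl] by blast
      then show ?thesis
        by (intro exI[of _ "(a, b)"]) (simp add: M_matrix_def transpose_def back_plane_axis)
    qed
    then have "\<exists>a. \<forall>x. \<forall>i. ev ?p (M_matrix C $ x $ i) = l i * (fst (a x) * al i + snd (a x) * be i)"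
      by (intro choice allI)
    then obtain a where ab: "\<And>x i. ev ?p (M_matrix C $ x $ i) = l i * (fst (a x) * al i + snd (a x) * be i)"
      by blast
    show "ev ?p g = 0"
      unfolding g det_3 vec_lambda_beta ev_simps ab by (simp add: algebra_simps)
  qed
qed

lemma quad_form_vanishes: "quad_form (H f1) (H f2) i j k m \<in> van line_points"
  unfolding van_def line_points_def
proof (intro CollectI ballI, clarify)
  fix l u1 u2 v1 v2
  let ?p = "pt l (lin u1 u2) (lin v1 v2)"
  obtain a b where ab: "\<And>i. ev ?p (H f1 i) = l i * (a * al i + b * be i)" using ev_H_line_point[OF refl] by blast
  obtain d e where de: "\<And>i. ev ?p (H f2 i) = l i * (d * al i + e * be i)" using ev_H_line_point[OF refl] by blast
  have P: "br j k * br i m + - (br i k * br j m) + br i j * br k m = 0"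
    by (simp add: br_def algebra_simps)
  define Q where "Q y1 y2 y3 y4 z1 z2 z3 z4 =
      br j k * br i m * (y4 * y1 * z2 * z3 + z4 * z1 * y2 * y3)
        + - (br i k * br j m) * (y4 * y2 * z3 * z1 + z4 * z2 * y3 * y1)
        + br i j * br k m * (y4 * y3 * z1 * z2 + z4 * z3 * y1 * y2)" for y1 y2 y3 y4 z1 z2 z3 z4
  have "br k i = - br i k" by (simp add: br_def)
  then have "ev ?p (quad_form (H f1) (H f2) i j k m) =
      Q (l i * (a * al i + b * be i)) (l j * (a * al j + b * be j)) (l k * (a * al k + b * be k)) (l m * (a * al m + b * be m))
        (l i * (d * al i + e * be i)) (l j * (d * al j + e * be j)) (l k * (d * al k + e * be k)) (l m * (d * al m + e * be m))"
    unfolding quad_form_def triple_form_def ev_simps ab de Q_def by (simp add: algebra_simps)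
  also have "\<dots> = Q (a * (l i * al i) + b * (l i * be i)) (a * (l j * al j) + b * (l j * be j))
        (a * (l k * al k) + b * (l k * be k)) (a * (l m * al m) + b * (l m * be m))
        (d * (l i * al i) + e * (l i * be i)) (d * (l j * al j) + e * (l j * be j))
        (d * (l k * al k) + e * (l k * be k)) (d * (l m * al m) + e * (l m * be m))"
    by (simp only: distrib_left mult.left_commute)
  also have "\<dots> = (a * e - b * d) * (a * e - b * d) *
      Q (l i * al i) (l j * al j) (l k * al k) (l m * al m) (l i * be i) (l j * be j) (l k * be k) (l m * be m)"
    by (rule quad_linear_identity[OF P Q_def])
  also have "Q (l i * al i) (l j * al j) (l k * al k) (l m * al m) (l i * be i) (l j * be j) (l k * be k) (l m * be m) = 0"
    unfolding Q_def br_def by (simp add: algebra_simps)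
  finally show "ev ?p (quad_form (H f1) (H f2) i j k m) = 0" by simp
qed

lemma minor4_quad_form:
  "minor4 (\<lambda>n. - H f2 (s n) * Const (al (s n))) (\<lambda>n. - H f2 (s n) * Const (be (s n)))
     (\<lambda>n. H f1 (s n) * Const (al (s n))) (\<lambda>n. H f1 (s n) * Const (be (s n))) 0 1 2 (3::nat)
   = quad_form (H f1) (H f2) (s 0) (s 1) (s 2) (s 3)"
  unfolding minor4_def quad_form_def triple_form_def br_def by (simp add: K_simps algebra_simps)

text \<open>
  Two of the auxiliary points complete \<open>E1, E2\<close> to a basis since the auxiliary line
  does not meet the line of centres. The third is a combination of them with nonzero coefficients
  since the points are distinct. So \<open>det_veronese\<close> applies.
\<close>

lemma det_Phi:
  assumes card: "card \<sigma> = 4" and aux: "auxiliary_points C \<sigma> Es f"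
  obtains k where "k \<noteq> 0" "independent4 E1 E2 (f 1) (f 2)"
    "det (Phi C c f \<sigma>) = Const k * quad_form (H (f 1)) (H (f 2)) (sorted_list_of_set \<sigma> ! 0)
       (sorted_list_of_set \<sigma> ! 1) (sorted_list_of_set \<sigma> ! 2) (sorted_list_of_set \<sigma> ! 3)"
proof -
  define s where "s n = sorted_list_of_set \<sigma> ! n" for n
  have fin: "finite \<sigma>" using card by (simp add: card_ge_0_finite)
  have len: "length (sorted_list_of_set \<sigma>) = 4" using card by simp
  have s_in: "s n \<in> \<sigma>" if "n < 4" for n
    unfolding s_def using nth_mem[of n "sorted_list_of_set \<sigma>"] len that fin by simp
  have s_dist: "s n \<noteq> s n'" if "n < 4" "n' < 4" "n \<noteq> n'" for n n'
    unfolding s_def using that len by (simp add: nth_eq_iff_index_eq)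
  have c_center: "c i \<in> center (C i)" for i
    using kernel[of i "c i"] by (auto simp: center_def intro: exI[of _ 1])
  let ?E = "vec.span (\<Union>i\<in>\<sigma>. center (C i))"
  have c_in: "c (s n) \<in> ?E" if "n < 4" for n
    using c_center s_in[OF that] by (intro vec.span_base) blast
  let ?d = "al (s 0) * be (s 1) - al (s 1) * be (s 0)"
  have d: "?d \<noteq> 0" using brackets s_dist[of 0 1] by simp
  have "?d *s E1 = be (s 1) *s c (s 0) - be (s 0) *s c (s 1)" "?d *s E2 = al (s 0) *s c (s 1) - al (s 1) *s c (s 0)"
    by (simp_all add: c_eq vec_eq_iff algebra_simps)
  then have "?d *s E1 \<in> ?E" "?d *s E2 \<in> ?E"
    using c_in[of 0] c_in[of 1] by (simp_all add: vec.span_diff vec.span_scale)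
  moreover have "v \<in> ?E" if "x *s v \<in> ?E" "x \<noteq> 0" for x v
    using vec.span_scale[OF that(1), of "1 / x"] that(2) by simp
  ultimately have E_in: "E1 \<in> ?E" "E2 \<in> ?E" using d by blast+
  have Es: "vec.subspace Es" "vec.dim Es = 2" "Es \<inter> ?E = {0}" and f: "\<And>k. f k \<in> Es" "\<And>k. f k \<noteq> 0"
    and inj: "inj (\<lambda>k. vec.span {f k})"
    using aux by (auto simp: auxiliary_points_def proj_line_def)
  have pair: "x = 0 \<and> y = 0" if "x *s f k + y *s f k' = 0" "k \<noteq> k'" for x y k k'
  proof -
    have span_eq: "vec.span {g} = vec.span {h}" if "g = t *s h" "t \<noteq> 0" for g h :: "complex^4" and t
    proof
      show "vec.span {g} \<subseteq> vec.span {h}" using that by (intro vec.span_minimal) (auto intro: vec.span_base vec.span_scale)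
      have "h = (1 / t) *s g" using that by simp
      then show "vec.span {h} \<subseteq> vec.span {g}"
        by (intro vec.span_minimal) (auto intro: vec.span_base vec.span_scale)
    qed
    have ne: "vec.span {f k} \<noteq> vec.span {f k'}" using inj that(2) by (auto dest: injD)
    have "x = 0"
    proof (rule ccontr)
      assume "x \<noteq> 0"
      then have fk: "f k = (- y / x) *s f k'"
        using that(1) by (simp add: vec_eq_iff field_simps add_eq_0_iff2)
      then have "y \<noteq> 0" using f(2)[of k] by auto
      then show False using ne span_eq[OF fk] \<open>x \<noteq> 0\<close> by simp
    qed
    then show ?thesis using that f(2)[of k'] by simp
  qed
  have ind: "independent4 E1 E2 (f 1) (f 2)"
    unfolding independent4_def
  proof (intro allI impI)
    fix x y z w assume 0: "x *s E1 + y *s E2 + z *s f 1 + w *s f 2 = 0"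
    have eq: "z *s f 1 + w *s f 2 = - (x *s E1 + y *s E2)"
      using 0 by (simp add: algebra_simps eq_neg_iff_add_eq_0)
    have "z *s f 1 + w *s f 2 \<in> Es"
      by (intro vec.subspace_add[OF Es(1)] vec.subspace_scale[OF Es(1)] f)
    moreover have "z *s f 1 + w *s f 2 \<in> ?E"
      unfolding eq by (intro vec.span_neg vec.span_add vec.span_scale E_in)
    ultimately have "z *s f 1 + w *s f 2 \<in> {0}" unfolding Es(3)[symmetric] by (rule IntI)
    then have "z *s f 1 + w *s f 2 = 0" by simp
    then have zw: "z = 0 \<and> w = 0" using pair[of z 1 w 2] by simp
    then have "x *s E1 + y *s E2 + 0 *s F1 + 0 *s F2 = 0" using 0 by simp
    from basis0[OF this] show "x = 0 \<and> y = 0 \<and> z = 0 \<and> w = 0" using zw by simp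
  qed
  have "f 3 \<in> vec.span {f 1, f 2}"
  proof -
    have i12: "vec.independent {f 1, f 2}" "f 1 \<noteq> f 2"
      using independent_pair[of "f 1" "f 2"] pair[of _ 1 _ 2] by auto
    have "Es \<subseteq> vec.span {f 1, f 2}"
      by (rule vec.card_ge_dim_independent) (use i12 Es(2) f(1) in simp_all)
    then show ?thesis using f(1) by (rule subsetD)
  qed
  then obtain u t where f3: "f 3 = u *s f 1 + t *s f 2" using span_pair by blast
  have u0: "u \<noteq> 0"
  proof
    assume "u = 0"
    then have "1 *s f 3 + (- t) *s f 2 = 0" using f3 by simp
    then show False using pair[of 1 3 "- t" 2] by simp
  qed
  have t0: "t \<noteq> 0"
  proof
    assume "t = 0"
    then have "1 *s f 3 + (- u) *s f 1 = 0" using f3 by simp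
    then show False using pair[of 1 3 "- u" 1] by simp
  qed
  have b: "al (s 0) * be (s 1) - al (s 1) * be (s 0) \<noteq> 0" "al (s 0) * be (s 2) - al (s 2) * be (s 0) \<noteq> 0"
    "al (s 1) * be (s 2) - al (s 2) * be (s 1) \<noteq> 0"
    using brackets s_dist by simp_all
  obtain k where k: "k \<noteq> 0" "det (vector [veronese (const_vec (c (s 0))), veronese (const_vec (c (s 1))), veronese (const_vec (c (s 2))),
        veronese (const_vec (f 1)), veronese (const_vec (f 2)), veronese (const_vec (f 3)),
        veronese (e_vec C c f (s 0)), veronese (e_vec C c f (s 1)), veronese (e_vec C c f (s 2)), veronese (e_vec C c f (s 3))] :: 'm mpoly^10^10) =
     Const k * quad_form (H (f 1)) (H (f 2)) (s 0) (s 1) (s 2) (s 3)"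
    using det_veronese[OF ind u0 t0 b, where y = "\<lambda>n. H (f 1) (s n)" and z = "\<lambda>n. H (f 2) (s n)"]
    unfolding minor4_quad_form f3[symmetric] c_eq[symmetric] e_vec_def dotp_back_plane by blast
  have "det (Phi C c f \<sigma>) = Const k * quad_form (H (f 1)) (H (f 2)) (s 0) (s 1) (s 2) (s 3)"
    unfolding Phi_def Let_def det_transpose list.map s_def[symmetric] by (rule k(2))
  then show ?thesis using that[OF k(1) ind] unfolding s_def by blast
qed

text \<open>
  All generators vanish at \<open>line_points\<close>. Conversely, the ideal contains all
  generators that \<open>line_points_vanishing\<close> asks for.
\<close>

theorem I_tilde_eq_van:
  assumes quadruples: "\<And>\<sigma>. card \<sigma> = 4 \<Longrightarrow> \<sigma> \<in> collinear_quadruples C"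
    and aux: "\<And>\<sigma>. \<sigma> \<in> collinear_quadruples C \<Longrightarrow> auxiliary_points C \<sigma> (Estar \<sigma>) (f \<sigma>)"
  shows "I_tilde C c f = van line_points"
proof
  show sub: "I_tilde C c f \<subseteq> van line_points"
  proof (rule I_tilde_subset)
    show "minors3 (M_matrix C) \<subseteq> van line_points" by (rule minors_vanish)
    fix \<sigma> assume \<sigma>: "\<sigma> \<in> collinear_quadruples C"
    then have "card \<sigma> = 4" by (simp add: collinear_quadruples_def)
    from det_Phi[OF this aux[OF \<sigma>]] obtain k where "det (Phi C c (f \<sigma>) \<sigma>) =
        Const k * quad_form (H (f \<sigma> 1)) (H (f \<sigma> 2)) (sorted_list_of_set \<sigma> ! 0)
       (sorted_list_of_set \<sigma> ! 1) (sorted_list_of_set \<sigma> ! 2) (sorted_list_of_set \<sigma> ! 3)" by blast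
    then show "det (Phi C c (f \<sigma>) \<sigma>) \<in> van line_points"
      using van_mult[OF quad_form_vanishes] by simp
  qed (auto intro: van_0 van_add van_mult)
  show "van line_points \<subseteq> I_tilde C c f"
  proof
    fix g assume g: "g \<in> van line_points"
    let ?I = "I_tilde C c f"
    have J: "minors3 (M_matrix C) \<subseteq> ?I" "0 \<in> ?I" "\<And>g h. g \<in> ?I \<Longrightarrow> h \<in> ?I \<Longrightarrow> g + h \<in> ?I" "\<And>g h. g \<in> ?I \<Longrightarrow> h * g \<in> ?I"
      using I_tilde_ideal[where C = C and c = c and f = f] by blast+
    show "g \<in> ?I"
    proof (rule line_points_vanishing[OF J(2-4) sub _ _ _ two Pol_UNIV g])
      show "minor_XX (letter x) i j k \<in> ?I" if "x \<in> {2, 3}" for x i j k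
        using that J_minor_XX[OF J] by (auto simp: letter_eq_H)
      show "minor_XYZ (letter 2) (letter 3) a b i j k \<in> ?I" for a b i j k
        unfolding letter_eq_H by (rule J_minor_XYZ[OF J])
      fix i j k m :: 'm assume d: "distinct [i, j, k, m]"
      define \<sigma> where "\<sigma> = {i, j, k, m}"
      have card: "card \<sigma> = 4" using d by (simp add: \<sigma>_def)
      define s where "s n = sorted_list_of_set \<sigma> ! n" for n
      obtain x where x: "x \<noteq> 0" "independent4 E1 E2 (f \<sigma> 1) (f \<sigma> 2)"
        "det (Phi C c (f \<sigma>) \<sigma>) = Const x * quad_form (H (f \<sigma> 1)) (H (f \<sigma> 2)) (s 0) (s 1) (s 2) (s 3)"
        using det_Phi[OF card aux[OF quadruples[OF card]]] unfolding s_def by blast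
      have len: "length (sorted_list_of_set \<sigma>) = 4" using card by simp
      have "Const (1 / x) * det (Phi C c (f \<sigma>) \<sigma>) \<in> ?I"
        using I_tilde_ideal(5)[OF quadruples[OF card]] J(4) by blast
      then have "quad_form (H (f \<sigma> 1)) (H (f \<sigma> 2)) (s 0) (s 1) (s 2) (s 3) \<in> ?I"
        unfolding x(3) mult.assoc[symmetric] K_mult[symmetric] using x(1) by (simp add: K_1)
      moreover have "s 2 \<noteq> s 3" unfolding s_def using len by (simp add: nth_eq_iff_index_eq)
      ultimately have "quad_form (H F1) (H F2) (s 0) (s 1) (s 2) (s 3) \<in> ?I"
        by (intro quad_form_change_line[OF J _ x(2)])
      moreover have "{i, j, k, m} = {s 0, s 1, s 2, s 3}"
      proof -
        have "finite \<sigma>" by (simp add: \<sigma>_def)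
        then have "set (sorted_list_of_set \<sigma>) = \<sigma>" by (rule set_sorted_list_of_set)
        then have "{i, j, k, m} = set (sorted_list_of_set \<sigma>)" by (simp only: \<sigma>_def)
        also have "\<dots> = {s n | n. n < 4}" unfolding s_def set_conv_nth len ..
        also have "\<dots> = {s 0, s 1, s 2, s 3}"
          by (auto simp: numeral_eq_Suc less_Suc_eq)
        finally show ?thesis .
      qed
      moreover have neg: "- h \<in> ?I" if "h \<in> ?I" for h using J(4)[OF that, of "-1"] by simp
      let ?Q = "\<lambda>i j k m. quad_form (H F1) (H F2) i j k m \<in> ?I"
      have swap: "?Q b a d e" "?Q a d b e" "?Q a b e d" if "?Q a b d e" for a b d e
        using neg[OF that] by (simp_all only: quad_form_swap_first[of _ _ b a] quad_form_swap_middle[of _ _ a d b]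
            quad_form_swap_last[of _ _ a b e d])
      ultimately have "quad_form (H F1) (H F2) i j k m \<in> ?I"
        by (intro permutations_of_four[where Q = ?Q, OF swap _ _ d])
      then show "quad_form (letter 2) (letter 3) i j k m \<in> ?I" unfolding letter_eq_H .
    qed
  qed
qed

end

section \<open>The vanishing ideal of the line multiview variety\<close>

definition independent3 :: "complex^4 \<Rightarrow> complex^4 \<Rightarrow> complex^4 \<Rightarrow> bool" where
  "independent3 a b c \<longleftrightarrow> (\<forall>x y t. x *s a + y *s b + t *s c = 0 \<longrightarrow> x = 0 \<and> y = 0 \<and> t = 0)"

context line_cameras
begin

lemma center_eq: "center (C i) = {x. \<exists>t. x = t *s c i}"
  by (simp add: center_def kernel)

lemma line_avoids_centers:
  "proj_line (vec.span {a, b}) \<and> (\<forall>i. \<not> center (C i) \<subseteq> vec.span {a, b}) \<longleftrightarrow> (\<forall>i. independent3 a b (c i))"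
proof (intro iffI conjI allI)
  fix i assume line: "proj_line (vec.span {a, b}) \<and> (\<forall>i. \<not> center (C i) \<subseteq> vec.span {a, b})"
  show "independent3 a b (c i)"
    unfolding independent3_def
  proof (intro allI impI)
    fix x y t assume 0: "x *s a + y *s b + t *s c i = 0"
    have "t = 0"
    proof (rule ccontr)
      assume t: "t \<noteq> 0"
      have "c i = (- x / t) *s a + (- y / t) *s b"
      proof -
        have "t *s c i = (- x) *s a + (- y) *s b" using 0 by (simp add: vec_eq_iff eq_neg_iff_add_eq_0 algebra_simps)
        then have "(1 / t) *s (t *s c i) = (1 / t) *s ((- x) *s a + (- y) *s b)" by simp
        then show ?thesis using t by (simp add: vec_eq_iff algebra_simps)
      qed
      then have "c i \<in> vec.span {a, b}" using span_pair by blast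
      then have "center (C i) \<subseteq> vec.span {a, b}" unfolding center_eq by (auto intro: vec.span_scale)
      then show False using line by blast
    qed
    then show "x = 0 \<and> y = 0 \<and> t = 0" using 0 line proj_line_span_pair[of a b] by simp
  qed
next
  assume ind: "\<forall>i. independent3 a b (c i)"
  show "proj_line (vec.span {a, b})"
    unfolding proj_line_span_pair
  proof (intro allI impI)
    fix x y assume "x *s a + y *s b = 0"
    then have "x *s a + y *s b + 0 *s c undefined = 0" by simp
    then show "x = 0 \<and> y = 0" using ind unfolding independent3_def by blast
  qed
  fix i
  show "\<not> center (C i) \<subseteq> vec.span {a, b}"
  proof
    assume "center (C i) \<subseteq> vec.span {a, b}"
    then have "1 *s c i \<in> vec.span {a, b}" unfolding center_eq by blast
    then obtain x y where "1 *s c i = x *s a + y *s b" unfolding span_pair by blast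
    then have "x *s a + y *s b + (-1) *s c i = 0" by (simp add: vec_eq_iff)
    then have "(-1 :: complex) = 0" using ind unfolding independent3_def by blast
    then show False by simp
  qed
qed

lemma image_nonzero:
  assumes "independent3 a b (c i)"
  shows "cprod (C i *v a) (C i *v b) \<noteq> 0"
proof (rule cross_product_nonzero)
  fix x y assume "x *s (C i *v a) + y *s (C i *v b) = 0"
  then have "C i *v (x *s a + y *s b) = 0" by (simp add: matrix_vector_right_distrib vector_scalar_commute)
  then obtain t where "x *s a + y *s b = t *s c i" using kernel by blast
  then have "x *s a + y *s b + (- t) *s c i = 0" by (simp add: vec_eq_iff)
  then show "x = 0 \<and> y = 0" using assms unfolding independent3_def by blast
qed

lemma ev_coordinates: "ev (\<lambda>x i. (frame i *v y i) $ x) f = eval_mpoly f y"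
proof -
  have "point (\<lambda>x i. (frame i *v y i) $ x) = y"
    by (rule ext) (simp add: point_def matrix_vector_mul_assoc frame_inverse)
  then show ?thesis by (simp add: ev_def)
qed

lemma eval_H_image:
  assumes "y i = t *s cprod (C i *v a) (C i *v b)"
  shows "eval_mpoly (H a i) y = 0" "eval_mpoly (H b i) y = 0"
  using cross_product_orthogonal[where u = "C i *v a" and v = "C i *v b"]
  by (simp_all add: eval_H assms mult.left_commute flip: sum_distrib_left)

text \<open>
  If the line spanned by \<open>a, b\<close> does not meet the line of centres, then the equations
  \<open>h\<^sub>i \<bullet> a = h\<^sub>i \<bullet> b = 0\<close> can be solved for the letters
  \<open>Y\<close> and \<open>Z\<close> by Cramer's rule.
\<close>

lemma vanishes_on_images_skew:
  assumes f: "f \<in> van line_points" and y: "\<And>i. y i = t i *s cprod (C i *v a) (C i *v b)" "\<And>i. t i \<noteq> 0"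
    and a: "a = a1 *s E1 + a2 *s E2 + a3 *s F1 + a4 *s F2"
    and b: "b = b1 *s E1 + b2 *s E2 + b3 *s F1 + b4 *s F2"
    and D: "a3 * b4 - a4 * b3 \<noteq> 0"
  shows "eval_mpoly f y = 0"
proof -
  have ind: "independent3 a b (c i)" for i
    unfolding independent3_def
  proof (intro allI impI)
    fix x z s assume "x *s a + z *s b + s *s c i = 0"
    then have "(x * a1 + z * b1 + s * al i) *s E1 + (x * a2 + z * b2 + s * be i) *s E2 +
        (x * a3 + z * b3) *s F1 + (x * a4 + z * b4) *s F2 = 0"
      unfolding a b c_eq by (simp add: vec_eq_iff algebra_simps)
    from basis0[OF this] have e: "x * a1 + z * b1 + s * al i = 0" "x * a2 + z * b2 + s * be i = 0"
      "x * a3 + z * b3 = 0" "x * a4 + z * b4 = 0" by auto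
    have "x * (a3 * b4 - a4 * b3) = b4 * (x * a3 + z * b3) - b3 * (x * a4 + z * b4)"
      "z * (a3 * b4 - a4 * b3) = a3 * (x * a4 + z * b4) - a4 * (x * a3 + z * b3)"
      by (simp_all add: algebra_simps)
    then have xz: "x = 0" "z = 0" using D unfolding e by simp_all
    then show "x = 0 \<and> z = 0 \<and> s = 0" using e coordinates_nonzero[of i] by auto
  qed
  have y0: "y i \<noteq> 0" for i using image_nonzero[OF ind] y by simp
  define l where "l i = eval_mpoly (letter 1 i) y" for i
  define Y where "Y i = eval_mpoly (letter 2 i) y" for i
  define Z where "Z i = eval_mpoly (letter 3 i) y" for i
  let ?D = "a3 * b4 - a4 * b3"
  have ea: "a1 * (- be i * l i) + a2 * (al i * l i) + a3 * Y i + a4 * Z i = 0" for i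
    using eval_H_image(1)[where y = y, OF y(1)[of i]] unfolding a H_add H_scale H_E1 H_E2 H_F
    by (simp add: eval_mpoly_add eval_mpoly_mult eval_mpoly_Const l_def Y_def Z_def)
  have eb: "b1 * (- be i * l i) + b2 * (al i * l i) + b3 * Y i + b4 * Z i = 0" for i
    using eval_H_image(2)[where y = y, OF y(1)[of i]] unfolding b H_add H_scale H_E1 H_E2 H_F
    by (simp add: eval_mpoly_add eval_mpoly_mult eval_mpoly_Const l_def Y_def Z_def)
  have Y: "Y i = l i * ((a4 * b2 - b4 * a2) / ?D * al i + (b4 * a1 - a4 * b1) / ?D * be i)" for i
  proof -
    have "?D * Y i = b4 * (a1 * (- be i * l i) + a2 * (al i * l i) + a3 * Y i + a4 * Z i)
        - a4 * (b1 * (- be i * l i) + b2 * (al i * l i) + b3 * Y i + b4 * Z i)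
        + l i * ((a4 * b2 - b4 * a2) * al i + (b4 * a1 - a4 * b1) * be i)" by (simp add: algebra_simps)
    then have "?D * Y i = l i * ((a4 * b2 - b4 * a2) * al i + (b4 * a1 - a4 * b1) * be i)" unfolding ea eb by simp
    then have "Y i = l i * ((a4 * b2 - b4 * a2) * al i + (b4 * a1 - a4 * b1) * be i) / ?D"
      using D by (simp add: eq_divide_eq mult.commute)
    then show ?thesis by (simp add: add_divide_distrib distrib_left)
  qed
  have Z: "Z i = l i * ((b3 * a2 - a3 * b2) / ?D * al i + (a3 * b1 - b3 * a1) / ?D * be i)" for i
  proof -
    have "?D * Z i = a3 * (b1 * (- be i * l i) + b2 * (al i * l i) + b3 * Y i + b4 * Z i)
        - b3 * (a1 * (- be i * l i) + a2 * (al i * l i) + a3 * Y i + a4 * Z i)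
        + l i * ((b3 * a2 - a3 * b2) * al i + (a3 * b1 - b3 * a1) * be i)" by (simp add: algebra_simps)
    then have "?D * Z i = l i * ((b3 * a2 - a3 * b2) * al i + (a3 * b1 - b3 * a1) * be i)" unfolding ea eb by simp
    then have "Z i = l i * ((b3 * a2 - a3 * b2) * al i + (a3 * b1 - b3 * a1) * be i) / ?D"
      using D by (simp add: eq_divide_eq mult.commute)
    then show ?thesis by (simp add: add_divide_distrib distrib_left)
  qed
  have coords: "(\<lambda>x i. (frame i *v y i) $ x) = pt l (\<lambda>i. (a4 * b2 - b4 * a2) / ?D * al i + (b4 * a1 - a4 * b1) / ?D * be i)
      (\<lambda>i. (b3 * a2 - a3 * b2) / ?D * al i + (a3 * b1 - b3 * a1) / ?D * be i)" (is "?p = ?q")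
  proof (intro ext)
    fix x i
    have "?p x i = eval_mpoly (letter x i) y" by (simp add: eval_letter)
    then show "?p x i = ?q x i" using exhaust_3[of x] Y[of i] Z[of i] by (auto simp: l_def Y_def Z_def)
  qed
  have l0: "l i \<noteq> 0" for i
  proof
    assume "l i = 0"
    then have "(frame i *v y i) $ x = 0" for x
      using exhaust_3[of x] Y[of i] Z[of i] by (auto simp: l_def Y_def Z_def eval_letter)
    then have "frame i *v y i = 0" by (simp add: vec_eq_iff)
    then have "matrix_inv (frame i) *v (frame i *v y i) = 0" by simp
    then show False using y0[of i] by (simp add: matrix_vector_mul_assoc frame_inverse)
  qed
  have "?p \<in> line_points" unfolding coords by (rule line_pointsI) (rule l0)
  then have "ev ?p f = 0" using f unfolding van_def by blast
  then show ?thesis unfolding ev_coordinates .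
qed

lemma eventually_nonzero_quadratic:
  fixes p q r s :: complex
  shows "\<forall>\<^sub>F t in at 0. (p + t) * (q + t) - r * s \<noteq> 0"
proof -
  define S where "S = {t. (p + t) * (q + t) - r * s = 0}"
  define k where "k i = (if i = 0 then p * q - r * s else if i = 1 then p + q else 1)" for i :: nat
  have "(\<Sum>i\<le>2. k i * t ^ i) = (p + t) * (q + t) - r * s" for t
    by (simp add: k_def numeral_2_eq_2 algebra_simps)
  then have "S = {t. (\<Sum>i\<le>2. k i * t ^ i) = 0}" by (simp add: S_def)
  moreover have "k 2 \<noteq> 0" by (simp add: k_def)
  then have "\<exists>i\<le>2. k i \<noteq> 0" by (intro exI[of _ 2]) simp
  then have "finite {t. (\<Sum>i\<le>2. k i * t ^ i) = 0}" using polyfun_finite_roots[of k 2] by simp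
  ultimately have "finite S" by simp
  then have "open (- (S - {0}))" by (intro open_Compl finite_imp_closed) auto
  then show ?thesis
    unfolding eventually_at_topological by (intro exI[of _ "- (S - {0})"]) (auto simp: S_def)
qed

text \<open>
  A line that meets the line of centres is a limit of lines that do not: move the two spanning
  points in the directions \<open>F1\<close> and \<open>F2\<close>.
\<close>

lemma vanishes_on_images:
  assumes f: "f \<in> van line_points" and y: "\<And>i. y i = t i *s cprod (C i *v a) (C i *v b)" "\<And>i. t i \<noteq> 0"
  shows "eval_mpoly f y = 0"
proof -
  obtain a1 a2 a3 a4 where a: "a = a1 *s E1 + a2 *s E2 + a3 *s F1 + a4 *s F2" using independent4_span[OF basis] .
  obtain b1 b2 b3 b4 where b: "b = b1 *s E1 + b2 *s E2 + b3 *s F1 + b4 *s F2" using independent4_span[OF basis] .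
  define z where "z s i = t i *s cprod (C i *v (a + s *s F1)) (C i *v (b + s *s F2))" for s i
  define q where "q s = (\<lambda>x i. (frame i *v z s i) $ x)" for s
  have "ev (q 0) f = 0"
  proof (rule ev_eq_0_limit[OF Pol_UNIV])
    fix x i
    have "isCont (\<lambda>s. z s i $ 1) 0" "isCont (\<lambda>s. z s i $ 2) 0" "isCont (\<lambda>s. z s i $ 3) 0"
      by (simp_all add: z_def cprod_def matrix_vector_right_distrib vector_scalar_commute)
    then show "isCont (\<lambda>s. q s x i) 0"
      unfolding q_def matrix_vector_mult_def vec_lambda_beta sum_3
      by (intro continuous_add continuous_mult continuous_const)
  next
    have "\<forall>\<^sub>F s in at 0. (a3 + s) * (b4 + s) - a4 * b3 \<noteq> 0" by (rule eventually_nonzero_quadratic)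
    then show "\<forall>\<^sub>F s in at 0. ev (q s) f = 0"
    proof (rule eventually_mono)
      fix s assume D: "(a3 + s) * (b4 + s) - a4 * b3 \<noteq> 0"
      show "ev (q s) f = 0"
        unfolding q_def ev_coordinates
      proof (rule vanishes_on_images_skew[OF f _ y(2) _ _ D, where ?a1.0 = a1 and ?a2.0 = a2 and ?b1.0 = b1 and ?b2.0 = b2])
        show "z s i = t i *s cprod (C i *v (a + s *s F1)) (C i *v (b + s *s F2))" for i
          by (simp only: z_def)
      qed (simp_all add: a b vec_eq_iff algebra_simps)
    qed
  qed
  moreover have "z 0 = y" by (intro ext) (simp add: z_def y)
  ultimately show ?thesis by (simp add: q_def ev_coordinates)
qed

definition line_images :: "('m \<Rightarrow> (complex^3) set) set" where
  "line_images = {line_image C a b | a b. proj_line (vec.span {a, b}) \<and>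
     (\<forall>i. \<not> center (C i) \<subseteq> vec.span {a, b})}"

lemma proj_point_line_images:
  assumes "P \<in> line_images"
  shows "proj_point (P i)"
proof -
  obtain a b where P: "P = line_image C a b" "\<forall>i. independent3 a b (c i)"
    using assms unfolding line_images_def line_avoids_centers by blast
  have "cprod (C i *v a) (C i *v b) \<noteq> 0" using P image_nonzero by blast
  then have "vec.dim {cprod (C i *v a) (C i *v b)} = 1"
    by (subst vec.dim_eq_card_independent) auto
  then show ?thesis unfolding P line_image_def proj_point_def by (simp add: vec.dim_span)
qed

text \<open>
  One inclusion is \<open>vanishes_on_images\<close>. For the other one, a point of
  \<open>line_points\<close> is the image of the line spanned by \<open>u2 *s E1 - u1 *s E2 +
  F1\<close> and \<open>v2 *s E1 - v1 *s E2 + F2\<close>, which all planes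
  \<open>h\<^sub>i\<close> contain.
\<close>

lemma vanishing_ideal_images: "vanishing_ideal line_images = van line_points"
proof
  show "van line_points \<subseteq> vanishing_ideal line_images"
  proof
    fix f assume f: "f \<in> van line_points"
    show "f \<in> vanishing_ideal line_images"
      unfolding vanishing_ideal_def vanishes_at_def
    proof (intro CollectI ballI allI impI)
      fix P x assume P: "P \<in> line_images" and x: "\<forall>j. x j \<in> P j \<and> x j \<noteq> 0"
      then obtain a b where ab: "P = line_image C a b" unfolding line_images_def by blast
      have "\<exists>t. x i = t *s cprod (C i *v a) (C i *v b)" for i
      proof -
        have "x i \<in> vec.span {cprod (C i *v a) (C i *v b)}" using x unfolding ab line_image_def by simp
        then show ?thesis unfolding vec.span_singleton by blast
      qed
      then have "\<exists>t. \<forall>i. x i = t i *s cprod (C i *v a) (C i *v b)" by (intro choice allI)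
      then obtain t where t: "\<And>i. x i = t i *s cprod (C i *v a) (C i *v b)" by blast
      moreover have "t i \<noteq> 0" for i
      proof
        assume "t i = 0"
        then have "x i = 0" using t[of i] by simp
        then show False using x by simp
      qed
      ultimately show "eval_mpoly f x = 0" by (rule vanishes_on_images[OF f])
    qed
  qed
  show "vanishing_ideal line_images \<subseteq> van line_points"
  proof
    fix f assume f: "f \<in> vanishing_ideal line_images"
    show "f \<in> van line_points"
      unfolding van_def line_points_def
    proof (intro CollectI ballI, clarify)
      fix l :: "'m \<Rightarrow> complex" and u1 u2 v1 v2 assume l: "\<forall>i. l i \<noteq> 0"
      define p where "p = pt l (lin u1 u2) (lin v1 v2)"
      define a where "a = u2 *s E1 + (- u1) *s E2 + 1 *s F1 + 0 *s F2"
      define b where "b = v2 *s E1 + (- v1) *s E2 + 0 *s F1 + 1 *s F2"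
      have ind: "independent3 a b (c i)" for i
        unfolding independent3_def
      proof (intro allI impI)
        fix x z s assume "x *s a + z *s b + s *s c i = 0"
        then have "(x * u2 + z * v2 + s * al i) *s E1 + (- x * u1 - z * v1 + s * be i) *s E2 + x *s F1 + z *s F2 = 0"
          unfolding a_def b_def c_eq by (simp add: vec_eq_iff algebra_simps)
        from basis0[OF this] show "x = 0 \<and> z = 0 \<and> s = 0" using coordinates_nonzero[of i] by auto
      qed
      then have P: "line_image C a b \<in> line_images"
        unfolding line_images_def using line_avoids_centers[of a b] by blast
      have Ha: "eval_mpoly (H a i) (point p) = 0" and Hb: "eval_mpoly (H b i) (point p) = 0" for i
        unfolding a_def b_def ev_def[symmetric] H_add H_scale H_E1 H_E2 H_F
        by (simp_all add: ev_simps p_def algebra_simps)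
      have "point p i \<in> line_image C a b i \<and> point p i \<noteq> 0" for i
      proof
        have "cprod (C i *v a) (C i *v b) \<noteq> 0" by (rule image_nonzero[OF ind])
        then obtain t where "point p i = t *s cprod (C i *v a) (C i *v b)"
          using cross_product_multiple[of "C i *v a" "C i *v b" "point p i"] Ha[of i] Hb[of i]
          unfolding eval_H by blast
        then show "point p i \<in> line_image C a b i"
          by (simp add: line_image_def vec.span_base vec.span_scale)
        have "ev p (letter 1 i) = l i" by (simp add: ev_simps p_def)
        then have "(frame i *v point p i) $ 1 \<noteq> 0" using l by (simp add: ev_def eval_letter)
        then show "point p i \<noteq> 0" by auto
      qed
      moreover have "vanishes_at f (line_image C a b)" using f P by (simp add: vanishing_ideal_def)
      ultimately have "eval_mpoly f (point p) = 0"
        unfolding vanishes_at_def by (elim allE[of _ "point p"]) simp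
      then show "ev (pt l (lin u1 u2) (lin v1 v2)) f = 0"
        by (simp add: ev_def p_def)
    qed
  qed
qed

theorem vanishing_ideal_variety: "vanishing_ideal (line_multiview_variety C) = van line_points"
  unfolding line_multiview_variety_def line_images_def[symmetric] vanishing_ideal_images[symmetric]
  by (rule vanishing_ideal_closure) (rule proj_point_line_images)

end

section \<open>Coordinates adapted to the cameras\<close>

text \<open>
  A camera of rank three has a right inverse, and the centre together with the columns of the
  right inverse is a basis.
\<close>

lemma camera_kernel:
  fixes A :: "complex^4^3"
  assumes "camera A" "c \<in> center A" "c \<noteq> 0"
  shows "A *v x = 0 \<longleftrightarrow> (\<exists>t. x = t *s c)"
proof -
  have dim: "vec.dim (rows A) = 3" using assms(1) by (simp add: camera_def row_rank_def_gen)
  have rows: "rows A = range (\<lambda>i. row i A)" by (auto simp: rows_def)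
  have fin: "finite (rows A)" unfolding rows by simp
  have "card (rows A) \<le> 3" unfolding rows using card_image_le[of UNIV "\<lambda>i::3. row i A"] by simp
  moreover have "3 \<le> card (rows A)" using vec.dim_le_card'[OF fin] dim by simp
  ultimately have card: "card (rows A) = 3" by simp
  then have inj: "inj (\<lambda>i. row i A)" unfolding rows by (intro eq_card_imp_inj_on) auto
  have ind: "vec.independent (rows A)"
    by (rule vec.card_le_dim_spanning[of "rows A" "rows A"]) (use dim card fin in \<open>simp_all add: vec.span_superset\<close>)
  have "k i = 0" if k: "(\<Sum>i\<in>UNIV. k i *s row i A) = 0" for k i
  proof -
    let ?u = "\<lambda>v. k (the_inv (\<lambda>i. row i A) v)"
    have "(\<Sum>v\<in>rows A. ?u v *s v) = 0"
      unfolding rows sum.reindex[OF inj] using k by (simp add: the_inv_f_f[OF inj])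
    from vec.independentD[OF ind fin _ this, of "row i A"] show ?thesis
      by (simp add: rows the_inv_f_f[OF inj])
  qed
  then obtain B :: "complex^3^4" where B: "A ** B = mat 1"
    using matrix_right_invertible_independent_rows[of A] by blast
  have AB: "A *v (B *v y) = y" for y by (simp add: matrix_vector_mul_assoc B)
  have c0: "A *v c = 0" using assms(2) by (simp add: center_def)
  have A_comb: "A *v (t *s c + x1 *s (B *v axis 1 1) + x2 *s (B *v axis 2 1) + x3 *s (B *v axis 3 1)) =
      x1 *s axis 1 1 + x2 *s axis 2 1 + x3 *s axis 3 1" for t x1 x2 x3
    by (simp add: matrix_vector_right_distrib vector_scalar_commute AB c0)
  have axes: "x1 = 0 \<and> x2 = 0 \<and> x3 = 0" if "x1 *s axis 1 1 + x2 *s axis 2 1 + x3 *s axis 3 1 = (0 :: complex^3)" for x1 x2 x3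
    using that by (simp add: vec_eq_iff forall_3 axis_def)
  have "independent4 c (B *v axis 1 1) (B *v axis 2 1) (B *v axis 3 1)"
    unfolding independent4_def
  proof (intro allI impI)
    fix t x1 x2 x3 assume 0: "t *s c + x1 *s (B *v axis 1 1) + x2 *s (B *v axis 2 1) + x3 *s (B *v axis 3 1) = 0"
    then have "x1 = 0 \<and> x2 = 0 \<and> x3 = 0" using A_comb[of t x1 x2 x3] axes by simp
    then show "t = 0 \<and> x1 = 0 \<and> x2 = 0 \<and> x3 = 0" using 0 assms(3) by simp
  qed
  from independent4_span[OF this, of x] obtain t x1 x2 x3 where
    x: "x = t *s c + x1 *s (B *v axis 1 1) + x2 *s (B *v axis 2 1) + x3 *s (B *v axis 3 1)" .
  show ?thesis
  proof
    assume "A *v x = 0"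
    then have "x1 = 0 \<and> x2 = 0 \<and> x3 = 0" using axes unfolding x A_comb by blast
    then show "\<exists>t. x = t *s c" unfolding x by auto
  next
    assume "\<exists>t. x = t *s c"
    then show "A *v x = 0" using c0 by (auto simp: vector_scalar_commute)
  qed
qed

lemma extend_to_basis4:
  assumes "\<And>x y. x *s u + y *s v = 0 \<Longrightarrow> x = 0 \<and> y = 0"
  obtains p q where "independent4 u v p q"
proof -
  have ind: "vec.independent {u, v}" "u \<noteq> v" using independent_pair[OF assms] by blast+
  define B where "B = vec.extend_basis {u, v}"
  have B: "{u, v} \<subseteq> B" "vec.independent B" "vec.span B = UNIV"
    unfolding B_def using vec.extend_basis_superset[OF ind(1)] vec.independent_extend_basis[OF ind(1)]
      vec.span_extend_basis[OF ind(1)] by blast+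
  have fin: "finite B" using B(2) vec.finiteI_independent by blast
  have "vec.dim (UNIV :: (complex^4) set) = card B"
    by (rule vec.dim_eq_card) (use B in auto)
  then have "card B = 4" by (simp add: card_cart_basis)
  then have "card (B - {u, v}) = 2" using B(1) ind(2) by (simp add: card_Diff_subset)
  then obtain p q where pq: "B - {u, v} = {p, q}" "p \<noteq> q" by (auto simp: card_2_iff)
  have ne: "p \<noteq> u" "p \<noteq> v" "q \<noteq> u" "q \<noteq> v" and Beq: "B = {u, v, p, q}" using pq(1) B(1) by blast+
  have "independent4 u v p q"
    unfolding independent4_def
  proof (intro allI impI)
    fix a b d e assume 0: "a *s u + b *s v + d *s p + e *s q = 0"
    let ?k = "\<lambda>w. if w = u then a else if w = v then b else if w = p then d else e"
    have "(\<Sum>w\<in>B. ?k w *s w) = 0"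
      unfolding Beq using 0 ne ind(2) pq(2) by (simp add: add.assoc)
    then have "?k w = 0" if "w \<in> B" for w by (rule vec.independentD[OF B(2) fin subset_refl _ that])
    from this[of u] this[of v] this[of p] this[of q] show "a = 0 \<and> b = 0 \<and> d = 0 \<and> e = 0"
      using ne ind(2) pq(2) by (simp add: Beq)
  qed
  then show ?thesis using that by blast
qed

lemma collinear_cameras_coordinates:
  fixes C :: "'m::{finite,linorder} \<Rightarrow> complex^4^3"
  assumes arr: "camera_arrangement C" and col: "collinear_cameras C UNIV" and c: "\<And>i. c i \<in> center (C i) \<and> c i \<noteq> 0"
  obtains al be E1 E2 F1 F2 where "line_cameras C c al be E1 E2 F1 F2"
proof -
  have card: "CARD('m) \<ge> 2" and cam: "\<And>i. camera (C i)" and inj: "inj (\<lambda>i. center (C i))"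
    using arr by (auto simp: camera_arrangement_def)
  have kernel: "C i *v x = 0 \<longleftrightarrow> (\<exists>t. x = t *s c i)" for i x
    using camera_kernel[OF cam] c by blast
  have pair: "x = 0 \<and> y = 0" if "i \<noteq> j" "x *s c i + y *s c j = 0" for i j x y
  proof -
    have x: "x = 0"
    proof (rule ccontr)
      assume "x \<noteq> 0"
      define s where "s = - y / x"
      have ci: "c i = s *s c j"
        using that(2) \<open>x \<noteq> 0\<close> by (simp add: s_def vec_eq_iff field_simps add_eq_0_iff2)
      then have s: "s \<noteq> 0" using c[of i] by auto
      have "center (C i) = center (C j)"
        unfolding center_def kernel
      proof (intro Collect_cong iffI; elim exE)
        fix v t assume "v = t *s c i"
        then have "v = (t * s) *s c j" by (simp add: ci)
        then show "\<exists>t. v = t *s c j" by blast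
      next
        fix v t assume "v = t *s c j"
        then have "v = (t / s) *s c i" using s by (simp add: ci)
        then show "\<exists>t. v = t *s c i" by blast
      qed
      then show False using inj that(1) by (auto dest: injD)
    qed
    then show ?thesis using that c[of j] by simp
  qed
  obtain i0 i1 :: 'm where i01: "i0 \<noteq> i1"
    using card card_le_Suc0_iff_eq[of "UNIV :: 'm set"] by auto
  obtain L where L: "vec.subspace L" "vec.dim L = 2" "\<And>i. center (C i) \<subseteq> L"
    using col by (auto simp: collinear_cameras_def proj_line_def)
  have cL: "c i \<in> L" for i using L(3) c by blast
  have ind: "vec.independent {c i0, c i1}" "c i0 \<noteq> c i1"
    using independent_pair[of "c i0" "c i1"] pair[OF i01] by blast+
  have "L \<subseteq> vec.span {c i0, c i1}"
    by (rule vec.card_ge_dim_independent) (use ind L(2) cL in simp_all)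
  then have "\<exists>a. c i = fst a *s c i0 + snd a *s c i1" for i
  proof -
    obtain x y where "c i = x *s c i0 + y *s c i1"
      using subsetD[OF \<open>L \<subseteq> vec.span {c i0, c i1}\<close> cL[of i]] unfolding span_pair by blast
    then show ?thesis by (intro exI[of _ "(x, y)"]) simp
  qed
  then have "\<exists>a. \<forall>i. c i = fst (a i) *s c i0 + snd (a i) *s c i1" by (intro choice allI)
  then obtain a where a: "\<And>i. c i = fst (a i) *s c i0 + snd (a i) *s c i1" by blast
  obtain F1 F2 where basis: "independent4 (c i0) (c i1) F1 F2"
    using extend_to_basis4[OF pair[OF i01]] by blast
  have "line_cameras C c (\<lambda>i. fst (a i)) (\<lambda>i. snd (a i)) (c i0) (c i1) F1 F2"
  proof
    fix i j :: 'm assume ij: "i \<noteq> j"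
    show "fst (a i) * snd (a j) - fst (a j) * snd (a i) \<noteq> 0"
    proof
      assume 0: "fst (a i) * snd (a j) - fst (a j) * snd (a i) = 0"
      have "snd (a j) *s c i + (- snd (a i)) *s c j = (fst (a i) * snd (a j) - fst (a j) * snd (a i)) *s c i0"
        by (subst a[of i], subst a[of j]) (simp add: vec_eq_iff algebra_simps)
      then have 1: "snd (a i) = 0" using pair[OF ij, of "snd (a j)" "- snd (a i)"] unfolding 0 by simp
      have "fst (a j) *s c i + (- fst (a i)) *s c j = - ((fst (a i) * snd (a j) - fst (a j) * snd (a i)) *s c i1)"
        by (subst a[of i], subst a[of j]) (simp add: vec_eq_iff algebra_simps)
      then have 2: "fst (a i) = 0" using pair[OF ij, of "fst (a j)" "- fst (a i)"] unfolding 0 by simp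
      show False using a[of i] c[of i] 1 2 by simp
    qed
  qed (rule kernel a basis card)+
  then show ?thesis using that by blast
qed

theorem corollary6p5:
  fixes C :: "'m::{finite,linorder} \<Rightarrow> complex^4^3"
    and c :: "'m \<Rightarrow> complex^4"
    and Estar :: "'m set \<Rightarrow> (complex^4) set"
    and f :: "'m set \<Rightarrow> 3 \<Rightarrow> complex^4"
  assumes "camera_arrangement C"
    and "collinear_cameras C UNIV"
    and "\<And>i. c i \<in> center (C i) \<and> c i \<noteq> 0"
    and "\<And>\<sigma>. \<sigma> \<in> collinear_quadruples C \<Longrightarrow> auxiliary_points C \<sigma> (Estar \<sigma>) (f \<sigma>)"
  shows "I_tilde C c f = vanishing_ideal (line_multiview_variety C)"
proof -
  obtain al be E1 E2 F1 F2 where "line_cameras C c al be E1 E2 F1 F2"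
    using collinear_cameras_coordinates[OF assms(1-3)] .
  then interpret line_cameras C c al be E1 E2 F1 F2 .
  have "\<sigma> \<in> collinear_quadruples C" if "card \<sigma> = 4" for \<sigma>
    using assms(2) that by (auto simp: collinear_quadruples_def collinear_cameras_def)
  then show ?thesis
    unfolding vanishing_ideal_variety using assms(4) by (rule I_tilde_eq_van)
qed

end
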